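(* Let $\theta$ be an irrational number and $\gamma\in C(\mathbb{T})$ a non-negative function. Let $A_\theta=C^*(u,v)$ be the universal irrational rotation $C^*$-algebra with unitary generators $u,v$ satisfying $vu=e^{2\pi i\theta}uv$. Then the $*$-homomorphism $\varphi$ from $A_{\theta,\gamma}=C^*(x,w)$ onto the $C^*$-subalgebra $C^*(u\gamma(v)^{1/2},v)$ of $A_\theta$ determined by $\varphi(x)=u\gamma(v)^{1/2}$ and $\varphi(w)=v$ is an isomorphism.
   Context: $\mathbb{T}$ is the unit circle. $A_{\theta,\gamma}=C^*(x,w)$ is the universal unital $C^*$-algebra generated by elements $x,w$ subject to the relations $w^*w=ww^*=1$, $x^*x=\gamma(w)$, $xx^*=\gamma(e^{-2\pi i\theta}w)$, $xw=e^{-2\pi i\theta}wx$ (functions of the unitary $w$ are taken by continuous functional calculus). Universality means that whenever $x',w'$ in some $C^*$-algebra satisfy the same relations, there is a $*$-homomorphism of $A_{\theta,\gamma}$ onto $C^*(x',w')$ with $x\mapsto x'$, $w\mapsto w'$. The elements $u\gamma(v)^{1/2}$ and $v$ of $A_\theta$ satisfy these relations, so $\varphi$ exists. *)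

theory Defs
  imports "HOL-Analysis.Analysis" "HOL-Algebra.Subrings"
begin

section \<open>Unital C*-algebras\<close>

definition complex_ring :: "complex ring" where
  "complex_ring = \<lparr>carrier = UNIV, mult = (*), one = 1, zero = 0, add = (+)\<rparr>"

record 'a cstar = "(complex, 'a) module" +
  star :: "'a \<Rightarrow> 'a"
  nrm :: "'a \<Rightarrow> real"

text \<open>The norm distance is cut off outside the carrier only because \<^locale>\<open>Metric_space\<close>
  requires non-negativity and symmetry on the whole type.\<close>

definition cstar_dist :: "'a cstar \<Rightarrow> 'a \<Rightarrow> 'a \<Rightarrow> real" where
  "cstar_dist A a b =
    (if a \<in> carrier A \<and> b \<in> carrier A then nrm A (a \<ominus>\<^bsub>A\<^esub> b) else 0)"

text \<open>The library locale \<open>algebra\<close> demands a commutative multiplication, hence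
  \<^locale>\<open>module\<close> together with \<^locale>\<open>ring\<close>. The zero algebra is allowed.\<close>

locale cstar_algebra = module complex_ring A + ring A for A :: "'a cstar" (structure) +
  assumes smult_mult_left:
      "\<lbrakk>a \<in> carrier A; b \<in> carrier A\<rbrakk> \<Longrightarrow> (c \<odot> a) \<otimes> b = c \<odot> (a \<otimes> b)"
    and smult_mult_right:
      "\<lbrakk>a \<in> carrier A; b \<in> carrier A\<rbrakk> \<Longrightarrow> a \<otimes> (c \<odot> b) = c \<odot> (a \<otimes> b)"
    and star_closed: "a \<in> carrier A \<Longrightarrow> star A a \<in> carrier A"
    and star_star: "a \<in> carrier A \<Longrightarrow> star A (star A a) = a"
    and star_add:
      "\<lbrakk>a \<in> carrier A; b \<in> carrier A\<rbrakk> \<Longrightarrow> star A (a \<oplus> b) = star A a \<oplus> star A b"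
    and star_smult: "a \<in> carrier A \<Longrightarrow> star A (c \<odot> a) = cnj c \<odot> star A a"
    and star_mult:
      "\<lbrakk>a \<in> carrier A; b \<in> carrier A\<rbrakk> \<Longrightarrow> star A (a \<otimes> b) = star A b \<otimes> star A a"
    and nrm_nonneg: "a \<in> carrier A \<Longrightarrow> 0 \<le> nrm A a"
    and nrm_eq_zero: "a \<in> carrier A \<Longrightarrow> nrm A a = 0 \<longleftrightarrow> a = \<zero>"
    and nrm_triangle:
      "\<lbrakk>a \<in> carrier A; b \<in> carrier A\<rbrakk> \<Longrightarrow> nrm A (a \<oplus> b) \<le> nrm A a + nrm A b"
    and nrm_smult: "a \<in> carrier A \<Longrightarrow> nrm A (c \<odot> a) = cmod c * nrm A a"
    and nrm_mult:
      "\<lbrakk>a \<in> carrier A; b \<in> carrier A\<rbrakk> \<Longrightarrow> nrm A (a \<otimes> b) \<le> nrm A a * nrm A b"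
    and cstar_identity: "a \<in> carrier A \<Longrightarrow> nrm A (star A a \<otimes> a) = (nrm A a)\<^sup>2"
    and complete: "Metric_space.mcomplete (carrier A) (cstar_dist A)"

definition star_hom :: "'a cstar \<Rightarrow> 'b cstar \<Rightarrow> ('a \<Rightarrow> 'b) \<Rightarrow> bool" where
  "star_hom A B h \<longleftrightarrow> h \<in> ring_hom A B \<and>
    (\<forall>a\<in>carrier A. (\<forall>c. h (c \<odot>\<^bsub>A\<^esub> a) = c \<odot>\<^bsub>B\<^esub> h a) \<and> h (star A a) = star B (h a))"

definition star_iso :: "'a cstar \<Rightarrow> 'b cstar \<Rightarrow> ('a \<Rightarrow> 'b) \<Rightarrow> bool" where
  "star_iso A B h \<longleftrightarrow> star_hom A B h \<and> bij_betw h (carrier A) (carrier B)"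

text \<open>Unital C*-subalgebras. Every generating set used below contains a unitary, so that a
  closed *-subalgebra containing it has the unit of the ambient algebra anyway.\<close>

definition cstar_subalgebra :: "'a set \<Rightarrow> 'a cstar \<Rightarrow> bool" where
  "cstar_subalgebra H A \<longleftrightarrow> subring H A \<and>
    (\<forall>a\<in>H. (\<forall>c. c \<odot>\<^bsub>A\<^esub> a \<in> H) \<and> star A a \<in> H) \<and>
    closedin (Metric_space.mtopology (carrier A) (cstar_dist A)) H"

definition cstar_generated :: "'a cstar \<Rightarrow> 'a set \<Rightarrow> 'a cstar" where
  "cstar_generated A S = A\<lparr>carrier := \<Inter>{H. cstar_subalgebra H A \<and> S \<subseteq> H}\<rparr>"

definition unitary_in :: "'a cstar \<Rightarrow> 'a \<Rightarrow> bool" where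
  "unitary_in A a \<longleftrightarrow> a \<in> carrier A \<and>
    star A a \<otimes>\<^bsub>A\<^esub> a = \<one>\<^bsub>A\<^esub> \<and> a \<otimes>\<^bsub>A\<^esub> star A a = \<one>\<^bsub>A\<^esub>"


section \<open>Continuous functional calculus\<close>

definition spectrum_in :: "'a cstar \<Rightarrow> 'a \<Rightarrow> complex set" where
  "spectrum_in A a = {c. (c \<odot>\<^bsub>A\<^esub> \<one>\<^bsub>A\<^esub>) \<ominus>\<^bsub>A\<^esub> a \<notin> Units A}"

text \<open>The C*-algebra \<open>C(K)\<close>, for compact \<open>K\<close>, with the supremum norm; the 0 inserted below
  only matters for \<open>K = {}\<close>.\<close>

definition cont_algebra :: "complex set \<Rightarrow> (complex \<Rightarrow> complex) cstar" where
  "cont_algebra K =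
    \<lparr>carrier = {f \<in> extensional K. continuous_on K f},
     mult = (\<lambda>f g. \<lambda>z\<in>K. f z * g z), one = (\<lambda>z\<in>K. 1),
     zero = (\<lambda>z\<in>K. 0), add = (\<lambda>f g. \<lambda>z\<in>K. f z + g z),
     smult = (\<lambda>c f. \<lambda>z\<in>K. c * f z),
     star = (\<lambda>f. \<lambda>z\<in>K. cnj (f z)),
     nrm = (\<lambda>f. Sup (insert 0 ((\<lambda>z. cmod (f z)) ` K)))\<rparr>"

text \<open>\<open>f(a)\<close> for normal \<open>a\<close> and \<open>f\<close> continuous on the spectrum of \<open>a\<close>: the value at \<open>f\<close> of
  the unique unital *-homomorphism from the continuous functions on the spectrum of \<open>a\<close> that maps
  the identity function to \<open>a\<close>.\<close>

definition cfc :: "'a cstar \<Rightarrow> 'a \<Rightarrow> (complex \<Rightarrow> complex) \<Rightarrow> 'a" where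
  "cfc A a f = (THE b. \<exists>\<Phi>. star_hom (cont_algebra (spectrum_in A a)) A \<Phi> \<and>
    \<Phi> (\<lambda>z\<in>spectrum_in A a. z) = a \<and> \<Phi> (restrict f (spectrum_in A a)) = b)"

text \<open>The square root of a positive element (whose spectrum is contained in the non-negative
  reals).\<close>

definition cstar_sqrt :: "'a cstar \<Rightarrow> 'a \<Rightarrow> 'a" where
  "cstar_sqrt A a = cfc A a (\<lambda>z. complex_of_real (sqrt (Re z)))"


section \<open>The two universal C*-algebras\<close>

definition rotation_relations :: "real \<Rightarrow> 'a cstar \<Rightarrow> 'a \<Rightarrow> 'a \<Rightarrow> bool" where
  "rotation_relations \<theta> A u v \<longleftrightarrow> unitary_in A u \<and> unitary_in A v \<and>
    v \<otimes>\<^bsub>A\<^esub> u = exp (2 * pi * \<i> * \<theta>) \<odot>\<^bsub>A\<^esub> (u \<otimes>\<^bsub>A\<^esub> v)"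

definition weighted_relations ::
    "real \<Rightarrow> (complex \<Rightarrow> real) \<Rightarrow> 'a cstar \<Rightarrow> 'a \<Rightarrow> 'a \<Rightarrow> bool" where
  "weighted_relations \<theta> \<gamma> A x w \<longleftrightarrow> x \<in> carrier A \<and> unitary_in A w \<and>
    star A x \<otimes>\<^bsub>A\<^esub> x = cfc A w (\<lambda>z. complex_of_real (\<gamma> z)) \<and>
    x \<otimes>\<^bsub>A\<^esub> star A x =
      cfc A (exp (- (2 * pi * \<i> * \<theta>)) \<odot>\<^bsub>A\<^esub> w) (\<lambda>z. complex_of_real (\<gamma> z)) \<and>
    x \<otimes>\<^bsub>A\<^esub> w = exp (- (2 * pi * \<i> * \<theta>)) \<odot>\<^bsub>A\<^esub> (w \<otimes>\<^bsub>A\<^esub> x)"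

text \<open>Universality is a statement about all C*-algebras \<open>B\<close>, but a formula cannot quantify over
  types. It only concerns the subalgebra of \<open>B\<close> generated by two elements; this is separable, so
  it has at most continuum many elements and is isomorphic to a C*-algebra whose carrier is a set
  of real numbers. Testing against all C*-algebra structures on sets of reals (arbitrary
  structures, unrelated to real arithmetic) is therefore the full universal property.\<close>

definition is_rotation_algebra :: "real \<Rightarrow> 'a cstar \<Rightarrow> 'a \<Rightarrow> 'a \<Rightarrow> bool" where
  "is_rotation_algebra \<theta> A u v \<longleftrightarrow> cstar_algebra A \<and> rotation_relations \<theta> A u v \<and>
    carrier (cstar_generated A {u, v}) = carrier A \<and>
    (\<forall>(B :: real cstar) u' v'. cstar_algebra B \<and> rotation_relations \<theta> B u' v' \<longrightarrow>
      (\<exists>h. star_hom A (cstar_generated B {u', v'}) h \<and>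
           h ` carrier A = carrier (cstar_generated B {u', v'}) \<and> h u = u' \<and> h v = v'))"

definition is_weighted_rotation_algebra ::
    "real \<Rightarrow> (complex \<Rightarrow> real) \<Rightarrow> 'a cstar \<Rightarrow> 'a \<Rightarrow> 'a \<Rightarrow> bool" where
  "is_weighted_rotation_algebra \<theta> \<gamma> A x w \<longleftrightarrow>
    cstar_algebra A \<and> weighted_relations \<theta> \<gamma> A x w \<and>
    carrier (cstar_generated A {x, w}) = carrier A \<and>
    (\<forall>(B :: real cstar) x' w'. cstar_algebra B \<and> weighted_relations \<theta> \<gamma> B x' w' \<longrightarrow>
      (\<exists>h. star_hom A (cstar_generated B {x', w'}) h \<and>
           h ` carrier A = carrier (cstar_generated B {x', w'}) \<and> h x = x' \<and> h w = w'))"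

end

theory Submission
  imports Defs
begin

text \<open>
  Put \<open>\<mu> = e\<^sup>2\<^sup>\<pi>\<^sup>i\<^sup>\<theta>\<close>. Conjugation by \<open>w\<close> multiplies \<open>x\<close> by \<open>\<mu>\<close>, so the gauge action at an
  aperiodic number is inner, and averaging its iterates bounds the norm of each homogeneous component
  of an element by the norm of the element. Let \<open>g\<close> be a homomorphism from \<open>A\<close> that is isometric on
  functions of \<open>w\<close>. It is isometric on homogeneous elements \<open>b\<close>, because \<open>b\<^sup>*b\<close> is a function of \<open>w\<close>;
  hence the norm of a sum \<open>a\<close> of \<open>2N + 1\<close> homogeneous elements is at most \<open>2N + 1\<close> times the norm of
  \<open>g a\<close>. For the powers of \<open>a\<^sup>*a\<close> the degree grows linearly and the norm exponentially, so \<open>g\<close> is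
  isometric. The same argument, with \<open>u\<close> rotating \<open>v\<close>, compares Laurent polynomials in \<open>v\<close> with
  functions on the circle and yields the functional calculus.

  Universality is only available for algebras on the real numbers. Therefore both algebras are mapped
  to an algebra \<open>R\<close> of operators on \<open>\<ell>\<^sup>2(\<int>)\<close>, transported to the real numbers, by \<open>h\<close> and \<open>g\<close>; both
  maps are isometric, and the isomorphism is \<open>h\<^sup>-\<^sup>1 \<circ> g\<close>.
\<close>

section \<open>Elementary C*-algebra theory\<close>

text \<open>The weight may vanish on part of the circle. Then x need not be invertible, u need not
  lie in the subalgebra generated by y and v, and no formula for an inverse of \<phi> is at hand;
  injectivity is therefore obtained as an equality of norms. The averaging has to take place in the
  target of \<open>g\<close>, because it is the norm there that must be bounded from below, while
  nothing is known about that algebra beyond the images of the relations. Conjugation by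
  \<open>w\<close> survives this: being inner, it becomes conjugation by \<open>g w\<close>, a
  contraction of any target. Irrationality of \<theta> enters only through the fact that no nonzero
  power of \<mu> is 1. That functions of \<open>w\<close> keep their sup norm in A cannot be seen
  inside A, which need not contain a unitary rotating \<open>w\<close>; it is read off from the
  image in R, where such a unitary exists. For this reason R has to be nonzero.\<close>

lemma complex_ring_simps [simp]:
  "carrier complex_ring = UNIV" "x \<oplus>\<^bsub>complex_ring\<^esub> y = x + y" "x \<otimes>\<^bsub>complex_ring\<^esub> y = x * y"
  "\<one>\<^bsub>complex_ring\<^esub> = 1" "\<zero>\<^bsub>complex_ring\<^esub> = 0"
  by (simp_all add: complex_ring_def)

lemma cring_complex_ring: "cring complex_ring"
proof (rule cringI)
  show "abelian_group complex_ring"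
  proof (rule abelian_groupI)
    fix x show "\<exists>y\<in>carrier complex_ring. y \<oplus>\<^bsub>complex_ring\<^esub> x = \<zero>\<^bsub>complex_ring\<^esub>"
      by (rule bexI[of _ "- x"]) auto
  qed (auto simp: algebra_simps)
  show "Group.comm_monoid complex_ring"
    by (rule comm_monoidI) (auto simp: algebra_simps)
qed (auto simp: algebra_simps)

section \<open>Arithmetic of scalars, differences, the involution and the norm\<close>

context cstar_algebra
begin

lemma scale_closed [simp, intro]: "a \<in> carrier A \<Longrightarrow> c \<odot> a \<in> carrier A"
  using smult_closed[of c a] by simp

lemma scale_add_left: "a \<in> carrier A \<Longrightarrow> (c + d) \<odot> a = c \<odot> a \<oplus> d \<odot> a"
  using smult_l_distr[of c d a] by simp

lemma scale_add_right:
  "\<lbrakk>a \<in> carrier A; b \<in> carrier A\<rbrakk> \<Longrightarrow> c \<odot> (a \<oplus> b) = c \<odot> a \<oplus> c \<odot> b"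
  using smult_r_distr[of c a b] by simp

lemma scale_scale [simp]: "a \<in> carrier A \<Longrightarrow> c \<odot> (d \<odot> a) = (c * d) \<odot> a"
  using smult_assoc1[of c d a] by simp

lemma scale_one [simp]: "a \<in> carrier A \<Longrightarrow> 1 \<odot> a = a"
  using smult_one[of a] by simp

lemma scale_zero [simp]: "a \<in> carrier A \<Longrightarrow> 0 \<odot> a = \<zero>"
  using smult_l_null[of a] by simp

lemma scale_of_zero [simp]: "c \<odot> \<zero> = \<zero>"
  using smult_r_null[of c] by simp

lemma scale_minus_one: "a \<in> carrier A \<Longrightarrow> (- 1) \<odot> a = \<ominus> a"
proof -
  assume a: "a \<in> carrier A"
  have "(- 1) \<odot> a \<oplus> a = \<zero>" using scale_add_left[OF a, of "-1" 1] a by simp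
  thus ?thesis using a by (simp add: M.minus_equality)
qed

lemma minus_eq_scale: "\<lbrakk>a \<in> carrier A; b \<in> carrier A\<rbrakk> \<Longrightarrow> a \<ominus> b = a \<oplus> (- 1) \<odot> b"
  by (simp add: a_minus_def scale_minus_one)

lemma neg_eq_scale: "a \<in> carrier A \<Longrightarrow> \<ominus> a = (- 1) \<odot> a"
  by (simp add: scale_minus_one)

lemma scale_diff_right:
  "\<lbrakk>a \<in> carrier A; b \<in> carrier A\<rbrakk> \<Longrightarrow> c \<odot> (a \<ominus> b) = c \<odot> a \<ominus> c \<odot> b"
  by (simp add: minus_eq_scale scale_add_right)

lemma mult_diff_right:
  "\<lbrakk>a \<in> carrier A; b \<in> carrier A; c \<in> carrier A\<rbrakk> \<Longrightarrow> a \<otimes> (b \<ominus> c) = a \<otimes> b \<ominus> a \<otimes> c"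
  by (simp add: a_minus_def r_distr r_minus)

lemma mult_diff_left:
  "\<lbrakk>a \<in> carrier A; b \<in> carrier A; c \<in> carrier A\<rbrakk> \<Longrightarrow> (b \<ominus> c) \<otimes> a = b \<otimes> a \<ominus> c \<otimes> a"
  by (simp add: a_minus_def l_distr l_minus)

declare smult_mult_left [simp] smult_mult_right [simp] star_closed [simp, intro]
  star_star [simp] star_add [simp] star_smult [simp] star_mult [simp] nrm_smult [simp]

lemma star_zero [simp]: "star A \<zero> = \<zero>"
  using star_smult[of \<zero> 0] by simp

lemma star_one [simp]: "star A \<one> = \<one>"
proof -
  have "star A \<one> = star A \<one> \<otimes> \<one>" by simp
  also have "\<dots> = star A (star A \<one> \<otimes> \<one>)" by (subst star_mult) auto
  also have "\<dots> = \<one>" by simp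
  finally show ?thesis .
qed

lemma star_diff [simp]:
  "\<lbrakk>a \<in> carrier A; b \<in> carrier A\<rbrakk> \<Longrightarrow> star A (a \<ominus> b) = star A a \<ominus> star A b"
  by (simp add: minus_eq_scale)

lemma nrm_zero [simp]: "nrm A \<zero> = 0"
  by (simp add: nrm_eq_zero)

lemma nrm_neg [simp]: "a \<in> carrier A \<Longrightarrow> nrm A (\<ominus> a) = nrm A a"
  by (simp add: neg_eq_scale)

lemma nrm_minus_commute:
  "\<lbrakk>a \<in> carrier A; b \<in> carrier A\<rbrakk> \<Longrightarrow> nrm A (a \<ominus> b) = nrm A (b \<ominus> a)"
proof -
  assume a: "a \<in> carrier A" "b \<in> carrier A"
  have "a \<ominus> b = (- 1) \<odot> (b \<ominus> a)"
    using a by (simp add: minus_eq_scale scale_add_right M.a_comm)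
  thus ?thesis using a by simp
qed

lemma nrm_diff_le:
  "\<lbrakk>a \<in> carrier A; b \<in> carrier A\<rbrakk> \<Longrightarrow> nrm A (a \<ominus> b) \<le> nrm A a + nrm A b"
  using nrm_triangle[of a "\<ominus> b"] by (simp add: a_minus_def)

lemma diff_add_diff:
  "\<lbrakk>a \<in> carrier A; b \<in> carrier A; c \<in> carrier A\<rbrakk> \<Longrightarrow> (a \<ominus> b) \<oplus> (b \<ominus> c) = a \<ominus> c"
  by (simp add: a_minus_def M.a_assoc M.r_neg1)

lemma nrm_diff_triangle:
  "\<lbrakk>a \<in> carrier A; b \<in> carrier A; c \<in> carrier A\<rbrakk>
    \<Longrightarrow> nrm A (a \<ominus> c) \<le> nrm A (a \<ominus> b) + nrm A (b \<ominus> c)"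
  using nrm_triangle[of "a \<ominus> b" "b \<ominus> c"] by (simp add: diff_add_diff)

lemma nrm_diff_eq_zero:
  "\<lbrakk>a \<in> carrier A; b \<in> carrier A\<rbrakk> \<Longrightarrow> nrm A (a \<ominus> b) = 0 \<longleftrightarrow> a = b"
  by (simp add: nrm_eq_zero)

lemma diff_self: "a \<in> carrier A \<Longrightarrow> a \<ominus> a = \<zero>"
  by simp

lemma nrm_le_add_diff:
  "\<lbrakk>a \<in> carrier A; b \<in> carrier A\<rbrakk> \<Longrightarrow> nrm A a \<le> nrm A b + nrm A (a \<ominus> b)"
  using nrm_diff_triangle[of a b \<zero>] by (simp add: a_minus_def)

lemma abs_nrm_diff_le:
  "\<lbrakk>a \<in> carrier A; b \<in> carrier A\<rbrakk> \<Longrightarrow> \<bar>nrm A a - nrm A b\<bar> \<le> nrm A (a \<ominus> b)"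
  using nrm_le_add_diff[of a b] nrm_le_add_diff[of b a] nrm_minus_commute[of a b] by simp

text \<open>The C*-identity and submultiplicativity bound the square of the norm of b by the product
  of the norms of \<open>star A b\<close> and b; cancelling one factor gives one inequality, and
  applying it to the adjoint gives the other.\<close>

lemma nrm_star [simp]: "a \<in> carrier A \<Longrightarrow> nrm A (star A a) = nrm A a"
proof -
  have le: "nrm A b \<le> nrm A (star A b)" if b: "b \<in> carrier A" for b
  proof (cases "nrm A b = 0")
    case True
    thus ?thesis using nrm_nonneg b by simp
  next
    case False
    hence pos: "0 < nrm A b" using nrm_nonneg[OF b] by simp
    have "nrm A b * nrm A b \<le> nrm A (star A b) * nrm A b"
      using cstar_identity[OF b] nrm_mult[of "star A b" b] b by (simp add: power2_eq_square)
    thus ?thesis using pos by simp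
  qed
  assume "a \<in> carrier A"
  thus ?thesis using le[of a] le[of "star A a"] by simp
qed

lemma nrm_one_le: "nrm A \<one> \<le> 1"
proof -
  have "nrm A \<one> = (nrm A \<one>)\<^sup>2" using cstar_identity[of \<one>] by simp
  hence "nrm A \<one> = 0 \<or> nrm A \<one> = 1" by (simp add: power2_eq_square)
  thus ?thesis by auto
qed

lemma nrm_one: "\<one> \<noteq> \<zero> \<Longrightarrow> nrm A \<one> = 1"
proof -
  assume "\<one> \<noteq> \<zero>"
  moreover have "nrm A \<one> = (nrm A \<one>)\<^sup>2" using cstar_identity[of \<one>] by simp
  ultimately show ?thesis using nrm_eq_zero[of \<one>] by (simp add: power2_eq_square)
qed

lemma unitaryD:
  assumes "unitary_in A w"
  shows "w \<in> carrier A" "star A w \<in> carrier A" "star A w \<otimes> w = \<one>" "w \<otimes> star A w = \<one>"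
  using assms by (auto simp: unitary_in_def)

lemma nrm_isometry_le:
  assumes "w \<in> carrier A" "star A w \<otimes> w = \<one>" shows "nrm A w \<le> 1"
proof -
  have "(nrm A w)\<^sup>2 \<le> 1\<^sup>2" using cstar_identity[of w] assms nrm_one_le by simp
  thus ?thesis by (rule power2_le_imp_le) simp
qed

subsection \<open>Limits\<close>

sublocale Metric_space "carrier A" "cstar_dist A"
proof
  fix x y z
  show "0 \<le> cstar_dist A x y" by (simp add: cstar_dist_def nrm_nonneg)
  show "cstar_dist A x y = cstar_dist A y x" by (simp add: cstar_dist_def nrm_minus_commute)
  show "x \<in> carrier A \<Longrightarrow> y \<in> carrier A \<Longrightarrow> (cstar_dist A x y = 0) = (x = y)"
    by (simp add: cstar_dist_def nrm_diff_eq_zero)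
  show "x \<in> carrier A \<Longrightarrow> y \<in> carrier A \<Longrightarrow> z \<in> carrier A
      \<Longrightarrow> cstar_dist A x z \<le> cstar_dist A x y + cstar_dist A y z"
    by (simp add: cstar_dist_def nrm_diff_triangle)
qed

text \<open>Membership in the carrier is part of the notion, so that the limit laws below carry no
  side conditions for the sequences.\<close>

definition tends :: "(nat \<Rightarrow> 'a) \<Rightarrow> 'a \<Rightarrow> bool" where
  "tends s l \<longleftrightarrow> (\<forall>n. s n \<in> carrier A) \<and> l \<in> carrier A \<and> (\<lambda>n. nrm A (s n \<ominus> l)) \<longlonglongrightarrow> 0"

lemma tends_carrier: "tends s l \<Longrightarrow> s n \<in> carrier A" "tends s l \<Longrightarrow> l \<in> carrier A"
  by (auto simp: tends_def)

lemma tends_iff_limitin: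
  assumes "\<And>n. s n \<in> carrier A"
  shows "tends s l \<longleftrightarrow> limitin mtopology s l sequentially"
proof (cases "l \<in> carrier A")
  case True
  have "(\<lambda>n. cstar_dist A (s n) l) = (\<lambda>n. nrm A (s n \<ominus> l))"
    using assms True by (simp add: cstar_dist_def)
  thus ?thesis using assms True by (simp add: tends_def limitin_metric_dist_null)
next
  case False
  thus ?thesis by (simp add: tends_def limitin_metric_dist_null)
qed

lemma tendsI:
  assumes "\<And>n. s n \<in> carrier A" "l \<in> carrier A" "\<And>n. nrm A (s n \<ominus> l) \<le> f n" "f \<longlonglongrightarrow> 0"
  shows "tends s l"
  unfolding tends_def using assms
  by (auto intro: tendsto_sandwich[of "\<lambda>_. 0" _ _ f] simp: nrm_nonneg)

lemma tends_const: "a \<in> carrier A \<Longrightarrow> tends (\<lambda>_. a) a"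
  by (simp add: tends_def diff_self)

lemma tends_unique: "\<lbrakk>tends s l; tends s l'\<rbrakk> \<Longrightarrow> l = l'"
proof -
  assume h: "tends s l" "tends s l'"
  hence "limitin mtopology s l sequentially" "limitin mtopology s l' sequentially"
    using tends_iff_limitin[of s] tends_carrier by auto
  thus "l = l'" by (rule limitin_metric_unique) simp
qed

lemma tends_scale: "tends s l \<Longrightarrow> tends (\<lambda>n. c \<odot> s n) (c \<odot> l)"
proof -
  assume h: "tends s l"
  have "nrm A (c \<odot> s n \<ominus> c \<odot> l) = cmod c * nrm A (s n \<ominus> l)" for n
    using tends_carrier[OF h] by (simp flip: scale_diff_right)
  moreover have "(\<lambda>n. cmod c * nrm A (s n \<ominus> l)) \<longlonglongrightarrow> 0"
    using h by (auto simp: tends_def intro: tendsto_mult_right_zero)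
  ultimately show ?thesis using tends_carrier[OF h] by (auto simp: tends_def)
qed

lemma tends_star: "tends s l \<Longrightarrow> tends (\<lambda>n. star A (s n)) (star A l)"
  by (auto simp: tends_def simp flip: star_diff)

lemma add_diff_add:
  assumes "a \<in> carrier A" "b \<in> carrier A" "c \<in> carrier A" "d \<in> carrier A"
  shows "(a \<oplus> b) \<ominus> (c \<oplus> d) = (a \<ominus> c) \<oplus> (b \<ominus> d)"
  using assms by (simp add: a_minus_def M.minus_add M.a_ac)

lemma tends_add:
  assumes "tends s l" "tends t m" shows "tends (\<lambda>n. s n \<oplus> t n) (l \<oplus> m)"
proof (rule tendsI)
  note [simp] = tends_carrier[OF assms(1)] tends_carrier[OF assms(2)]
  show "s n \<oplus> t n \<in> carrier A" "l \<oplus> m \<in> carrier A" for n by auto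
  show "nrm A (s n \<oplus> t n \<ominus> (l \<oplus> m)) \<le> nrm A (s n \<ominus> l) + nrm A (t n \<ominus> m)" for n
    by (simp add: add_diff_add nrm_triangle)
  show "(\<lambda>n. nrm A (s n \<ominus> l) + nrm A (t n \<ominus> m)) \<longlonglongrightarrow> 0"
    using tendsto_add[of "\<lambda>n. nrm A (s n \<ominus> l)" 0 _ "\<lambda>n. nrm A (t n \<ominus> m)" 0] assms
    by (simp add: tends_def)
qed

lemma tends_nrm: "tends s l \<Longrightarrow> (\<lambda>n. nrm A (s n)) \<longlonglongrightarrow> nrm A l"
proof -
  assume h: "tends s l"
  have "(\<lambda>n. nrm A (s n) - nrm A l) \<longlonglongrightarrow> 0"
  proof (rule Lim_null_comparison)
    show "\<forall>\<^sub>F n in sequentially. norm (nrm A (s n) - nrm A l) \<le> nrm A (s n \<ominus> l)"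
      using tends_carrier[OF h] by (simp add: abs_nrm_diff_le)
    show "(\<lambda>n. nrm A (s n \<ominus> l)) \<longlonglongrightarrow> 0" using h by (simp add: tends_def)
  qed
  thus ?thesis by (simp add: LIM_zero_iff)
qed

lemma tends_mult:
  assumes "tends s l" "tends t m" shows "tends (\<lambda>n. s n \<otimes> t n) (l \<otimes> m)"
proof (rule tendsI)
  note [simp] = tends_carrier[OF assms(1)] tends_carrier[OF assms(2)]
  show "s n \<otimes> t n \<in> carrier A" "l \<otimes> m \<in> carrier A" for n by auto
  show "nrm A (s n \<otimes> t n \<ominus> l \<otimes> m)
      \<le> nrm A (s n \<ominus> l) * nrm A (t n) + nrm A l * nrm A (t n \<ominus> m)" for n
  proof -
    have "s n \<otimes> t n \<ominus> l \<otimes> m = (s n \<ominus> l) \<otimes> t n \<oplus> l \<otimes> (t n \<ominus> m)"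
      by (simp add: mult_diff_left mult_diff_right diff_add_diff)
    thus ?thesis
      using nrm_triangle[of "(s n \<ominus> l) \<otimes> t n" "l \<otimes> (t n \<ominus> m)"]
        nrm_mult[of "s n \<ominus> l" "t n"] nrm_mult[of l "t n \<ominus> m"] by simp
  qed
  have "(\<lambda>n. nrm A (s n \<ominus> l) * nrm A (t n) + nrm A l * nrm A (t n \<ominus> m))
      \<longlonglongrightarrow> 0 * nrm A m + nrm A l * 0"
    using assms tends_nrm[OF assms(2)] by (intro tendsto_intros) (auto simp: tends_def)
  thus "(\<lambda>n. nrm A (s n \<ominus> l) * nrm A (t n) + nrm A l * nrm A (t n \<ominus> m)) \<longlonglongrightarrow> 0" by simp
qed

lemma complete_seq:
  assumes "\<And>n. s n \<in> carrier A"
    and "\<And>e. e > 0 \<Longrightarrow> \<exists>N. \<forall>m\<ge>N. \<forall>n\<ge>N. nrm A (s m \<ominus> s n) < e"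
  obtains l where "tends s l"
proof -
  have "MCauchy s"
    unfolding MCauchy_def using assms by (auto simp: cstar_dist_def)
  then obtain l where "limitin mtopology s l sequentially"
    using complete mcomplete_def by blast
  thus ?thesis using that tends_iff_limitin assms(1) by blast
qed

lemma tends_Cauchy:
  assumes s: "tends s l" and "e > 0"
  shows "\<exists>N. \<forall>m\<ge>N. \<forall>n\<ge>N. nrm A (s m \<ominus> s n) < e"
proof -
  have e2: "e / 2 > 0" using assms(2) by simp
  have "(\<lambda>n. nrm A (s n \<ominus> l)) \<longlonglongrightarrow> 0" using s by (simp add: tends_def)
  from order_tendstoD(2)[OF this e2]
  obtain N where N: "\<And>n. n \<ge> N \<Longrightarrow> nrm A (s n \<ominus> l) < e / 2"
    unfolding eventually_sequentially by blast
  note c = tends_carrier[OF s]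
  have "nrm A (s m \<ominus> s n) < e" if "m \<ge> N" "n \<ge> N" for m n
    using nrm_diff_triangle[OF c(1,2,1), of m n] N[OF that(1)] N[OF that(2)]
      nrm_minus_commute[OF c(2,1), of n] by simp
  thus ?thesis by blast
qed

text \<open>Turns the topological clause of \<open>cstar_subalgebra\<close> into closure under norm
  limits of sequences, the form in which it is proved and used afterwards.\<close>

lemma closed_iff:
  assumes "H \<subseteq> carrier A"
  shows "closedin mtopology H \<longleftrightarrow> (\<forall>s l. (\<forall>n. s n \<in> H) \<and> tends s l \<longrightarrow> l \<in> H)"
proof -
  have eq: "tends s l \<longleftrightarrow> limitin mtopology s l sequentially" if "\<forall>n. s n \<in> H" for s l
    using that assms by (intro tends_iff_limitin) auto
  have "range s \<subseteq> H \<longleftrightarrow> (\<forall>n. s n \<in> H)" for s :: "nat \<Rightarrow> 'a" by auto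
  thus ?thesis
    unfolding metric_closedin_iff_sequentially_closed using assms eq by meson
qed

subsection \<open>Subalgebras\<close>

lemma cstar_subalgebraI:
  assumes "H \<subseteq> carrier A" "\<one> \<in> H"
    and "\<And>a b. \<lbrakk>a \<in> H; b \<in> H\<rbrakk> \<Longrightarrow> a \<otimes> b \<in> H"
    and "\<And>a b. \<lbrakk>a \<in> H; b \<in> H\<rbrakk> \<Longrightarrow> a \<oplus> b \<in> H"
    and "\<And>c a. a \<in> H \<Longrightarrow> c \<odot> a \<in> H"
    and "\<And>a. a \<in> H \<Longrightarrow> star A a \<in> H"
    and "\<And>s l. \<lbrakk>\<And>n. s n \<in> H; tends s l\<rbrakk> \<Longrightarrow> l \<in> H"
  shows "cstar_subalgebra H A"
proof -
  have "subring H A"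
    using assms(1-6) neg_eq_scale by (intro subringI) (auto simp: subset_iff)
  moreover have "closedin mtopology H" using assms(1,7) by (simp add: closed_iff) blast
  ultimately show ?thesis using assms by (auto simp: cstar_subalgebra_def)
qed

lemma cstar_subalgebraD:
  assumes "cstar_subalgebra H A"
  shows "H \<subseteq> carrier A" "\<one> \<in> H"
    and "\<And>a b. \<lbrakk>a \<in> H; b \<in> H\<rbrakk> \<Longrightarrow> a \<otimes> b \<in> H"
    and "\<And>a b. \<lbrakk>a \<in> H; b \<in> H\<rbrakk> \<Longrightarrow> a \<oplus> b \<in> H"
    and "\<And>c a. a \<in> H \<Longrightarrow> c \<odot> a \<in> H"
    and "\<And>a. a \<in> H \<Longrightarrow> star A a \<in> H"
    and "\<And>s l. \<lbrakk>\<And>n. s n \<in> H; tends s l\<rbrakk> \<Longrightarrow> l \<in> H"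
proof -
  have sr: "subring H A" and cl: "closedin mtopology H"
    using assms by (auto simp: cstar_subalgebra_def)
  note * = subringE[OF sr]
  show "H \<subseteq> carrier A" "\<one> \<in> H" using * by auto
  show "\<And>a b. \<lbrakk>a \<in> H; b \<in> H\<rbrakk> \<Longrightarrow> a \<otimes> b \<in> H"
    "\<And>a b. \<lbrakk>a \<in> H; b \<in> H\<rbrakk> \<Longrightarrow> a \<oplus> b \<in> H" using * by auto
  show "\<And>c a. a \<in> H \<Longrightarrow> c \<odot> a \<in> H" "\<And>a. a \<in> H \<Longrightarrow> star A a \<in> H"
    using assms by (auto simp: cstar_subalgebra_def)
  show "\<And>s l. \<lbrakk>\<And>n. s n \<in> H; tends s l\<rbrakk> \<Longrightarrow> l \<in> H"
    using cl closed_iff[OF *(1)] by blast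
qed

lemma generated_least:
  "\<lbrakk>cstar_subalgebra H A; S \<subseteq> H\<rbrakk> \<Longrightarrow> carrier (cstar_generated A S) \<subseteq> H"
  by (auto simp: cstar_generated_def)

lemma carrier_subalgebra: "cstar_subalgebra (carrier A) A"
  by (rule cstar_subalgebraI) (auto dest: tends_carrier)

text \<open>The whole algebra belongs to the family that is intersected, so the intersection stays
  inside the carrier; every closure property is inherited from the members.\<close>

lemma generated_subalgebra:
  assumes "S \<subseteq> carrier A" shows "cstar_subalgebra (carrier (cstar_generated A S)) A"
proof -
  have ne: "carrier A \<in> {H. cstar_subalgebra H A \<and> S \<subseteq> H}"
    using assms carrier_subalgebra by simp
  show ?thesis
    unfolding cstar_generated_def
  proof (rule cstar_subalgebraI, simp_all, goal_cases)
    case 1 show ?case by (rule Inter_lower[OF ne])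
  next
    case 2 thus ?case by (simp add: cstar_subalgebraD(2))
  next
    case 3 thus ?case by (simp add: cstar_subalgebraD(3))
  next
    case 4 thus ?case by (simp add: cstar_subalgebraD(4))
  next
    case 5 thus ?case by (simp add: cstar_subalgebraD(5))
  next
    case 6 thus ?case by (simp add: cstar_subalgebraD(6))
  next
    case (7 s l)
    show ?case
    proof (intro allI impI)
      fix H assume H: "cstar_subalgebra H A \<and> S \<subseteq> H"
      show "l \<in> H" by (rule cstar_subalgebraD(7)[OF _ _ 7(2)]) (use H 7(1) in auto)
    qed
  qed
qed

lemma generators_in: "S \<subseteq> carrier (cstar_generated A S)"
  by (auto simp: cstar_generated_def)

definition cl :: "'a set \<Rightarrow> 'a set" where
  "cl D = {a \<in> carrier A. \<forall>e>0. \<exists>d\<in>D. nrm A (d \<ominus> a) < e}"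

lemma cl_iff:
  assumes "D \<subseteq> carrier A" shows "a \<in> cl D \<longleftrightarrow> (\<exists>s. (\<forall>n. s n \<in> D) \<and> tends s a)"
proof
  assume a: "a \<in> cl D"
  have "\<exists>d. d \<in> D \<and> nrm A (d \<ominus> a) < inverse (real (Suc n))" for n
  proof -
    have "inverse (real (Suc n)) > 0" by simp
    thus ?thesis using a unfolding cl_def by blast
  qed
  then obtain s where s: "\<And>n. s n \<in> D" "\<And>n. nrm A (s n \<ominus> a) < inverse (real (Suc n))"
    by metis
  have "tends s a"
    using s assms a LIMSEQ_inverse_real_of_nat
    by (intro tendsI[where f = "\<lambda>n. inverse (real (Suc n))"]) (auto simp: cl_def less_imp_le)
  thus "\<exists>s. (\<forall>n. s n \<in> D) \<and> tends s a" using s by blast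
next
  assume "\<exists>s. (\<forall>n. s n \<in> D) \<and> tends s a"
  then obtain s where s: "\<And>n. s n \<in> D" "tends s a" by blast
  have "\<exists>d\<in>D. nrm A (d \<ominus> a) < e" if "e > 0" for e
  proof -
    have "(\<lambda>n. nrm A (s n \<ominus> a)) \<longlonglongrightarrow> 0" using s(2) by (simp add: tends_def)
    from order_tendstoD(2)[OF this that]
    have "\<forall>\<^sub>F n in sequentially. nrm A (s n \<ominus> a) < e" .
    from eventually_happens'[OF sequentially_bot this]
    obtain n where "nrm A (s n \<ominus> a) < e" ..
    thus ?thesis using s(1) by blast
  qed
  thus "a \<in> cl D" using tends_carrier[OF s(2)] by (simp add: cl_def)
qed

lemma cl_I: "\<lbrakk>D \<subseteq> carrier A; \<And>n. s n \<in> D; tends s a\<rbrakk> \<Longrightarrow> a \<in> cl D"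
  using cl_iff by blast

text \<open>The source of all density statements: once the closure of a unital *-subalgebra contains
  the generators, \<open>generated_least\<close> shows that it is everything.\<close>

lemma cl_subalgebra:
  assumes D: "D \<subseteq> carrier A" "\<one> \<in> D"
    and "\<And>a b. \<lbrakk>a \<in> D; b \<in> D\<rbrakk> \<Longrightarrow> a \<otimes> b \<in> D"
    and "\<And>a b. \<lbrakk>a \<in> D; b \<in> D\<rbrakk> \<Longrightarrow> a \<oplus> b \<in> D"
    and "\<And>c a. a \<in> D \<Longrightarrow> c \<odot> a \<in> D"
    and "\<And>a. a \<in> D \<Longrightarrow> star A a \<in> D"
  shows "cstar_subalgebra (cl D) A"
proof (rule cstar_subalgebraI)
  show "cl D \<subseteq> carrier A" by (auto simp: cl_def)
  show "\<one> \<in> cl D" by (rule cl_I[where s = "\<lambda>_. \<one>"]) (use D tends_const in auto)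
  fix a b c
  assume a: "a \<in> cl D"
  then obtain s where s: "\<And>n. s n \<in> D" "tends s a" using cl_iff[OF D(1)] by blast
  show "c \<odot> a \<in> cl D" by (rule cl_I[OF D(1) _ tends_scale[OF s(2)]]) (use s(1) assms in auto)
  show "star A a \<in> cl D" by (rule cl_I[OF D(1) _ tends_star[OF s(2)]]) (use s(1) assms in auto)
  assume b: "b \<in> cl D"
  then obtain t where t: "\<And>n. t n \<in> D" "tends t b" using cl_iff[OF D(1)] by blast
  show "a \<oplus> b \<in> cl D" by (rule cl_I[OF D(1) _ tends_add[OF s(2) t(2)]]) (use s(1) t(1) assms in auto)
  show "a \<otimes> b \<in> cl D" by (rule cl_I[OF D(1) _ tends_mult[OF s(2) t(2)]]) (use s(1) t(1) assms in auto)
next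
  fix s l assume s: "\<And>n. s n \<in> cl D" "tends s l"
  have "\<exists>d\<in>D. nrm A (d \<ominus> l) < e" if "e > 0" for e
  proof -
    have e2: "e / 2 > 0" using that by simp
    have "(\<lambda>n. nrm A (s n \<ominus> l)) \<longlonglongrightarrow> 0" using s(2) by (simp add: tends_def)
    from order_tendstoD(2)[OF this e2]
    have "\<forall>\<^sub>F n in sequentially. nrm A (s n \<ominus> l) < e / 2" .
    from eventually_happens'[OF sequentially_bot this]
    obtain n where n: "nrm A (s n \<ominus> l) < e / 2" ..
    obtain d where d: "d \<in> D" "nrm A (d \<ominus> s n) < e / 2"
      using s(1)[of n] e2 unfolding cl_def by blast
    show ?thesis
    proof
      have "d \<in> carrier A" using d D(1) by auto
      thus "nrm A (d \<ominus> l) < e"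
        using n d nrm_diff_triangle[of d "s n" l] tends_carrier[OF s(2)] by simp
    qed (rule d(1))
  qed
  thus "l \<in> cl D" using tends_carrier[OF s(2)] by (simp add: cl_def)
qed

end

subsection \<open>Homomorphisms are contractive\<close>

context cstar_algebra
begin

text \<open>The square root of 1 - a^2 arises as a limit of real polynomials in a, and so inherits
  selfadjointness and commutation with a.\<close>

lemma exists_sqrt_complement:
  assumes a: "a \<in> carrier A" "star A a = a" "nrm A a < 1"
  obtains b where "b \<in> carrier A" "star A b = b" "a \<otimes> b = b \<otimes> a" "b \<otimes> b = \<one> \<ominus> a \<otimes> a"
proof -
  define s where "s = a \<otimes> a"
  define q where "q = (nrm A a)\<^sup>2"
  \<comment> \<open>r is the smaller root of (q + r^2) / 2 = r, so the iteration below preserves the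
    ball of radius r; q < 1 makes r < 1.\<close>
  define r where "r = 1 - sqrt (1 - q)"
  have s: "s \<in> carrier A" "star A s = s" "a \<otimes> s = s \<otimes> a" "nrm A s = q"
    using a cstar_identity[of a] by (auto simp: s_def q_def m_assoc)
  have q: "0 \<le> q" "q < 1"
    using a nrm_nonneg[of a] power_strict_mono[of "nrm A a" 1 2] by (auto simp: q_def)
  hence r: "0 \<le> r" "r < 1" by (auto simp: r_def)
  have qr: "(q + r * r) / 2 = r"
  proof -
    have "sqrt (1 - q) * sqrt (1 - q) = 1 - q" using q by simp
    thus ?thesis by (simp add: r_def field_simps)
  qed
  \<comment> \<open>The limit \<open>l\<close> of this iteration satisfies \<open>(1 - l)\<^sup>2 = 1 - s\<close>.\<close>
  define y where "y = rec_nat \<zero> (\<lambda>_ z. (1/2) \<odot> (s \<oplus> z \<otimes> z))"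
  have y0: "y 0 = \<zero>" and yS: "y (Suc n) = (1/2) \<odot> (s \<oplus> y n \<otimes> y n)" for n
    by (simp_all add: y_def)
  have y: "y n \<in> carrier A \<and> star A (y n) = y n \<and> a \<otimes> y n = y n \<otimes> a \<and> nrm A (y n) \<le> r" for n
  proof (induction n)
    case 0
    show ?case using a r by (simp add: y0)
  next
    case (Suc n)
    have "nrm A (y (Suc n)) \<le> (1/2) * (nrm A s + nrm A (y n) * nrm A (y n))"
      using nrm_triangle[of s "y n \<otimes> y n"] nrm_mult[of "y n" "y n"] Suc s by (simp add: yS)
    also have "\<dots> \<le> (1/2) * (q + r * r)"
      using Suc s r by (intro mult_left_mono add_mono mult_mono) (auto simp: nrm_nonneg)
    finally have "nrm A (y (Suc n)) \<le> r" using qr by simp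
    moreover have "a \<otimes> (y n \<otimes> y n) = (y n \<otimes> y n) \<otimes> a"
      using Suc a by (metis m_assoc)
    ultimately show ?case using Suc s a by (simp add: yS l_distr r_distr)
  qed
  have yc: "y n \<in> carrier A" for n using y by blast
  \<comment> \<open>On that ball the iteration has Lipschitz constant r, by u^2 - v^2 = (u - v) u +
    v (u - v) and the factor 1/2.\<close>
  have step: "nrm A (y (n + k) \<ominus> y n) \<le> r ^ n" for n k
  proof (induction n)
    case 0
    have "y k \<ominus> \<zero> = y k" using yc by (simp add: a_minus_def)
    thus ?case using y[of k] r by (simp add: y0)
  next
    case (Suc n)
    let ?u = "y (n + k)" and ?v = "y n"
    have "y (Suc n + k) \<ominus> y (Suc n) = (1/2) \<odot> ((s \<oplus> ?u \<otimes> ?u) \<ominus> (s \<oplus> ?v \<otimes> ?v))"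
      using yc s by (simp add: yS scale_diff_right)
    also have "(s \<oplus> ?u \<otimes> ?u) \<ominus> (s \<oplus> ?v \<otimes> ?v) = ?u \<otimes> ?u \<ominus> ?v \<otimes> ?v"
      using yc s by (simp add: add_diff_add)
    also have "\<dots> = (?u \<ominus> ?v) \<otimes> ?u \<oplus> ?v \<otimes> (?u \<ominus> ?v)"
      using yc by (simp add: mult_diff_left mult_diff_right diff_add_diff)
    finally have "nrm A (y (Suc n + k) \<ominus> y (Suc n))
        = (1/2) * nrm A ((?u \<ominus> ?v) \<otimes> ?u \<oplus> ?v \<otimes> (?u \<ominus> ?v))"
      using yc by simp
    also have "\<dots> \<le> (1/2) * (nrm A (?u \<ominus> ?v) * nrm A ?u + nrm A ?v * nrm A (?u \<ominus> ?v))"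
      using nrm_triangle[of "(?u \<ominus> ?v) \<otimes> ?u" "?v \<otimes> (?u \<ominus> ?v)"]
        nrm_mult[of "?u \<ominus> ?v" ?u] nrm_mult[of ?v "?u \<ominus> ?v"] yc by simp
    also have "\<dots> \<le> (1/2) * (r ^ n * r + r * r ^ n)"
      using Suc y r yc by (intro mult_left_mono add_mono mult_mono) (auto simp: nrm_nonneg)
    finally show ?case by simp
  qed
  have "\<exists>N. \<forall>m\<ge>N. \<forall>n\<ge>N. nrm A (y m \<ominus> y n) < e" if e: "e > 0" for e
  proof -
    obtain N where N: "r ^ N < e"
      using real_arch_pow_inv[OF e r(2)] by blast
    have small: "nrm A (y m \<ominus> y n) < e" if "N \<le> n" "n \<le> m" for m n
    proof -
      have "nrm A (y m \<ominus> y n) \<le> r ^ n" using step[of n "m - n"] that by simp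
      also have "\<dots> \<le> r ^ N" using that r by (intro power_decreasing) auto
      finally show ?thesis using N by simp
    qed
    have "nrm A (y m \<ominus> y n) < e" if "N \<le> n" "N \<le> m" for m n
      using small[of m n] small[of n m] that nrm_minus_commute[OF yc yc, of m n]
      by (cases "n \<le> m") auto
    thus ?thesis by blast
  qed
  then obtain l where l: "tends y l" using complete_seq[of y] yc by blast
  have lc: "l \<in> carrier A" using tends_carrier[OF l] by simp
  have "tends (\<lambda>n. y (Suc n)) l" using l LIMSEQ_Suc by (auto simp: tends_def)
  moreover have "tends (\<lambda>n. y (Suc n)) ((1/2) \<odot> (s \<oplus> l \<otimes> l))"
    unfolding yS by (intro tends_scale tends_add tends_mult tends_const l s)
  ultimately have fixpt: "l = (1/2) \<odot> (s \<oplus> l \<otimes> l)" by (rule tends_unique)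
  have "tends (\<lambda>n. star A (y n)) (star A l)" by (rule tends_star[OF l])
  hence star_l: "star A l = l" using y l tends_unique by auto
  have "tends (\<lambda>n. a \<otimes> y n) (a \<otimes> l)" "tends (\<lambda>n. y n \<otimes> a) (l \<otimes> a)"
    by (intro tends_mult tends_const l a)+
  hence comm: "a \<otimes> l = l \<otimes> a" using y tends_unique by auto
  have "2 \<odot> l = 2 \<odot> ((1/2) \<odot> (s \<oplus> l \<otimes> l))" using fixpt by simp
  also have "\<dots> = s \<oplus> l \<otimes> l" using s lc by simp
  finally have two: "l \<oplus> l = s \<oplus> l \<otimes> l"
    using scale_add_left[OF lc, of 1 1] lc by simp
  show ?thesis
  proof (rule that[of "\<one> \<ominus> l"])
    show "\<one> \<ominus> l \<in> carrier A" "star A (\<one> \<ominus> l) = \<one> \<ominus> l" using lc star_l by auto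
    show "a \<otimes> (\<one> \<ominus> l) = (\<one> \<ominus> l) \<otimes> a"
      using lc a comm by (simp add: mult_diff_left mult_diff_right)
    have "(\<one> \<ominus> l) \<otimes> (\<one> \<ominus> l) = \<one> \<oplus> l \<otimes> l \<ominus> (l \<oplus> l)"
      using lc by (simp add: mult_diff_left mult_diff_right) algebra
    also have "\<dots> = \<one> \<ominus> s" unfolding two using lc s by algebra
    finally show "(\<one> \<ominus> l) \<otimes> (\<one> \<ominus> l) = \<one> \<ominus> a \<otimes> a" by (simp add: s_def)
  qed
qed

text \<open>Take u = a + i sqrt(1 - a^2): the root commutes with a, so the mixed terms of
  \<open>star A u \<otimes> u\<close> cancel. The relation
  \<open>star A u \<otimes> u = \<one>\<close> is preserved by homomorphisms and bounds the norm of
  the image of u by 1.\<close>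

lemma selfadjoint_real_part_of_unitary:
  assumes a: "a \<in> carrier A" "star A a = a" "nrm A a < 1"
  obtains u where "u \<in> carrier A" "star A u \<otimes> u = \<one>" "a = (1/2) \<odot> (u \<oplus> star A u)"
proof -
  obtain b where b: "b \<in> carrier A" "star A b = b" "a \<otimes> b = b \<otimes> a" "b \<otimes> b = \<one> \<ominus> a \<otimes> a"
    using exists_sqrt_complement[OF a] by blast
  let ?u = "a \<oplus> \<i> \<odot> b"
  have su: "star A ?u = a \<oplus> (- \<i>) \<odot> b" using a b by simp
  show ?thesis
  proof (rule that[of ?u])
    show "?u \<in> carrier A" using a b by simp
    have "star A ?u \<otimes> ?u = a \<otimes> a \<oplus> \<i> \<odot> (b \<otimes> a) \<oplus> ((- \<i>) \<odot> (b \<otimes> a) \<oplus> b \<otimes> b)"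
      unfolding su using a(1) b(1,3)
      by (simp add: l_distr r_distr scale_add_right M.a_ac)
    also have "\<dots> = a \<otimes> a \<oplus> (\<i> + (- \<i>)) \<odot> (b \<otimes> a) \<oplus> b \<otimes> b"
      unfolding scale_add_left[OF m_closed[OF b(1) a(1)]] using a b by (simp add: M.a_assoc)
    also have "\<dots> = a \<otimes> a \<oplus> (\<one> \<ominus> a \<otimes> a)" using a b by simp
    also have "\<dots> = \<one>" using a(1) by algebra
    finally show "star A ?u \<otimes> ?u = \<one>" .
    have "?u \<oplus> star A ?u = (a \<oplus> a) \<oplus> (\<i> \<odot> b \<oplus> (- \<i>) \<odot> b)"
      unfolding su using a b by (simp add: M.a_ac)
    also have "\<dots> = (1 + 1) \<odot> a \<oplus> (\<i> + (- \<i>)) \<odot> b"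
      unfolding scale_add_left[OF b(1)] scale_add_left[OF a(1)] using a b by simp
    finally show "a = (1/2) \<odot> (?u \<oplus> star A ?u)" using a b by simp
  qed
qed

end

locale cstar_hom = A: cstar_algebra A + B: cstar_algebra B
  for A :: "'a cstar" and B :: "'b cstar" and h :: "'a \<Rightarrow> 'b" +
  assumes hom: "star_hom A B h"
begin

lemma closed [simp, intro]: "a \<in> carrier A \<Longrightarrow> h a \<in> carrier B"
  using hom by (auto simp: star_hom_def ring_hom_def)

lemma add [simp]:
  "\<lbrakk>a \<in> carrier A; b \<in> carrier A\<rbrakk> \<Longrightarrow> h (a \<oplus>\<^bsub>A\<^esub> b) = h a \<oplus>\<^bsub>B\<^esub> h b"
  using hom by (auto simp: star_hom_def ring_hom_def)

lemma mult [simp]: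
  "\<lbrakk>a \<in> carrier A; b \<in> carrier A\<rbrakk> \<Longrightarrow> h (a \<otimes>\<^bsub>A\<^esub> b) = h a \<otimes>\<^bsub>B\<^esub> h b"
  using hom by (auto simp: star_hom_def ring_hom_def)

lemma one [simp]: "h \<one>\<^bsub>A\<^esub> = \<one>\<^bsub>B\<^esub>"
  using hom by (auto simp: star_hom_def ring_hom_def)

lemma scale [simp]: "a \<in> carrier A \<Longrightarrow> h (c \<odot>\<^bsub>A\<^esub> a) = c \<odot>\<^bsub>B\<^esub> h a"
  using hom by (auto simp: star_hom_def)

lemma star [simp]: "a \<in> carrier A \<Longrightarrow> h (star A a) = star B (h a)"
  using hom by (auto simp: star_hom_def)

lemma zero [simp]: "h \<zero>\<^bsub>A\<^esub> = \<zero>\<^bsub>B\<^esub>"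
  using scale[of "\<zero>\<^bsub>A\<^esub>" 0] by simp

lemma diff [simp]:
  "\<lbrakk>a \<in> carrier A; b \<in> carrier A\<rbrakk> \<Longrightarrow> h (a \<ominus>\<^bsub>A\<^esub> b) = h a \<ominus>\<^bsub>B\<^esub> h b"
  by (simp add: A.minus_eq_scale B.minus_eq_scale)

text \<open>Divided by a number t above its norm, a is the mean of an isometry and its adjoint, and
  both have images of norm at most 1. Letting t decrease to the norm of a gives the bound.\<close>

lemma contractive_selfadjoint:
  assumes a: "a \<in> carrier A" "star A a = a" shows "nrm B (h a) \<le> nrm A a"
proof (rule dense_ge)
  fix t assume t: "nrm A a < t"
  hence tpos: "t > 0" using A.nrm_nonneg[OF a(1)] by simp
  let ?a = "complex_of_real (1/t) \<odot>\<^bsub>A\<^esub> a"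
  have "nrm A ?a < 1" using a t tpos by (simp add: norm_divide)
  then obtain u where u: "u \<in> carrier A" "star A u \<otimes>\<^bsub>A\<^esub> u = \<one>\<^bsub>A\<^esub>"
      "?a = (1/2) \<odot>\<^bsub>A\<^esub> (u \<oplus>\<^bsub>A\<^esub> star A u)"
    using A.selfadjoint_real_part_of_unitary[of ?a] a by auto
  have "star B (h u) \<otimes>\<^bsub>B\<^esub> h u = h (star A u \<otimes>\<^bsub>A\<^esub> u)" using u(1) by simp
  hence "nrm B (h u) \<le> 1" using B.nrm_isometry_le[of "h u"] u(1,2) by simp
  moreover have "nrm B (h ?a) \<le> (1/2) * (nrm B (h u) + nrm B (h u))"
    unfolding u(3) using u(1) B.nrm_triangle[of "h u" "star B (h u)"] by simp
  ultimately have "nrm B (h ?a) \<le> 1" by simp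
  thus "nrm B (h a) \<le> t" using a(1) tpos by (simp add: norm_divide divide_le_eq)
qed

lemma contractive: "a \<in> carrier A \<Longrightarrow> nrm B (h a) \<le> nrm A a"
proof -
  assume a: "a \<in> carrier A"
  have "(nrm B (h a))\<^sup>2 = nrm B (h (star A a \<otimes>\<^bsub>A\<^esub> a))"
    using a B.cstar_identity[of "h a"] by simp
  also have "\<dots> \<le> nrm A (star A a \<otimes>\<^bsub>A\<^esub> a)"
    using a by (intro contractive_selfadjoint) auto
  also have "\<dots> = (nrm A a)\<^sup>2" using A.cstar_identity[OF a] .
  finally show ?thesis using A.nrm_nonneg[OF a] by (rule power2_le_imp_le)
qed

lemma tends: "A.tends s l \<Longrightarrow> B.tends (\<lambda>n. h (s n)) (h l)"
proof -
  assume s: "A.tends s l"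
  have c: "nrm B (h (s n) \<ominus>\<^bsub>B\<^esub> h l) \<le> nrm A (s n \<ominus>\<^bsub>A\<^esub> l)" for n
    using contractive[of "s n \<ominus>\<^bsub>A\<^esub> l"] A.tends_carrier[OF s] by simp
  show ?thesis
    by (rule B.tendsI[where f = "\<lambda>n. nrm A (s n \<ominus>\<^bsub>A\<^esub> l)"])
      (use s c A.tends_carrier[OF s] in \<open>auto simp: A.tends_def\<close>)
qed

text \<open>Contractivity makes h continuous, hence the preimage closed.\<close>

lemma vimage_subalgebra:
  assumes H: "cstar_subalgebra H B" shows "cstar_subalgebra {a \<in> carrier A. h a \<in> H} A"
proof (rule A.cstar_subalgebraI)
  fix s l assume s: "\<And>n. s n \<in> {a \<in> carrier A. h a \<in> H}" "A.tends s l"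
  have "h l \<in> H" by (rule B.cstar_subalgebraD(7)[OF H _ tends[OF s(2)]]) (use s in auto)
  thus "l \<in> {a \<in> carrier A. h a \<in> H}" using A.tends_carrier[OF s(2)] by simp
qed (use B.cstar_subalgebraD(2-6)[OF H] in auto)

lemma image_generated:
  assumes "S \<subseteq> carrier A" "h ` S \<subseteq> T" "T \<subseteq> carrier B" "a \<in> carrier (cstar_generated A S)"
  shows "h a \<in> carrier (cstar_generated B T)"
proof -
  have "carrier (cstar_generated A S) \<subseteq> {a \<in> carrier A. h a \<in> carrier (cstar_generated B T)}"
    by (rule A.generated_least[OF vimage_subalgebra[OF B.generated_subalgebra[OF assms(3)]]])
      (use assms B.generators_in[of T] in auto)
  thus ?thesis using assms(4) by blast
qed

end

section \<open>Composition, change of codomain and uniqueness of homomorphisms\<close>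

lemma cstar_hom_compose:
  assumes "cstar_hom A B h" "cstar_hom B C k" shows "cstar_hom A C (k \<circ> h)"
proof -
  interpret h: cstar_hom A B h by fact
  interpret k: cstar_hom B C k by fact
  have "star_hom A C (k \<circ> h)"
    unfolding star_hom_def by (intro conjI ballI allI ring_hom_memI) auto
  thus ?thesis by unfold_locales
qed

text \<open>\<open>cstar_generated\<close> replaces only the carrier and keeps all operations, so
  the two codomains differ just by a condition on values.\<close>

lemma (in cstar_algebra) star_hom_generated:
  assumes "S \<subseteq> carrier A"
  shows "star_hom C (cstar_generated A S) h \<longleftrightarrow>
    star_hom C A h \<and> h ` carrier C \<subseteq> carrier (cstar_generated A S)"
proof -
  have "carrier (cstar_generated A S) \<subseteq> carrier A"
    using cstar_subalgebraD(1)[OF generated_subalgebra[OF assms]] .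
  thus ?thesis by (auto simp: star_hom_def ring_hom_def cstar_generated_def subset_iff Pi_iff)
qed

text \<open>The set where two homomorphisms agree is closed by contractivity, hence a C*-subalgebra.
  This serves both the uniqueness of \<phi> and the uniqueness behind \<open>cfc\<close>.\<close>

lemma star_homs_eq_on_generated:
  assumes "cstar_hom A B h" "cstar_hom A B k" "S \<subseteq> carrier A"
    and "\<And>a. a \<in> S \<Longrightarrow> h a = k a" "a \<in> carrier (cstar_generated A S)"
  shows "h a = k a"
proof -
  interpret h: cstar_hom A B h by fact
  interpret k: cstar_hom A B k by fact
  have "cstar_subalgebra {a \<in> carrier A. h a = k a} A"
  proof (rule h.A.cstar_subalgebraI)
    fix s l assume s: "\<And>n. s n \<in> {a \<in> carrier A. h a = k a}" "h.A.tends s l"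
    have "h.B.tends (\<lambda>n. h (s n)) (k l)" using k.tends[OF s(2)] s(1) by simp
    thus "l \<in> {a \<in> carrier A. h a = k a}"
      using h.tends[OF s(2)] h.B.tends_unique h.A.tends_carrier[OF s(2)] by simp
  qed auto
  from h.A.generated_least[OF this, of S] show ?thesis using assms by blast
qed

section \<open>Spectral subspaces of an irrational rotation\<close>

context cstar_algebra
begin

lemma nrm_finsum_le:
  assumes "finite F" "\<And>k. k \<in> F \<Longrightarrow> s k \<in> carrier A"
  shows "nrm A (finsum A s F) \<le> (\<Sum>k\<in>F. nrm A (s k))"
  using assms
proof (induction F)
  case (insert x F)
  have "finsum A s F \<in> carrier A" using insert by (intro M.finsum_closed) auto
  thus ?case
    using insert nrm_triangle[of "s x" "finsum A s F"] by (simp add: M.finsum_insert Pi_iff)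
qed simp

end

text \<open>The bound does not depend on n, so these sums disappear after division by n.\<close>

lemma norm_geometric_sum_le:
  fixes z :: complex
  assumes "cmod z = 1" "z \<noteq> 1"
  shows "cmod (\<Sum>i<n. z ^ i) \<le> 2 / cmod (1 - z)"
proof -
  have "(\<Sum>i<n. z ^ i) = (1 - z ^ n) / (1 - z)"
    using assms by (simp add: sum_gp_strict)
  moreover have "cmod (1 - z ^ n) \<le> 2"
    using norm_triangle_ineq4[of 1 "z ^ n"] assms by (simp add: norm_power)
  ultimately show ?thesis by (simp add: norm_divide divide_right_mono)
qed

text \<open>Negative exponents are included, so that the quotient \<open>\<mu> powi (k - j)\<close>
  of two eigenvalues differs from 1 for any two distinct degrees.\<close>

definition aperiodic :: "complex \<Rightarrow> bool" where
  "aperiodic \<mu> \<longleftrightarrow> cmod \<mu> = 1 \<and> (\<forall>k::int. k \<noteq> 0 \<longrightarrow> \<mu> powi k \<noteq> 1)"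

text \<open>The averaging uses a linear contraction and its eigenvectors. The instances are
  conjugation by a unitary and rotation of functions on the circle.\<close>

locale rotation_action = cstar_algebra A for A :: "'a cstar" (structure) +
  fixes \<alpha> :: "'a \<Rightarrow> 'a" and \<mu> :: complex
  assumes act_closed [simp, intro]: "a \<in> carrier A \<Longrightarrow> \<alpha> a \<in> carrier A"
    and act_add: "\<lbrakk>a \<in> carrier A; b \<in> carrier A\<rbrakk> \<Longrightarrow> \<alpha> (a \<oplus> b) = \<alpha> a \<oplus> \<alpha> b"
    and act_scale: "a \<in> carrier A \<Longrightarrow> \<alpha> (c \<odot> a) = c \<odot> \<alpha> a"
    and act_le: "a \<in> carrier A \<Longrightarrow> nrm A (\<alpha> a) \<le> nrm A a"
    and aperiodic: "aperiodic \<mu>"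
begin

lemma \<mu>_props: "cmod \<mu> = 1" "\<mu> \<noteq> 0" "k \<noteq> 0 \<Longrightarrow> \<mu> powi k \<noteq> 1"
  using aperiodic by (auto simp: aperiodic_def)

text \<open>Averaging the powers of \<open>\<mu>\<^sup>-\<^sup>j \<alpha>\<close> isolates the component of degree \<open>j\<close>.\<close>

lemma nrm_component_le:
  fixes s :: "int \<Rightarrow> 'a"
  assumes F: "finite F" "j \<in> F" and s: "\<And>k. k \<in> F \<Longrightarrow> s k \<in> carrier A"
    and eig: "\<And>k. k \<in> F \<Longrightarrow> \<alpha> (s k) = (\<mu> powi k) \<odot> s k"
  shows "nrm A (s j) \<le> nrm A (finsum A s F)"
proof -
  \<comment> \<open>\<open>\<beta>\<close> fixes degree j and multiplies degree k by
    \<open>\<mu> powi (k - j)\<close>; \<open>T n\<close> is the sum of its powers with exponents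
    below n, in Horner form.\<close>
  define \<beta> where "\<beta> a = (\<mu> powi (- j)) \<odot> \<alpha> a" for a
  define T where "T n a = rec_nat \<zero> (\<lambda>_ y. a \<oplus> \<beta> y) n" for n a
  have T0: "T 0 a = \<zero>" and TS: "T (Suc n) a = a \<oplus> \<beta> (T n a)" for n a
    by (simp_all add: T_def)
  have \<beta>c: "\<beta> a \<in> carrier A" if "a \<in> carrier A" for a using that by (simp add: \<beta>_def)
  have Tc: "T n a \<in> carrier A" if "a \<in> carrier A" for n a
    using that by (induction n) (auto simp: T0 TS \<beta>c)
  have \<beta>_add: "\<beta> (a \<oplus> b) = \<beta> a \<oplus> \<beta> b" if "a \<in> carrier A" "b \<in> carrier A" for a b
    using that by (simp add: \<beta>_def act_add scale_add_right)
  have \<alpha>0: "\<alpha> \<zero> = \<zero>" using act_scale[of \<zero> 0] by simp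
  have T_add: "T n (a \<oplus> b) = T n a \<oplus> T n b" if "a \<in> carrier A" "b \<in> carrier A" for n a b
  proof (induction n)
    case (Suc n)
    thus ?case using that Tc \<beta>c by (simp add: TS \<beta>_add M.a_ac)
  qed (simp add: T0)
  have \<beta>_le: "nrm A (\<beta> a) \<le> nrm A a" if "a \<in> carrier A" for a
    using act_le[OF that] that \<mu>_props by (simp add: \<beta>_def norm_power_int)
  have T_le: "nrm A (T n a) \<le> real n * nrm A a" if a: "a \<in> carrier A" for n a
  proof (induction n)
    case (Suc n)
    have "nrm A (T (Suc n) a) \<le> nrm A a + nrm A (\<beta> (T n a))"
      unfolding TS using a Tc \<beta>c by (intro nrm_triangle) auto
    thus ?case using \<beta>_le[OF Tc[OF a], of n] Suc by (simp add: algebra_simps)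
  qed (simp add: T0)
  have T_eig: "T n (s k) = (\<Sum>i<n. (\<mu> powi (k - j)) ^ i) \<odot> s k" if k: "k \<in> F" for n k
  proof (induction n)
    case 0
    show ?case using s[OF k] by (simp add: T0)
  next
    case (Suc n)
    have pw: "\<mu> powi (- j) * \<mu> powi k = \<mu> powi (k - j)"
      using \<mu>_props by (simp flip: power_int_add)
    have "T (Suc n) (s k) = s k \<oplus> ((\<Sum>i<n. (\<mu> powi (k - j)) ^ i) * \<mu> powi (k - j)) \<odot> s k"
      using s[OF k] eig[OF k] pw
      by (simp add: TS Suc \<beta>_def act_scale mult.assoc mult.left_commute[of "\<mu> powi (- j)"])
    also have "\<dots> = (1 + (\<Sum>i<n. (\<mu> powi (k - j)) ^ i) * \<mu> powi (k - j)) \<odot> s k"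
      using s[OF k] by (simp add: scale_add_left)
    also have "1 + (\<Sum>i<n. (\<mu> powi (k - j)) ^ i) * \<mu> powi (k - j)
        = (\<Sum>i<Suc n. (\<mu> powi (k - j)) ^ i)"
      unfolding sum.lessThan_Suc_shift by (simp add: sum_distrib_left mult.commute)
    finally show ?case .
  qed
  \<comment> \<open>Summands of degree other than j contribute geometric sums with ratio different
    from 1, so their \<open>T n\<close> stays bounded as n grows.\<close>
  have bounded: "\<exists>C. \<forall>n. nrm A (T n (finsum A s E)) \<le> C"
    if "finite E" "E \<subseteq> F - {j}" for E
    using that
  proof (induction E)
    case empty
    have "T n \<zero> = \<zero>" for n
      by (induction n) (auto simp: T0 TS \<beta>_def \<alpha>0)
    thus ?case by (intro exI[of _ 0]) simp
  next
    case (insert k E)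
    then obtain C where C: "\<And>n. nrm A (T n (finsum A s E)) \<le> C" by auto
    have kF: "k \<in> F" "k \<noteq> j" using insert by auto
    have c: "s k \<in> carrier A" "finsum A s E \<in> carrier A"
      using insert s by (auto intro!: M.finsum_closed)
    let ?z = "\<mu> powi (k - j)"
    have z: "cmod ?z = 1" "?z \<noteq> 1"
      using \<mu>_props kF by (auto simp: norm_power_int)
    have "nrm A (T n (finsum A s (insert k E))) \<le> 2 / cmod (1 - ?z) * nrm A (s k) + C" for n
    proof -
      have "T n (finsum A s (insert k E)) = T n (s k) \<oplus> T n (finsum A s E)"
        using insert c s by (subst M.finsum_insert) (auto simp: T_add)
      hence "nrm A (T n (finsum A s (insert k E)))
          \<le> nrm A (T n (s k)) + nrm A (T n (finsum A s E))"
        using c Tc nrm_triangle by simp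
      moreover have "nrm A (T n (s k)) \<le> 2 / cmod (1 - ?z) * nrm A (s k)"
        unfolding T_eig[OF kF(1)]
        using c norm_geometric_sum_le[OF z, of n] nrm_nonneg[OF c(1)]
        by (simp only: nrm_smult) (intro mult_right_mono)
      ultimately show ?thesis using C[of n] by linarith
    qed
    thus ?case by blast
  qed
  define R where "R = finsum A s (F - {j})"
  obtain C where C: "\<And>n. nrm A (T n R) \<le> C"
    using bounded[of "F - {j}"] F by (auto simp: R_def)
  have sj: "s j \<in> carrier A" and Rc: "R \<in> carrier A"
    using F s by (auto simp: R_def intro!: M.finsum_closed)
  have split: "finsum A s F = s j \<oplus> R"
    using M.finsum_insert[of "F - {j}" j s] F s by (simp add: R_def insert_absorb Pi_iff)
  have Fc: "finsum A s F \<in> carrier A" using sj Rc split by simp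
  \<comment> \<open>\<open>T n\<close> multiplies the component of degree j by n and has norm at
    most n itself; the bounded contribution C of the other degrees is lost on division by n.\<close>
  have key: "real n * nrm A (s j) \<le> real n * nrm A (finsum A s F) + C" for n
  proof -
    have "T n (s j) = complex_of_nat n \<odot> s j" using T_eig[OF F(2), of n] by simp
    hence "real n * nrm A (s j) = nrm A (T n (s j))" using sj by simp
    also have "T n (s j) = T n (finsum A s F) \<ominus> T n R"
      using T_add[OF sj Rc] Tc[OF sj] Tc[OF Rc] unfolding split
      by (simp add: a_minus_def M.a_assoc M.r_neg)
    also have "nrm A \<dots> \<le> nrm A (T n (finsum A s F)) + nrm A (T n R)"
      using Tc Fc Rc by (intro nrm_diff_le) auto
    also have "\<dots> \<le> real n * nrm A (finsum A s F) + C"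
      using T_le[OF Fc, of n] C[of n] by linarith
    finally show ?thesis .
  qed
  show ?thesis
  proof (rule ccontr)
    assume "\<not> ?thesis"
    hence d: "nrm A (s j) - nrm A (finsum A s F) > 0" (is "?d > 0") by simp
    obtain n where "C < real n * ?d" using reals_Archimedean3[OF d] by blast
    thus False using key[of n] by (simp add: algebra_simps)
  qed
qed

end

lemma (in cstar_algebra) rotation_action_conjugation:
  assumes w: "unitary_in A w" and "aperiodic \<mu>"
  shows "rotation_action A (\<lambda>a. w \<otimes> a \<otimes> star A w) \<mu>"
proof
  note u = unitaryD[OF w]
  fix a b c assume a: "a \<in> carrier A"
  show "w \<otimes> a \<otimes> star A w \<in> carrier A" using a u by simp
  show "w \<otimes> (c \<odot> a) \<otimes> star A w = c \<odot> (w \<otimes> a \<otimes> star A w)" using a u by simp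
  have "nrm A (w \<otimes> a \<otimes> star A w) \<le> nrm A (w \<otimes> a) * nrm A (star A w)"
    using a u by (intro nrm_mult) auto
  also have "\<dots> \<le> (nrm A w * nrm A a) * nrm A (star A w)"
    using a u by (intro mult_right_mono nrm_mult) (auto simp: nrm_nonneg)
  also have "\<dots> \<le> (1 * nrm A a) * 1"
    using a u nrm_isometry_le[of w] by (intro mult_mono) (auto simp: nrm_nonneg)
  finally show "nrm A (w \<otimes> a \<otimes> star A w) \<le> nrm A a" by simp
  assume "b \<in> carrier A"
  thus "w \<otimes> (a \<oplus> b) \<otimes> star A w = w \<otimes> a \<otimes> star A w \<oplus> w \<otimes> b \<otimes> star A w"
    using a u by (simp add: l_distr r_distr)
qed fact

section \<open>Comparison of norms on graded pairs\<close>

context cstar_algebra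
begin

definition sqpow :: "nat \<Rightarrow> 'a \<Rightarrow> 'a" where
  "sqpow n a = ((\<lambda>b. b \<otimes> b) ^^ n) a"

lemma sqpow_simps [simp]: "sqpow 0 a = a" "sqpow (Suc n) a = sqpow n a \<otimes> sqpow n a"
  by (simp_all add: sqpow_def)

text \<open>For selfadjoint b the C*-identity says that the norm of b^2 is the square of the norm of
  b, so repeated squaring loses nothing; for general elements the power may be much smaller.\<close>

lemma sqpow_selfadjoint:
  assumes "a \<in> carrier A" "star A a = a"
  shows "sqpow n a \<in> carrier A \<and> star A (sqpow n a) = sqpow n a
    \<and> nrm A (sqpow n a) = nrm A a ^ (2 ^ n)"
proof (induction n)
  case (Suc n)
  have "nrm A (sqpow n a \<otimes> sqpow n a) = (nrm A (sqpow n a))\<^sup>2"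
    using Suc cstar_identity[of "sqpow n a"] by simp
  also have "\<dots> = nrm A a ^ (2 ^ Suc n)"
    using Suc by (simp flip: power_mult add: mult.commute)
  finally show ?case using Suc by simp
qed (use assms in simp)

end

text \<open>If x = (1 + \<delta>) y with \<delta> > 0, the left side grows exponentially in 2^n
  relative to the power of y, and no linear factor keeps up.\<close>

lemma le_of_power_le_linear:
  fixes x y K :: real
  assumes "0 \<le> x" "0 \<le> y" and le: "\<And>n. x ^ (2 ^ n) \<le> (K * 2 ^ n + 1) * y ^ (2 ^ n)"
  shows "x \<le> y"
proof (rule ccontr)
  assume "\<not> x \<le> y"
  hence xy: "y < x" by simp
  \<comment> \<open>The case n = 0, that is exponent 1, excludes y = 0.\<close>
  have ypos: "y > 0"
  proof (rule ccontr)
    assume "\<not> y > 0"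
    hence "x \<le> 0" using assms(2) le[of 0] by simp
    thus False using xy assms by simp
  qed
  define \<delta> where "\<delta> = x / y - 1"
  have \<delta>: "\<delta> > 0" using xy ypos by (simp add: \<delta>_def)
  have pw: "(1 + \<delta>) ^ (2 ^ n) \<le> K * 2 ^ n + 1" for n
    using le[of n] ypos by (simp add: \<delta>_def power_divide divide_le_eq)
  \<comment> \<open>Bernoulli's inequality is only linear in 2^n, like the right side; squaring it
    gives a quadratic lower bound at the exponent 2^(n+1).\<close>
  have "2 ^ n * \<delta>\<^sup>2 \<le> 2 * \<bar>K\<bar> + 1" for n :: nat
  proof -
    have "(2 ^ n * \<delta>)\<^sup>2 \<le> ((1 + \<delta>) ^ (2 ^ n))\<^sup>2"
      using Bernoulli_inequality[of \<delta> "2 ^ n"] \<delta> by (intro power_mono) auto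
    also have "\<dots> = (1 + \<delta>) ^ (2 ^ Suc n)" by (simp flip: power_mult add: mult.commute)
    also have "\<dots> \<le> K * 2 ^ Suc n + 1" by (rule pw)
    also have "\<dots> \<le> \<bar>K\<bar> * 2 ^ Suc n + 2 ^ n" by (intro add_mono mult_right_mono) auto
    also have "\<dots> = 2 ^ n * (2 * \<bar>K\<bar> + 1)" by (simp add: algebra_simps)
    finally have "2 ^ n * (2 ^ n * \<delta>\<^sup>2) \<le> 2 ^ n * (2 * \<bar>K\<bar> + 1)"
      by (simp add: power_mult_distrib power2_eq_square mult.assoc mult.left_commute)
    thus ?thesis by simp
  qed
  moreover obtain n :: nat where "(2 * \<bar>K\<bar> + 1) / \<delta>\<^sup>2 < 2 ^ n"
    using real_arch_pow[of 2 "(2 * \<bar>K\<bar> + 1) / \<delta>\<^sup>2"] by auto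
  ultimately show False using \<delta> by (simp add: divide_less_eq not_less[symmetric])
qed

text \<open>\<open>S k\<close> relates elements of degree k of the two algebras. A relation is used
  because the bound goes from A1 to A2, and a map in that direction is well defined only after the
  bound is known. The rotation lives on A1, and homogeneous pairs already satisfy the bound.\<close>

locale graded_pair = A1: rotation_action A1 \<alpha> \<mu> + A2: cstar_algebra A2
  for A1 :: "'a cstar" and A2 :: "'b cstar" and \<alpha> \<mu> +
  fixes S :: "int \<Rightarrow> 'a \<Rightarrow> 'b \<Rightarrow> bool"
  assumes S_carrier: "S k a b \<Longrightarrow> a \<in> carrier A1 \<and> b \<in> carrier A2"
    and S_zero: "S k \<zero>\<^bsub>A1\<^esub> \<zero>\<^bsub>A2\<^esub>"
    and S_add: "\<lbrakk>S k a b; S k a' b'\<rbrakk> \<Longrightarrow> S k (a \<oplus>\<^bsub>A1\<^esub> a') (b \<oplus>\<^bsub>A2\<^esub> b')"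
    and S_mult: "\<lbrakk>S k a b; S l a' b'\<rbrakk> \<Longrightarrow> S (k + l) (a \<otimes>\<^bsub>A1\<^esub> a') (b \<otimes>\<^bsub>A2\<^esub> b')"
    and S_scale: "S k a b \<Longrightarrow> S k (c \<odot>\<^bsub>A1\<^esub> a) (c \<odot>\<^bsub>A2\<^esub> b)"
    and S_star: "S k a b \<Longrightarrow> S (- k) (star A1 a) (star A2 b)"
    and S_le: "S k a b \<Longrightarrow> nrm A2 b \<le> nrm A1 a"
    and S_eigen: "S k a b \<Longrightarrow> \<alpha> a = (\<mu> powi k) \<odot>\<^bsub>A1\<^esub> a"
begin

inductive G :: "nat \<Rightarrow> 'a \<Rightarrow> 'b \<Rightarrow> bool" where
  homog: "\<lbrakk>\<bar>k\<bar> \<le> int N; S k a b\<rbrakk> \<Longrightarrow> G N a b"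
| sum: "\<lbrakk>G N a b; G N a' b'\<rbrakk> \<Longrightarrow> G N (a \<oplus>\<^bsub>A1\<^esub> a') (b \<oplus>\<^bsub>A2\<^esub> b')"

lemma G_carrier: "G N a b \<Longrightarrow> a \<in> carrier A1 \<and> b \<in> carrier A2"
  by (induction rule: G.induct) (use S_carrier in auto)

lemma G_mono: "\<lbrakk>G N a b; N \<le> M\<rbrakk> \<Longrightarrow> G M a b"
proof (induction rule: G.induct)
  case (homog k N a b)
  thus ?case by (intro G.homog[of k]) auto
qed (auto intro: sum)

lemma G_star: "G N a b \<Longrightarrow> G N (star A1 a) (star A2 b)"
proof (induction rule: G.induct)
  case (homog k N a b)
  thus ?case using G.homog[of "- k"] S_star by auto
next
  case (sum N a b a' b')
  thus ?case using G_carrier G.sum by simp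
qed

lemma G_scale: "G N a b \<Longrightarrow> G N (c \<odot>\<^bsub>A1\<^esub> a) (c \<odot>\<^bsub>A2\<^esub> b)"
proof (induction rule: G.induct)
  case (homog k N a b)
  thus ?case using G.homog S_scale by blast
next
  case (sum N a b a' b')
  thus ?case using G_carrier G.sum by (simp add: A1.scale_add_right A2.scale_add_right)
qed

lemma G_mult:
  assumes "G N a b" "G M a' b'" shows "G (N + M) (a \<otimes>\<^bsub>A1\<^esub> a') (b \<otimes>\<^bsub>A2\<^esub> b')"
  using assms
proof (induction rule: G.induct)
  case (homog k N a b)
  note ab = homog
  show ?case using ab(3)
  proof (induction rule: G.induct)
    case (homog l M a' b')
    thus ?case using ab S_mult by (intro G.homog[of "k + l"]) auto
  next
    case (sum M c d c' d')
    thus ?case using G_carrier ab(2) S_carrier G.sum by (simp add: A1.r_distr A2.r_distr)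
  qed
next
  case (sum N c d c' d')
  thus ?case using G_carrier G.sum by (simp add: A1.l_distr A2.l_distr)
qed

text \<open>Collects the summands of equal degree, padding with zeros, since averaging isolates one
  summand for each degree.\<close>

lemma G_components:
  assumes "G N a b"
  obtains s t where "\<And>k. S k (s k) (t k)"
    "a = finsum A1 s {- int N..int N}" "b = finsum A2 t {- int N..int N}"
proof -
  have "\<exists>s t. (\<forall>k. S k (s k) (t k)) \<and>
      a = finsum A1 s {- int N..int N} \<and> b = finsum A2 t {- int N..int N}"
    using assms
  proof (induction rule: G.induct)
    case (homog k N a b)
    let ?s = "\<lambda>j. if k = j then a else \<zero>\<^bsub>A1\<^esub>" and ?t = "\<lambda>j. if k = j then b else \<zero>\<^bsub>A2\<^esub>"
    have "k \<in> {- int N..int N}" using homog(1) by auto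
    moreover have "a \<in> carrier A1" "b \<in> carrier A2" using S_carrier homog(2) by auto
    ultimately have "finsum A1 ?s {- int N..int N} = a" "finsum A2 ?t {- int N..int N} = b"
      by (simp_all add: A1.M.finsum_singleton[of k _ "\<lambda>_. a"] A2.M.finsum_singleton[of k _ "\<lambda>_. b"])
    moreover have "\<forall>j. S j (?s j) (?t j)" using homog S_zero by simp
    ultimately show ?case by metis
  next
    case (sum N a b a' b')
    then obtain s t s' t' where
      st: "\<And>k. S k (s k) (t k)" "a = finsum A1 s {- int N..int N}" "b = finsum A2 t {- int N..int N}" and
      st': "\<And>k. S k (s' k) (t' k)" "a' = finsum A1 s' {- int N..int N}" "b' = finsum A2 t' {- int N..int N}"
      by blast
    have c: "s k \<in> carrier A1" "s' k \<in> carrier A1" "t k \<in> carrier A2" "t' k \<in> carrier A2" for k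
      using S_carrier st(1)[of k] st'(1)[of k] by auto
    show ?case
    proof (intro exI conjI allI)
      show "S k (s k \<oplus>\<^bsub>A1\<^esub> s' k) (t k \<oplus>\<^bsub>A2\<^esub> t' k)" for k
        using S_add st(1) st'(1) by blast
      show "a \<oplus>\<^bsub>A1\<^esub> a' = finsum A1 (\<lambda>k. s k \<oplus>\<^bsub>A1\<^esub> s' k) {- int N..int N}"
        unfolding st(2) st'(2) using c by (subst A1.M.finsum_addf) auto
      show "b \<oplus>\<^bsub>A2\<^esub> b' = finsum A2 (\<lambda>k. t k \<oplus>\<^bsub>A2\<^esub> t' k) {- int N..int N}"
        unfolding st(3) st'(3) using c by (subst A2.M.finsum_addf) auto
    qed
  qed
  thus ?thesis using that by blast
qed

lemma G_le_linear:
  assumes "G N a b" shows "nrm A2 b \<le> (2 * real N + 1) * nrm A1 a"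
proof -
  obtain s t where st: "\<And>k. S k (s k) (t k)"
    "a = finsum A1 s {- int N..int N}" "b = finsum A2 t {- int N..int N}"
    using G_components[OF assms] by blast
  let ?F = "{- int N..int N}"
  have c: "s k \<in> carrier A1" "t k \<in> carrier A2" for k using S_carrier st(1)[of k] by auto
  have "nrm A2 b \<le> (\<Sum>k\<in>?F. nrm A2 (t k))"
    unfolding st(3) using c by (intro A2.nrm_finsum_le) auto
  also have "\<dots> \<le> (\<Sum>k\<in>?F. nrm A1 a)"
  proof (rule sum_mono)
    fix k assume k: "k \<in> ?F"
    have "nrm A2 (t k) \<le> nrm A1 (s k)" using S_le st(1) by blast
    also have "\<dots> \<le> nrm A1 a"
      unfolding st(2) using k c S_eigen[OF st(1)] by (intro A1.nrm_component_le) auto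
    finally show "nrm A2 (t k) \<le> nrm A1 a" .
  qed
  also have "\<dots> = (2 * real N + 1) * nrm A1 a" by simp
  finally show ?thesis .
qed

text \<open>The \<open>2\<^sup>n\<close>-th power of \<open>a\<^sup>*a\<close> has norm \<open>\<parallel>a\<parallel>\<close> to the power \<open>2\<^sup>n\<^sup>+\<^sup>1\<close>, while its degree grows only linearly
  in \<open>2\<^sup>n\<close>; so the factor in the previous bound disappears in the limit.\<close>

lemma G_le:
  assumes "G N a b" shows "nrm A2 b \<le> nrm A1 a"
proof -
  have c: "a \<in> carrier A1" "b \<in> carrier A2" using G_carrier assms by auto
  let ?a = "star A1 a \<otimes>\<^bsub>A1\<^esub> a" and ?b = "star A2 b \<otimes>\<^bsub>A2\<^esub> b"
  \<comment> \<open>The product of \<open>star A1 a\<close> and a has degree at most 2N, and each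
    squaring doubles the degree.\<close>
  have "G (2 * N * 2 ^ n) (A1.sqpow n ?a) (A2.sqpow n ?b)" for n
  proof (induction n)
    case 0
    show ?case using G_mult[OF G_star[OF assms] assms] by (simp add: mult_2)
  next
    case (Suc n)
    have "2 * N * 2 ^ n + 2 * N * 2 ^ n = 2 * N * 2 ^ Suc n" by simp
    thus ?case using G_mult[OF Suc Suc] by simp
  qed
  note pw = G_le_linear[OF this]
  \<comment> \<open>or is it\<close>
  have "nrm A2 ?b \<le> nrm A1 ?a"
  proof (rule le_of_power_le_linear[where K = "4 * real N"])
    show "nrm A2 ?b ^ 2 ^ n \<le> (4 * real N * 2 ^ n + 1) * nrm A1 ?a ^ 2 ^ n" for n
      using pw[of n] A1.sqpow_selfadjoint[of ?a n] A2.sqpow_selfadjoint[of ?b n] c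
      by (simp add: mult.assoc)
  qed (use c in \<open>auto simp: A1.nrm_nonneg A2.nrm_nonneg\<close>)
  hence "(nrm A2 b)\<^sup>2 \<le> (nrm A1 a)\<^sup>2"
    using A1.cstar_identity A2.cstar_identity c by simp
  thus ?thesis using A1.nrm_nonneg[OF c(1)] by (rule power2_le_imp_le)
qed

end

section \<open>Continuous functions on a compact set\<close>

lemma cstar_algebraI:
  fixes A :: "'a cstar" (structure)
  assumes add: "\<And>a b. \<lbrakk>a \<in> carrier A; b \<in> carrier A\<rbrakk> \<Longrightarrow> a \<oplus> b \<in> carrier A"
      "\<zero> \<in> carrier A"
      "\<And>a b c. \<lbrakk>a \<in> carrier A; b \<in> carrier A; c \<in> carrier A\<rbrakk> \<Longrightarrow> (a \<oplus> b) \<oplus> c = a \<oplus> (b \<oplus> c)"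
      "\<And>a b. \<lbrakk>a \<in> carrier A; b \<in> carrier A\<rbrakk> \<Longrightarrow> a \<oplus> b = b \<oplus> a"
      "\<And>a. a \<in> carrier A \<Longrightarrow> \<zero> \<oplus> a = a"
    and mult: "\<And>a b. \<lbrakk>a \<in> carrier A; b \<in> carrier A\<rbrakk> \<Longrightarrow> a \<otimes> b \<in> carrier A"
      "\<one> \<in> carrier A"
      "\<And>a b c. \<lbrakk>a \<in> carrier A; b \<in> carrier A; c \<in> carrier A\<rbrakk> \<Longrightarrow> (a \<otimes> b) \<otimes> c = a \<otimes> (b \<otimes> c)"
      "\<And>a. a \<in> carrier A \<Longrightarrow> \<one> \<otimes> a = a" "\<And>a. a \<in> carrier A \<Longrightarrow> a \<otimes> \<one> = a"
    and distr: "\<And>a b c. \<lbrakk>a \<in> carrier A; b \<in> carrier A; c \<in> carrier A\<rbrakk> \<Longrightarrow> (a \<oplus> b) \<otimes> c = a \<otimes> c \<oplus> b \<otimes> c"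
      "\<And>a b c. \<lbrakk>a \<in> carrier A; b \<in> carrier A; c \<in> carrier A\<rbrakk> \<Longrightarrow> c \<otimes> (a \<oplus> b) = c \<otimes> a \<oplus> c \<otimes> b"
    and scale: "\<And>a c. a \<in> carrier A \<Longrightarrow> c \<odot> a \<in> carrier A"
      "\<And>a c d. a \<in> carrier A \<Longrightarrow> (c + d) \<odot> a = c \<odot> a \<oplus> d \<odot> a"
      "\<And>a b c. \<lbrakk>a \<in> carrier A; b \<in> carrier A\<rbrakk> \<Longrightarrow> c \<odot> (a \<oplus> b) = c \<odot> a \<oplus> c \<odot> b"
      "\<And>a c d. a \<in> carrier A \<Longrightarrow> (c * d) \<odot> a = c \<odot> (d \<odot> a)"
      "\<And>a. a \<in> carrier A \<Longrightarrow> 1 \<odot> a = a" "\<And>a. a \<in> carrier A \<Longrightarrow> 0 \<odot> a = \<zero>"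
      "\<And>a b c. \<lbrakk>a \<in> carrier A; b \<in> carrier A\<rbrakk> \<Longrightarrow> (c \<odot> a) \<otimes> b = c \<odot> (a \<otimes> b)"
      "\<And>a b c. \<lbrakk>a \<in> carrier A; b \<in> carrier A\<rbrakk> \<Longrightarrow> a \<otimes> (c \<odot> b) = c \<odot> (a \<otimes> b)"
    and star: "\<And>a. a \<in> carrier A \<Longrightarrow> star A a \<in> carrier A"
      "\<And>a. a \<in> carrier A \<Longrightarrow> star A (star A a) = a"
      "\<And>a b. \<lbrakk>a \<in> carrier A; b \<in> carrier A\<rbrakk> \<Longrightarrow> star A (a \<oplus> b) = star A a \<oplus> star A b"
      "\<And>a c. a \<in> carrier A \<Longrightarrow> star A (c \<odot> a) = cnj c \<odot> star A a"
      "\<And>a b. \<lbrakk>a \<in> carrier A; b \<in> carrier A\<rbrakk> \<Longrightarrow> star A (a \<otimes> b) = star A b \<otimes> star A a"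
    and nrm: "\<And>a. a \<in> carrier A \<Longrightarrow> 0 \<le> nrm A a"
      "\<And>a. a \<in> carrier A \<Longrightarrow> nrm A a = 0 \<longleftrightarrow> a = \<zero>"
      "\<And>a b. \<lbrakk>a \<in> carrier A; b \<in> carrier A\<rbrakk> \<Longrightarrow> nrm A (a \<oplus> b) \<le> nrm A a + nrm A b"
      "\<And>a c. a \<in> carrier A \<Longrightarrow> nrm A (c \<odot> a) = cmod c * nrm A a"
      "\<And>a b. \<lbrakk>a \<in> carrier A; b \<in> carrier A\<rbrakk> \<Longrightarrow> nrm A (a \<otimes> b) \<le> nrm A a * nrm A b"
      "\<And>a. a \<in> carrier A \<Longrightarrow> nrm A (star A a \<otimes> a) = (nrm A a)\<^sup>2"
    and complete: "\<And>s :: nat \<Rightarrow> 'a. \<lbrakk>\<And>n. s n \<in> carrier A;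
        \<And>e. e > 0 \<Longrightarrow> \<exists>N. \<forall>m\<ge>N. \<forall>n\<ge>N. nrm A (s m \<oplus> (- 1) \<odot> s n) < e\<rbrakk>
        \<Longrightarrow> \<exists>l\<in>carrier A. (\<lambda>n. nrm A (s n \<oplus> (- 1) \<odot> l)) \<longlonglongrightarrow> 0"
  shows "cstar_algebra A"
proof -
  have neg: "(- 1) \<odot> a \<oplus> a = \<zero>" if "a \<in> carrier A" for a
    using scale(2)[OF that, of "-1" 1] scale(5,6)[OF that] by simp
  have ag: "abelian_group A"
  proof (rule abelian_groupI)
    fix a assume a: "a \<in> carrier A"
    show "\<exists>b\<in>carrier A. b \<oplus> a = \<zero>" using neg[OF a] scale(1)[OF a, of "-1"] by blast
  qed (use add in auto)
  have mon: "Group.monoid A" using mult by (intro monoidI) auto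
  interpret ring A using distr by (intro ringI ag mon) auto
  interpret module complex_ring A
    using scale by (intro moduleI cring_complex_ring ag) auto
  have minus: "a \<ominus> b = a \<oplus> (- 1) \<odot> b" if "a \<in> carrier A" "b \<in> carrier A" for a b
    using abelian_group.minus_equality[OF ag neg[OF that(2)]] that scale(1) by (simp add: a_minus_def)
  have commute: "nrm A (a \<ominus> b) = nrm A (b \<ominus> a)" if "a \<in> carrier A" "b \<in> carrier A" for a b
  proof -
    have "(- 1) \<odot> (b \<oplus> (- 1) \<odot> a) = (- 1) \<odot> b \<oplus> ((- 1) * (- 1)) \<odot> a"
      unfolding scale(4)[OF that(1)] using that by (intro scale(3) scale(1))
    also have "\<dots> = a \<oplus> (- 1) \<odot> b"
      using that scale(1,5) add(4)[OF that(1)] by simp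
    finally have "nrm A (a \<ominus> b) = nrm A ((- 1) \<odot> (b \<ominus> a))" using that minus by simp
    thus ?thesis using that nrm(4)[of "b \<ominus> a" "-1"] by simp
  qed
  have tri: "nrm A (a \<ominus> c) \<le> nrm A (a \<ominus> b) + nrm A (b \<ominus> c)"
    if "a \<in> carrier A" "b \<in> carrier A" "c \<in> carrier A" for a b c
  proof -
    have "(a \<ominus> b) \<oplus> (b \<ominus> c) = a \<ominus> c" using that by algebra
    thus ?thesis using nrm(3)[of "a \<ominus> b" "b \<ominus> c"] that by simp
  qed
  interpret M: Metric_space "carrier A" "cstar_dist A"
    by unfold_locales (use nrm(1,2) commute tri in \<open>auto simp: cstar_dist_def\<close>)
  have "M.mcomplete"
    unfolding M.mcomplete_def
  proof (intro allI impI)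
    fix s assume s: "M.MCauchy s"
    hence sc: "s n \<in> carrier A" for n by (auto simp: M.MCauchy_def)
    have "\<exists>N. \<forall>m\<ge>N. \<forall>n\<ge>N. nrm A (s m \<oplus> (- 1) \<odot> s n) < e" if "e > 0" for e
      using s that sc by (auto simp: M.MCauchy_def cstar_dist_def minus)
    then obtain l where l: "l \<in> carrier A" "(\<lambda>n. nrm A (s n \<oplus> (- 1) \<odot> l)) \<longlonglongrightarrow> 0"
      using complete[of s] sc by blast
    have "(\<lambda>n. cstar_dist A (s n) l) = (\<lambda>n. nrm A (s n \<oplus> (- 1) \<odot> l))"
      using sc l(1) by (simp add: cstar_dist_def minus)
    thus "\<exists>x. limitin M.mtopology s x sequentially"
      using sc l by (auto simp: M.limitin_metric_dist_null)
  qed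
  thus ?thesis
    by unfold_locales (use scale(7,8) star nrm in auto)
qed

definition supnorm :: "complex set \<Rightarrow> (complex \<Rightarrow> complex) \<Rightarrow> real" where
  "supnorm K f = Sup (insert 0 ((\<lambda>z. cmod (f z)) ` K))"

lemma
  assumes "compact K" "continuous_on K f"
  shows supnorm_ge: "z \<in> K \<Longrightarrow> cmod (f z) \<le> supnorm K f"
    and supnorm_nonneg: "0 \<le> supnorm K f"
proof -
  have "compact ((\<lambda>z. cmod (f z)) ` K)"
    using assms by (intro compact_continuous_image continuous_intros)
  hence b: "bdd_above (insert 0 ((\<lambda>z. cmod (f z)) ` K))"
    by (simp add: bounded_imp_bdd_above compact_imp_bounded)
  show "z \<in> K \<Longrightarrow> cmod (f z) \<le> supnorm K f" "0 \<le> supnorm K f"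
    unfolding supnorm_def by (rule cSup_upper[OF _ b], simp)+
qed

lemma supnorm_le: "\<lbrakk>0 \<le> M; \<And>z. z \<in> K \<Longrightarrow> cmod (f z) \<le> M\<rbrakk> \<Longrightarrow> supnorm K f \<le> M"
  unfolding supnorm_def by (rule cSup_least) auto

lemma supnorm_cong: "(\<And>z. z \<in> K \<Longrightarrow> cmod (f z) = cmod (g z)) \<Longrightarrow> supnorm K f = supnorm K g"
  unfolding supnorm_def by (simp cong: image_cong)

lemma cont_algebra_simps [simp]:
  "carrier (cont_algebra K) = {f \<in> extensional K. continuous_on K f}"
  "f \<otimes>\<^bsub>cont_algebra K\<^esub> g = (\<lambda>z\<in>K. f z * g z)" "\<one>\<^bsub>cont_algebra K\<^esub> = (\<lambda>z\<in>K. 1)"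
  "\<zero>\<^bsub>cont_algebra K\<^esub> = (\<lambda>z\<in>K. 0)" "f \<oplus>\<^bsub>cont_algebra K\<^esub> g = (\<lambda>z\<in>K. f z + g z)"
  "c \<odot>\<^bsub>cont_algebra K\<^esub> f = (\<lambda>z\<in>K. c * f z)" "star (cont_algebra K) f = (\<lambda>z\<in>K. cnj (f z))"
  "nrm (cont_algebra K) f = supnorm K f"
  by (simp_all add: cont_algebra_def supnorm_def)

lemma continuous_on_restrict [simp]: "continuous_on K (restrict f K) \<longleftrightarrow> continuous_on K f"
  by (rule continuous_on_cong) auto

lemma cstar_algebra_cont_algebra:
  assumes K: "compact K" shows "cstar_algebra (cont_algebra K)"
proof (rule cstar_algebraI, goal_cases)
  case (27 a)
  show ?case
  proof
    assume "nrm (cont_algebra K) a = 0"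
    hence "a z = 0" if "z \<in> K" for z using supnorm_ge[OF K, of a z] 27 that by simp
    thus "a = \<zero>\<^bsub>cont_algebra K\<^esub>" using 27 by (intro extensionalityI[of _ K]) auto
  next
    assume "a = \<zero>\<^bsub>cont_algebra K\<^esub>"
    thus "nrm (cont_algebra K) a = 0"
      using supnorm_le[of 0 K a] supnorm_nonneg[OF K, of a] 27 by simp
  qed
next
  case (26 a)
  thus ?case using supnorm_nonneg[OF K] by simp
next
  case (28 a b)
  have "cmod (a z + b z) \<le> supnorm K a + supnorm K b" if "z \<in> K" for z
    using norm_triangle_ineq[of "a z" "b z"] supnorm_ge[OF K, of a z] supnorm_ge[OF K, of b z] 28 that
    by simp
  thus ?case using supnorm_nonneg[OF K] 28 by (auto intro!: supnorm_le)
next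
  case (29 a c)
  have "supnorm K (\<lambda>z\<in>K. c * a z) = cmod c * supnorm K a"
  proof (rule antisym)
    show "supnorm K (\<lambda>z\<in>K. c * a z) \<le> cmod c * supnorm K a"
      using 29 supnorm_ge[OF K, of a] supnorm_nonneg[OF K, of a]
      by (intro supnorm_le) (auto simp: norm_mult intro: mult_left_mono)
    show "cmod c * supnorm K a \<le> supnorm K (\<lambda>z\<in>K. c * a z)"
    proof (cases "c = 0")
      case True
      have "continuous_on K (\<lambda>z\<in>K. c * a z)" by (simp add: True)
      thus ?thesis using supnorm_nonneg[OF K] True by simp
    next
      case False
      have ca: "continuous_on K (\<lambda>z\<in>K. c * a z)" using 29 by (auto intro!: continuous_intros)
      have "supnorm K a \<le> supnorm K (\<lambda>z\<in>K. c * a z) / cmod c"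
      proof (rule supnorm_le)
        fix z assume "z \<in> K"
        thus "cmod (a z) \<le> supnorm K (\<lambda>z\<in>K. c * a z) / cmod c"
          using supnorm_ge[OF K ca, of z] False by (simp add: norm_mult field_simps)
      qed (use supnorm_nonneg[OF K ca] in simp)
      thus ?thesis using False by (simp add: field_simps)
    qed
  qed
  thus ?case by simp
next
  case (30 a b)
  have "cmod (a z * b z) \<le> supnorm K a * supnorm K b" if "z \<in> K" for z
    unfolding norm_mult using supnorm_ge[OF K, of a z] supnorm_ge[OF K, of b z] 30 that
      supnorm_nonneg[OF K, of a] by (intro mult_mono) auto
  thus ?case using supnorm_nonneg[OF K] 30 by (auto intro!: supnorm_le)
next
  case (31 a)
  have ca: "continuous_on K a" using 31 by simp
  have ca2: "continuous_on K (\<lambda>z\<in>K. cnj (a z) * a z)"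
    using ca by (auto intro!: continuous_intros)
  have "supnorm K (\<lambda>z\<in>K. cnj (a z) * a z) \<le> (supnorm K a)\<^sup>2"
    unfolding power2_eq_square using supnorm_ge[OF K ca] supnorm_nonneg[OF K ca]
    by (intro supnorm_le) (auto simp: norm_mult intro: mult_mono)
  moreover have "supnorm K a \<le> sqrt (supnorm K (\<lambda>z\<in>K. cnj (a z) * a z))"
  proof (rule supnorm_le)
    fix z assume "z \<in> K"
    thus "cmod (a z) \<le> sqrt (supnorm K (\<lambda>z\<in>K. cnj (a z) * a z))"
      using supnorm_ge[OF K ca2, of z]
      by (intro real_le_rsqrt) (simp add: norm_mult power2_eq_square)
  qed (use supnorm_nonneg[OF K ca2] in simp)
  ultimately have "supnorm K (\<lambda>z\<in>K. cnj (a z) * a z) = (supnorm K a)\<^sup>2"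
    using supnorm_nonneg[OF K ca] supnorm_nonneg[OF K ca2]
    by (metis antisym real_sqrt_le_iff real_sqrt_unique real_sqrt_abs abs_of_nonneg)
  moreover have "nrm (cont_algebra K) (star (cont_algebra K) a \<otimes>\<^bsub>cont_algebra K\<^esub> a)
      = supnorm K (\<lambda>z\<in>K. cnj (a z) * a z)"
    unfolding cont_algebra_simps by (rule supnorm_cong) simp
  ultimately show ?case by simp
next
  case (32 s)
  have s: "continuous_on K (s n)" "s n \<in> extensional K" for n using 32(1) by auto
  have d: "supnorm K (\<lambda>z\<in>K. s m z - g z) = nrm (cont_algebra K)
      (s m \<oplus>\<^bsub>cont_algebra K\<^esub> (- 1) \<odot>\<^bsub>cont_algebra K\<^esub> g)" for m g
    unfolding cont_algebra_simps by (rule supnorm_cong) simp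
  have "uniformly_Cauchy_on K s"
  proof (rule uniformly_Cauchy_onI)
    fix e :: real assume "e > 0"
    then obtain N where N: "\<And>m n. \<lbrakk>m \<ge> N; n \<ge> N\<rbrakk> \<Longrightarrow> supnorm K (\<lambda>z\<in>K. s m z - s n z) < e"
      using 32(2) unfolding d by blast
    have "dist (s m z) (s n z) < e" if "m \<ge> N" "n \<ge> N" "z \<in> K" for m n z
    proof -
      have "continuous_on K (\<lambda>z\<in>K. s m z - s n z)" using s by (auto intro!: continuous_intros)
      from supnorm_ge[OF K this that(3)] show ?thesis
        using N[OF that(1,2)] that(3) by (simp add: dist_norm)
    qed
    thus "\<exists>M. \<forall>z\<in>K. \<forall>m\<ge>M. \<forall>n\<ge>M. dist (s m z) (s n z) < e" by blast
  qed
  then obtain l where l: "uniform_limit K s l sequentially"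
    using Cauchy_uniformly_convergent by (auto simp: uniformly_convergent_on_def)
  have cl: "continuous_on K l"
    by (rule uniform_limit_theorem[OF _ l]) (use s in auto)
  show ?case
  proof
    show "restrict l K \<in> carrier (cont_algebra K)" using cl by simp
    have "(\<lambda>n. supnorm K (\<lambda>z\<in>K. s n z - restrict l K z)) \<longlonglongrightarrow> 0"
    proof (rule LIMSEQ_I)
      fix e :: real assume e: "e > 0"
      then obtain N where N: "\<And>n z. \<lbrakk>n \<ge> N; z \<in> K\<rbrakk> \<Longrightarrow> dist (s n z) (l z) < e / 2"
        using l unfolding uniform_limit_sequentially_iff by (meson half_gt_zero)
      have "norm (supnorm K (\<lambda>z\<in>K. s n z - restrict l K z) - 0) < e" if "n \<ge> N" for n
      proof -
        have "supnorm K (\<lambda>z\<in>K. s n z - restrict l K z) \<le> e / 2"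
          using e N[OF that] by (intro supnorm_le) (auto simp: dist_norm less_imp_le)
        moreover have "continuous_on K (\<lambda>z\<in>K. s n z - restrict l K z)"
          using s cl by (auto intro!: continuous_intros)
        ultimately show ?thesis using e supnorm_nonneg[OF K] by fastforce
      qed
      thus "\<exists>N. \<forall>n\<ge>N. norm (supnorm K (\<lambda>z\<in>K. s n z - restrict l K z) - 0) < e" by blast
    qed
    thus "(\<lambda>n. nrm (cont_algebra K) (s n \<oplus>\<^bsub>cont_algebra K\<^esub> (- 1) \<odot>\<^bsub>cont_algebra K\<^esub> restrict l K))
        \<longlonglongrightarrow> 0" unfolding d .
  qed
qed (((auto simp: fun_eq_iff restrict_def extensional_def algebra_simps simp del: continuous_on_restrict)[1]; fail)
    | (simp add: continuous_on_add continuous_on_mult continuous_on_cnj; fail))+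

lemma cont_algebra_generated:
  assumes K: "compact K"
  shows "carrier (cstar_generated (cont_algebra K) {\<lambda>z\<in>K. z}) = carrier (cont_algebra K)"
    (is "carrier (cstar_generated ?C ?S) = _")
proof
  interpret cstar_algebra ?C by (rule cstar_algebra_cont_algebra[OF K])
  have S: "?S \<subseteq> carrier ?C" by simp
  define P where "P = carrier (cstar_generated ?C ?S)"
  have P: "cstar_subalgebra P ?C" unfolding P_def by (rule generated_subalgebra[OF S])
  note PD = cstar_subalgebraD[OF P]
  show "carrier (cstar_generated ?C ?S) \<subseteq> carrier ?C" using PD(1) by (simp add: P_def)
  have P_id: "(\<lambda>z\<in>K. z) \<in> P" using generators_in[of ?S] by (simp add: P_def)
  have P_const: "(\<lambda>z\<in>K. c) \<in> P" for c
  proof -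
    have "c \<odot>\<^bsub>?C\<^esub> \<one>\<^bsub>?C\<^esub> = (\<lambda>z\<in>K. c)" by (simp add: restrict_def fun_eq_iff)
    thus ?thesis using PD(5)[OF PD(2), of c] by simp
  qed
  have P_sum: "(\<lambda>z\<in>K. f z + g z) \<in> P" if "(\<lambda>z\<in>K. f z) \<in> P" "(\<lambda>z\<in>K. g z) \<in> P" for f g
    using PD(4)[OF that] by (simp add: restrict_def cong: if_cong)
  have P_mult: "(\<lambda>z\<in>K. f z * g z) \<in> P" if "(\<lambda>z\<in>K. f z) \<in> P" "(\<lambda>z\<in>K. g z) \<in> P" for f g
    using PD(3)[OF that] by (simp add: restrict_def cong: if_cong)
  have P_conj: "(\<lambda>z\<in>K. cnj (f z)) \<in> P" if "(\<lambda>z\<in>K. f z) \<in> P" for f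
    using PD(6)[OF that] by (simp add: restrict_def cong: if_cong)
  have Re: "(\<lambda>z\<in>K. complex_of_real (Re z)) \<in> P"
  proof -
    have "(\<lambda>z\<in>K. (1/2) * (z + cnj z)) \<in> P" by (intro P_mult P_sum P_conj P_const P_id)
    thus ?thesis by (simp add: complex_add_cnj)
  qed
  have Im: "(\<lambda>z\<in>K. complex_of_real (Im z)) \<in> P"
  proof -
    have "(\<lambda>z\<in>K. (- \<i>/2) * (z + (- 1) * cnj z)) \<in> P" by (intro P_mult P_sum P_conj P_const P_id)
    moreover have "(- \<i>/2) * (z + (- 1) * cnj z) = complex_of_real (Im z)" for z
      by (simp add: complex_eq_iff)
    ultimately show ?thesis by simp
  qed
  have poly: "(\<lambda>z\<in>K. complex_of_real (p z)) \<in> P" if "real_polynomial_function p" for p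
    using that
  proof induction
    case (linear f)
    have eq: "complex_of_real (f z) = complex_of_real (f 1) * complex_of_real (Re z)
        + complex_of_real (f \<i>) * complex_of_real (Im z)" for z
    proof -
      have "f z = f (Re z *\<^sub>R 1 + Im z *\<^sub>R \<i>)"
        by (rule arg_cong[of _ _ f]) (simp add: complex_eq_iff)
      also have "\<dots> = Re z * f 1 + Im z * f \<i>"
        using linear by (simp add: linear_add linear_scale bounded_linear.linear)
      finally show ?thesis by simp
    qed
    have "(\<lambda>z\<in>K. complex_of_real (f z)) = (\<lambda>z\<in>K. complex_of_real (f 1) * complex_of_real (Re z)
        + complex_of_real (f \<i>) * complex_of_real (Im z))"
      by (intro restrict_ext eq)
    thus ?case by (rule ssubst) (intro P_sum P_mult P_const Re Im)
  next
    case (const c)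
    show ?case by (rule P_const)
  next
    case (add f g)
    show ?case unfolding of_real_add by (rule P_sum[OF add.IH])
  next
    case (mult f g)
    show ?case unfolding of_real_mult by (rule P_mult[OF mult.IH])
  qed
  show "carrier ?C \<subseteq> carrier (cstar_generated ?C ?S)"
    unfolding P_def[symmetric]
  proof
    fix f assume f: "f \<in> carrier ?C"
    have "f \<in> cl P"
      unfolding cl_def
    proof (safe intro!: f)
      fix e :: real assume e: "e > 0"
      then obtain g where g: "polynomial_function g" "\<And>z. z \<in> K \<Longrightarrow> cmod (f z - g z) < e / 2"
        using Stone_Weierstrass_polynomial_function[OF K, of f "e / 2"] f by auto
      have "real_polynomial_function (Re \<circ> g)" "real_polynomial_function (Im \<circ> g)"
        using g(1) bounded_linear_Re bounded_linear_Im by (auto simp: polynomial_function_def)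
      from P_sum[OF poly[OF this(1)] P_mult[OF P_const[of \<i>] poly[OF this(2)]]]
      have gP: "(\<lambda>z\<in>K. g z) \<in> P" by (simp flip: complex_eq)
      have "(\<lambda>z\<in>K. g z) \<ominus>\<^bsub>?C\<^esub> f = (\<lambda>z\<in>K. g z - f z)"
        using f gP PD(1) by (subst minus_eq_scale) (auto simp: restrict_def)
      moreover have "supnorm K (\<lambda>z\<in>K. g z - f z) \<le> e / 2"
        using e g(2) by (intro supnorm_le) (auto simp: norm_minus_commute intro: less_imp_le)
      ultimately have "nrm ?C ((\<lambda>z\<in>K. g z) \<ominus>\<^bsub>?C\<^esub> f) \<le> e / 2" by simp
      thus "\<exists>d\<in>P. nrm ?C (d \<ominus>\<^bsub>?C\<^esub> f) < e" using e gP by force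
    qed
    thus "f \<in> P" using cl_iff[OF PD(1)] PD(7) by blast
  qed
qed

subsection \<open>Evaluating the functional calculus\<close>

lemma cfc_eq:
  assumes "cstar_hom (cont_algebra K) A \<Phi>" "compact K" "spectrum_in A a = K"
    and "\<Phi> (\<lambda>z\<in>K. z) = a" "continuous_on K f"
  shows "cfc A a f = \<Phi> (restrict f K)"
  unfolding cfc_def assms(3)
proof (rule the_equality)
  interpret \<Phi>: cstar_hom "cont_algebra K" A \<Phi> by fact
  show "\<exists>\<Psi>. star_hom (cont_algebra K) A \<Psi> \<and> \<Psi> (\<lambda>z\<in>K. z) = a \<and> \<Psi> (restrict f K) = \<Phi> (restrict f K)"
    using \<Phi>.hom assms(4) by blast
  fix b assume "\<exists>\<Psi>. star_hom (cont_algebra K) A \<Psi> \<and> \<Psi> (\<lambda>z\<in>K. z) = a \<and> \<Psi> (restrict f K) = b"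
  then obtain \<Psi> where \<Psi>: "star_hom (cont_algebra K) A \<Psi>" "\<Psi> (\<lambda>z\<in>K. z) = a" "\<Psi> (restrict f K) = b"
    by blast
  interpret \<Psi>: cstar_hom "cont_algebra K" A \<Psi> by unfold_locales (rule \<Psi>(1))
  have "\<Psi> (restrict f K) = \<Phi> (restrict f K)"
    by (rule star_homs_eq_on_generated[OF \<Psi>.cstar_hom_axioms assms(1), of "{\<lambda>z\<in>K. z}"])
      (use \<Psi>(2) assms cont_algebra_generated[OF assms(2)] in auto)
  thus "b = \<Phi> (restrict f K)" using \<Psi>(3) by simp
qed

lemma spectrum_isometric:
  assumes "cstar_hom (cont_algebra K) A \<Phi>" "compact K" "K \<noteq> {}"
    and iso: "\<And>f. f \<in> carrier (cont_algebra K) \<Longrightarrow> nrm A (\<Phi> f) = supnorm K f"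
    and g: "g \<in> carrier (cont_algebra K)"
  shows "spectrum_in A (\<Phi> g) = g ` K"
proof -
  interpret \<Phi>: cstar_hom "cont_algebra K" A \<Phi> by fact
  note [simp del] = cont_algebra_simps(1-7)
  have diff: "(c \<odot>\<^bsub>A\<^esub> \<one>\<^bsub>A\<^esub>) \<ominus>\<^bsub>A\<^esub> \<Phi> g = \<Phi> (\<lambda>z\<in>K. c - g z)" for c
  proof -
    have "(c \<odot>\<^bsub>A\<^esub> \<one>\<^bsub>A\<^esub>) \<ominus>\<^bsub>A\<^esub> \<Phi> g
        = \<Phi> (c \<odot>\<^bsub>cont_algebra K\<^esub> \<one>\<^bsub>cont_algebra K\<^esub> \<oplus>\<^bsub>cont_algebra K\<^esub> (- 1) \<odot>\<^bsub>cont_algebra K\<^esub> g)"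
      using g by (simp add: \<Phi>.B.minus_eq_scale)
    also have "c \<odot>\<^bsub>cont_algebra K\<^esub> \<one>\<^bsub>cont_algebra K\<^esub> \<oplus>\<^bsub>cont_algebra K\<^esub> (- 1) \<odot>\<^bsub>cont_algebra K\<^esub> g
        = (\<lambda>z\<in>K. c - g z)"
      by (simp add: restrict_def cont_algebra_simps cong: if_cong)
    finally show ?thesis .
  qed
  have cg: "(\<lambda>z\<in>K. c - g z) \<in> carrier (cont_algebra K)" for c
    using g by (auto simp: cont_algebra_simps intro!: continuous_intros)
  have "c \<in> g ` K" if c: "\<Phi> (\<lambda>z\<in>K. c - g z) \<notin> Units A" for c
  proof (rule ccontr)
    assume n: "c \<notin> g ` K"
    let ?f = "\<lambda>z\<in>K. 1 / (c - g z)"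
    have f: "?f \<in> carrier (cont_algebra K)"
      using g n by (auto simp: cont_algebra_simps intro!: continuous_intros)
    have "?f \<otimes>\<^bsub>cont_algebra K\<^esub> (\<lambda>z\<in>K. c - g z) = \<one>\<^bsub>cont_algebra K\<^esub>"
      "(\<lambda>z\<in>K. c - g z) \<otimes>\<^bsub>cont_algebra K\<^esub> ?f = \<one>\<^bsub>cont_algebra K\<^esub>"
      using n by (auto simp: cont_algebra_simps restrict_def fun_eq_iff)
    hence "\<Phi> ?f \<otimes>\<^bsub>A\<^esub> \<Phi> (\<lambda>z\<in>K. c - g z) = \<one>\<^bsub>A\<^esub>" "\<Phi> (\<lambda>z\<in>K. c - g z) \<otimes>\<^bsub>A\<^esub> \<Phi> ?f = \<one>\<^bsub>A\<^esub>"
      using f cg[of c] \<Phi>.mult \<Phi>.one by metis+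
    thus False using c f cg[of c] by (auto simp: Units_def)
  qed
  moreover have "\<Phi> (\<lambda>z\<in>K. g w - g z) \<notin> Units A" if w: "w \<in> K" for w
  proof
    let ?r = "\<lambda>z\<in>K. g w - g z"
    assume "\<Phi> ?r \<in> Units A"
    then obtain d where d: "d \<in> carrier A" "d \<otimes>\<^bsub>A\<^esub> \<Phi> ?r = \<one>\<^bsub>A\<^esub>" by (auto simp: Units_def)
    define e where "e = 1 / (2 * (nrm A d + 1))"
    have dn: "0 \<le> nrm A d" by (rule \<Phi>.B.nrm_nonneg[OF d(1)])
    hence e: "e > 0" by (simp add: e_def)
    let ?h = "\<lambda>z\<in>K. complex_of_real (max 0 (1 - cmod (g w - g z) / e))"
    have h: "?h \<in> carrier (cont_algebra K)"
      using g e by (auto simp: cont_algebra_simps intro!: continuous_intros)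
    have rh: "?r \<otimes>\<^bsub>cont_algebra K\<^esub> ?h \<in> carrier (cont_algebra K)" using cg h by simp
    have small: "nrm A (\<Phi> (?r \<otimes>\<^bsub>cont_algebra K\<^esub> ?h)) \<le> e"
      unfolding iso[OF rh]
    proof (rule supnorm_le)
      fix z assume z: "z \<in> K"
      show "cmod ((?r \<otimes>\<^bsub>cont_algebra K\<^esub> ?h) z) \<le> e"
      proof (cases "cmod (g w - g z) \<le> e")
        case True
        have "cmod (g w - g z) * \<bar>max 0 (1 - cmod (g w - g z) / e)\<bar> \<le> e * 1"
          using True e by (intro mult_mono) auto
        thus ?thesis using z by (simp add: cont_algebra_simps norm_mult)
      next
        case False
        hence "max 0 (1 - cmod (g w - g z) / e) = 0" using e by simp
        thus ?thesis using z e by (simp add: cont_algebra_simps)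
      qed
    qed (use e in simp)
    have "1 \<le> supnorm K ?h"
      using supnorm_ge[OF assms(2), of ?h w] h w by (simp add: cont_algebra_simps)
    also have "\<dots> = nrm A (\<Phi> ?h)" using iso[OF h] by simp
    also have "\<Phi> ?h = d \<otimes>\<^bsub>A\<^esub> (\<Phi> ?r \<otimes>\<^bsub>A\<^esub> \<Phi> ?h)"
      using d h cg by (simp flip: \<Phi>.B.m_assoc)
    also have "\<Phi> ?r \<otimes>\<^bsub>A\<^esub> \<Phi> ?h = \<Phi> (?r \<otimes>\<^bsub>cont_algebra K\<^esub> ?h)" using cg h by simp
    also have "nrm A (d \<otimes>\<^bsub>A\<^esub> \<Phi> (?r \<otimes>\<^bsub>cont_algebra K\<^esub> ?h))
        \<le> nrm A d * nrm A (\<Phi> (?r \<otimes>\<^bsub>cont_algebra K\<^esub> ?h))"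
      using d rh by (intro \<Phi>.B.nrm_mult) auto
    also have "\<dots> \<le> nrm A d * e" using small dn by (rule mult_left_mono)
    also have "\<dots> < 1" using dn by (simp add: e_def field_simps)
    finally show False by simp
  qed
  ultimately show ?thesis by (auto simp: spectrum_in_def diff)
qed

section \<open>Functional calculus for unitaries\<close>

lemma star_hom_extension:
  assumes A: "cstar_algebra A" and B: "cstar_algebra B"
    and car: "\<And>a b. \<Gamma> a b \<Longrightarrow> a \<in> carrier A \<and> b \<in> carrier B"
    and one: "\<Gamma> \<one>\<^bsub>A\<^esub> \<one>\<^bsub>B\<^esub>"
    and add: "\<And>a b a' b'. \<lbrakk>\<Gamma> a b; \<Gamma> a' b'\<rbrakk> \<Longrightarrow> \<Gamma> (a \<oplus>\<^bsub>A\<^esub> a') (b \<oplus>\<^bsub>B\<^esub> b')"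
    and mult: "\<And>a b a' b'. \<lbrakk>\<Gamma> a b; \<Gamma> a' b'\<rbrakk> \<Longrightarrow> \<Gamma> (a \<otimes>\<^bsub>A\<^esub> a') (b \<otimes>\<^bsub>B\<^esub> b')"
    and scale: "\<And>a b c. \<Gamma> a b \<Longrightarrow> \<Gamma> (c \<odot>\<^bsub>A\<^esub> a) (c \<odot>\<^bsub>B\<^esub> b)"
    and star: "\<And>a b. \<Gamma> a b \<Longrightarrow> \<Gamma> (star A a) (star B b)"
    and le: "\<And>a b. \<Gamma> a b \<Longrightarrow> nrm B b \<le> nrm A a"
    and dense: "carrier A \<subseteq> cstar_algebra.cl A {a. \<exists>b. \<Gamma> a b}"
  shows "\<exists>\<Phi>. cstar_hom A B \<Phi> \<and> (\<forall>a b. \<Gamma> a b \<longrightarrow> \<Phi> a = b)"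
proof -
  interpret A: cstar_algebra A by fact
  interpret B: cstar_algebra B by fact
  define R where "R a l \<longleftrightarrow> (\<exists>s t. (\<forall>n. \<Gamma> (s n) (t n)) \<and> A.tends s a \<and> B.tends t l)" for a l
  have R_I: "R a l" if "\<And>n. \<Gamma> (s n) (t n)" "A.tends s a" "B.tends t l" for a l s t
    unfolding R_def using that by blast
  have R_E: "\<exists>s t. (\<forall>n. \<Gamma> (s n) (t n)) \<and> A.tends s a \<and> B.tends t l" if "R a l" for a l
    using that unfolding R_def .
  have R_car: "a \<in> carrier A" "l \<in> carrier B" if "R a l" for a l
    using R_E[OF that] A.tends_carrier B.tends_carrier by blast+
  have R_of: "R a b" if "\<Gamma> a b" for a b
    unfolding R_def using that car[OF that] A.tends_const B.tends_const
    by (intro exI[of _ "\<lambda>_. a"] exI[of _ "\<lambda>_. b"]) auto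
  have R_add: "R (a \<oplus>\<^bsub>A\<^esub> a') (l \<oplus>\<^bsub>B\<^esub> l')" if r: "R a l" "R a' l'" for a l a' l'
  proof -
    obtain s t s' t' where *: "\<And>n. \<Gamma> (s n) (t n)" "A.tends s a" "B.tends t l"
      "\<And>n. \<Gamma> (s' n) (t' n)" "A.tends s' a'" "B.tends t' l'" using R_E[OF r(1)] R_E[OF r(2)] by blast
    show ?thesis by (rule R_I[OF add[OF *(1) *(4)] A.tends_add[OF *(2,5)] B.tends_add[OF *(3,6)]])
  qed
  have R_mult: "R (a \<otimes>\<^bsub>A\<^esub> a') (l \<otimes>\<^bsub>B\<^esub> l')" if r: "R a l" "R a' l'" for a l a' l'
  proof -
    obtain s t s' t' where *: "\<And>n. \<Gamma> (s n) (t n)" "A.tends s a" "B.tends t l"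
      "\<And>n. \<Gamma> (s' n) (t' n)" "A.tends s' a'" "B.tends t' l'" using R_E[OF r(1)] R_E[OF r(2)] by blast
    show ?thesis by (rule R_I[OF mult[OF *(1) *(4)] A.tends_mult[OF *(2,5)] B.tends_mult[OF *(3,6)]])
  qed
  have R_scale: "R (c \<odot>\<^bsub>A\<^esub> a) (c \<odot>\<^bsub>B\<^esub> l)" if r: "R a l" for a l c
  proof -
    obtain s t where *: "\<And>n. \<Gamma> (s n) (t n)" "A.tends s a" "B.tends t l" using R_E[OF r] by blast
    show ?thesis by (rule R_I[OF scale[OF *(1)] A.tends_scale[OF *(2)] B.tends_scale[OF *(3)]])
  qed
  have R_star: "R (star A a) (star B l)" if r: "R a l" for a l
  proof -
    obtain s t where *: "\<And>n. \<Gamma> (s n) (t n)" "A.tends s a" "B.tends t l" using R_E[OF r] by blast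
    show ?thesis by (rule R_I[OF star[OF *(1)] A.tends_star[OF *(2)] B.tends_star[OF *(3)]])
  qed
  have R_le: "nrm B l \<le> nrm A a" if r: "R a l" for a l
  proof -
    obtain s t where *: "\<And>n. \<Gamma> (s n) (t n)" "A.tends s a" "B.tends t l" using R_E[OF r] by blast
    show ?thesis
      by (rule LIMSEQ_le[OF B.tends_nrm[OF *(3)] A.tends_nrm[OF *(2)]]) (use le *(1) in blast)
  qed
  have R_unique: "l = l'" if r: "R a l" "R a l'" for a l l'
  proof -
    have "R (a \<oplus>\<^bsub>A\<^esub> (- 1) \<odot>\<^bsub>A\<^esub> a) (l \<oplus>\<^bsub>B\<^esub> (- 1) \<odot>\<^bsub>B\<^esub> l')"
      by (intro R_add R_scale r)
    from R_le[OF this] have "nrm B (l \<ominus>\<^bsub>B\<^esub> l') \<le> nrm A (a \<ominus>\<^bsub>A\<^esub> a)"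
      using R_car[OF r(1)] R_car[OF r(2)] by (simp add: A.minus_eq_scale B.minus_eq_scale)
    hence "nrm B (l \<ominus>\<^bsub>B\<^esub> l') \<le> 0" using R_car[OF r(1)] by (simp add: A.diff_self)
    thus ?thesis
      using B.nrm_diff_eq_zero[of l l'] B.nrm_nonneg[of "l \<ominus>\<^bsub>B\<^esub> l'"] R_car[OF r(1)] R_car[OF r(2)]
      by simp
  qed
  have R_total: "\<exists>l. R a l" if a: "a \<in> carrier A" for a
  proof -
    have "{a. \<exists>b. \<Gamma> a b} \<subseteq> carrier A" using car by auto
    from A.cl_iff[OF this] obtain s where s: "\<And>n. \<exists>b. \<Gamma> (s n) b" "A.tends s a"
      using dense a by blast
    then obtain t where t: "\<And>n. \<Gamma> (s n) (t n)" by metis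
    have c: "s n \<in> carrier A" "t n \<in> carrier B" for n using car[OF t[of n]] by auto
    have d: "nrm B (t m \<ominus>\<^bsub>B\<^esub> t n) \<le> nrm A (s m \<ominus>\<^bsub>A\<^esub> s n)" for m n
      using le[OF add[OF t[of m] scale[OF t[of n], of "- 1"]]] c
      by (simp add: A.minus_eq_scale B.minus_eq_scale)
    have "\<exists>N. \<forall>m\<ge>N. \<forall>n\<ge>N. nrm B (t m \<ominus>\<^bsub>B\<^esub> t n) < e" if "e > 0" for e
      using A.tends_Cauchy[OF s(2) that] d by (meson le_less_trans)
    then obtain l where "B.tends t l" using B.complete_seq[of t] c(2) by blast
    thus ?thesis using R_I[of s t] t s(2) by blast
  qed
  define \<Phi> where "\<Phi> a = (THE l. R a l)" for a
  have \<Phi>: "\<Phi> a = l" if "R a l" for a l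
    unfolding \<Phi>_def by (rule the_equality[where P = "R a"]) (use that R_unique in auto)
  have R\<Phi>: "R a (\<Phi> a)" if "a \<in> carrier A" for a
    using R_total[OF that] \<Phi> by blast
  have "star_hom A B \<Phi>"
    unfolding star_hom_def
  proof (intro conjI ballI allI ring_hom_memI)
    fix a b assume a: "a \<in> carrier A"
    note r = R\<Phi>[OF a]
    show "\<Phi> a \<in> carrier B" using R_car r by blast
    show "\<Phi> (c \<odot>\<^bsub>A\<^esub> a) = c \<odot>\<^bsub>B\<^esub> \<Phi> a" for c by (rule \<Phi>[OF R_scale[OF r]])
    show "\<Phi> (star A a) = star B (\<Phi> a)" by (rule \<Phi>[OF R_star[OF r]])
    assume "b \<in> carrier A"
    note r' = R\<Phi>[OF this]
    show "\<Phi> (a \<otimes>\<^bsub>A\<^esub> b) = \<Phi> a \<otimes>\<^bsub>B\<^esub> \<Phi> b" by (rule \<Phi>[OF R_mult[OF r r']])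
    show "\<Phi> (a \<oplus>\<^bsub>A\<^esub> b) = \<Phi> a \<oplus>\<^bsub>B\<^esub> \<Phi> b" by (rule \<Phi>[OF R_add[OF r r']])
  next
    show "\<Phi> \<one>\<^bsub>A\<^esub> = \<one>\<^bsub>B\<^esub>" by (rule \<Phi>[OF R_of[OF one]])
  qed
  hence "cstar_hom A B \<Phi>" by unfold_locales
  thus ?thesis using \<Phi> R_of by blast
qed

lemma (in cstar_hom) isometric_if_dense:
  assumes D: "carrier A \<subseteq> A.cl D" "\<And>a. a \<in> D \<Longrightarrow> a \<in> carrier A \<and> nrm A a \<le> nrm B (h a)"
    and a: "a \<in> carrier A"
  shows "nrm B (h a) = nrm A a"
proof (rule antisym[OF contractive[OF a]])
  have "D \<subseteq> carrier A" using D(2) by auto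
  from A.cl_iff[OF this] obtain s where s: "\<And>n. s n \<in> D" "A.tends s a"
    using D(1) a by blast
  show "nrm A a \<le> nrm B (h a)"
    by (rule LIMSEQ_le[OF A.tends_nrm[OF s(2)] B.tends_nrm[OF tends[OF s(2)]]])
      (use s D(2) in blast)
qed

subsection \<open>Integer powers of a unitary\<close>

context cstar_algebra
begin

definition upow :: "'a \<Rightarrow> int \<Rightarrow> 'a" where
  "upow w k = w [^]\<^bsub>units_of A\<^esub> k"

context
  fixes w assumes w: "unitary_in A w"
begin

interpretation U: group "units_of A" by (rule units_group)

lemma unitary_Units: "w \<in> Units A" "inv w = star A w" "w \<in> carrier (units_of A)"
proof -
  note u = unitaryD[OF w]
  show "w \<in> Units A" using u by (auto simp: Units_def)
  thus "w \<in> carrier (units_of A)" by (simp add: units_of_carrier)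
  show "inv w = star A w" by (rule inv_unique'[symmetric]) (use u in auto)
qed

lemma upow_closed [simp, intro]: "upow w k \<in> carrier A"
  using U.int_pow_closed[OF unitary_Units(3), of k] Units_closed
  by (simp add: upow_def units_of_carrier)

lemma upow_add: "upow w (j + k) = upow w j \<otimes> upow w k"
  using U.int_pow_mult[OF unitary_Units(3), of j k] by (simp add: upow_def units_of_mult)

lemma upow_0 [simp]: "upow w 0 = \<one>"
  by (simp add: upow_def units_of_one)

lemma upow_1 [simp]: "upow w 1 = w"
  using U.int_pow_1[OF unitary_Units(3)] by (simp add: upow_def)

lemma upow_minus_1 [simp]: "upow w (- 1) = star A w"
  using U.int_pow_neg[OF unitary_Units(3), of 1] U.int_pow_1[OF unitary_Units(3)]
    units_of_inv[OF unitary_Units(1)] unitary_Units(2) by (simp add: upow_def)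

lemma star_upow: "star A (upow w k) = upow w (- k)"
proof (induction k rule: int_induct[where k = 0])
  case (step1 i)
  have e: "- (i + 1) = - 1 + - i" by simp
  show ?case
    unfolding e unfolding upow_add upow_minus_1 upow_1 using step1 unitaryD[OF w] by simp
next
  case (step2 i)
  have "upow w (1 + - i) = w \<otimes> upow w (- i)" by (simp only: upow_add upow_1)
  moreover have "upow w (i - 1) = upow w i \<otimes> star A w"
    using upow_add[of i "- 1"] by simp
  ultimately show ?case using step2 unitaryD[OF w] by simp
qed simp

lemma nrm_upow_le: "nrm A (upow w k) \<le> 1"
  using upow_add[of "- k" k] by (intro nrm_isometry_le) (auto simp: star_upow)

lemma nrm_upow: "\<one> \<noteq> \<zero> \<Longrightarrow> nrm A (upow w k) = 1"
proof -
  assume ne: "\<one> \<noteq> \<zero>"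
  have "(nrm A (upow w k))\<^sup>2 = 1"
    using cstar_identity[of "upow w k"] upow_add[of "- k" k] nrm_one[OF ne] by (simp add: star_upow)
  thus ?thesis using nrm_nonneg[OF upow_closed] by (simp add: power2_eq_1_iff) (smt (verit))
qed

lemma upow_commute:
  assumes a: "a \<in> carrier A" "w \<otimes> a = \<nu> \<odot> (a \<otimes> w)" and \<nu>: "\<nu> \<noteq> 0"
  shows "upow w k \<otimes> a = (\<nu> powi k) \<odot> (a \<otimes> upow w k)"
proof -
  note u = unitaryD[OF w]
  have "a \<otimes> star A w = star A w \<otimes> (w \<otimes> a) \<otimes> star A w"
    using u a(1) by (simp flip: m_assoc)
  also have "\<dots> = \<nu> \<odot> (star A w \<otimes> a)"
    unfolding a(2) using u a(1) by (simp add: m_assoc)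
  finally have inv: "star A w \<otimes> a = inverse \<nu> \<odot> (a \<otimes> star A w)" using \<nu> u a(1) by simp
  show ?thesis
  proof (induction k rule: int_induct[where k = 0])
    case base
    show ?case using a by simp
  next
    case (step1 i)
    have "upow w (i + 1) \<otimes> a = upow w i \<otimes> (w \<otimes> a)"
      using a u by (simp add: upow_add m_assoc)
    also have "\<dots> = \<nu> \<odot> ((upow w i \<otimes> a) \<otimes> w)"
      unfolding a(2) using a(1) u by (simp add: m_assoc)
    also have "\<dots> = (\<nu> powi (i + 1)) \<odot> (a \<otimes> upow w (i + 1))"
      unfolding step1 using a(1) u \<nu> by (simp add: upow_add m_assoc power_int_add mult.commute)
    finally show ?case .
  next
    case (step2 i)
    have e: "upow w (i - 1) = upow w i \<otimes> star A w" using upow_add[of i "- 1"] by simp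
    have "upow w (i - 1) \<otimes> a = upow w i \<otimes> (star A w \<otimes> a)"
      unfolding e using a u by (simp add: m_assoc)
    also have "\<dots> = inverse \<nu> \<odot> ((upow w i \<otimes> a) \<otimes> star A w)"
      unfolding inv using a(1) u by (simp add: m_assoc)
    also have "\<dots> = (\<nu> powi (i - 1)) \<odot> (a \<otimes> upow w (i - 1))"
      unfolding step2 e using a(1) u \<nu>
      by (simp add: m_assoc power_int_diff field_simps)
    finally show ?case .
  qed
qed

end

end

lemma (in cstar_hom) unitary: "unitary_in A w \<Longrightarrow> unitary_in B (h w)"
  by (auto simp: unitary_in_def simp flip: star mult)

lemma (in cstar_hom) upow:
  assumes w: "unitary_in A w" shows "h (A.upow w k) = B.upow (h w) k"
proof (induction k rule: int_induct[where k = 0])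
  case base
  show ?case using w unitary[OF w] by simp
next
  case (step1 i)
  thus ?case using w unitary[OF w] A.unitaryD[OF w] by (simp add: A.upow_add B.upow_add)
next
  case (step2 i)
  thus ?case
    using w unitary[OF w] A.unitaryD[OF w] A.upow_add[OF w, of i "- 1"] B.upow_add[OF unitary[OF w], of i "- 1"]
    by simp
qed

subsection \<open>Laurent polynomials in two unitaries\<close>

context graded_pair
begin

definition \<Gamma> :: "'a \<Rightarrow> 'b \<Rightarrow> bool" where
  "\<Gamma> a b \<longleftrightarrow> (\<exists>N. G N a b)"

lemma \<Gamma>_homog: "S k a b \<Longrightarrow> \<Gamma> a b"
  unfolding \<Gamma>_def using homog[of k "nat \<bar>k\<bar>"] by auto

lemma \<Gamma>_carrier: "\<Gamma> a b \<Longrightarrow> a \<in> carrier A1 \<and> b \<in> carrier A2"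
  and \<Gamma>_scale: "\<Gamma> a b \<Longrightarrow> \<Gamma> (c \<odot>\<^bsub>A1\<^esub> a) (c \<odot>\<^bsub>A2\<^esub> b)"
  and \<Gamma>_star: "\<Gamma> a b \<Longrightarrow> \<Gamma> (star A1 a) (star A2 b)"
  and \<Gamma>_mult: "\<lbrakk>\<Gamma> a b; \<Gamma> a' b'\<rbrakk> \<Longrightarrow> \<Gamma> (a \<otimes>\<^bsub>A1\<^esub> a') (b \<otimes>\<^bsub>A2\<^esub> b')"
  and \<Gamma>_le: "\<Gamma> a b \<Longrightarrow> nrm A2 b \<le> nrm A1 a"
  unfolding \<Gamma>_def by (use G_carrier in blast, use G_scale in blast, use G_star in blast,
    use G_mult in blast, use G_le in blast)

lemma \<Gamma>_add: "\<lbrakk>\<Gamma> a b; \<Gamma> a' b'\<rbrakk> \<Longrightarrow> \<Gamma> (a \<oplus>\<^bsub>A1\<^esub> a') (b \<oplus>\<^bsub>A2\<^esub> b')"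
  unfolding \<Gamma>_def by (meson G_mono max.cobounded1 max.cobounded2 sum)

lemma \<Gamma>_subalgebras:
  assumes one: "S 0 \<one>\<^bsub>A1\<^esub> \<one>\<^bsub>A2\<^esub>"
  shows "cstar_subalgebra (A1.cl {a. \<exists>b. \<Gamma> a b}) A1" "cstar_subalgebra (A2.cl {b. \<exists>a. \<Gamma> a b}) A2"
  by (rule A1.cl_subalgebra A2.cl_subalgebra;
      use \<Gamma>_homog[OF one] in \<open>blast intro: \<Gamma>_add \<Gamma>_mult \<Gamma>_scale \<Gamma>_star dest: \<Gamma>_carrier\<close>)+

lemma \<Gamma>_in_cl:
  assumes "\<Gamma> a b" shows "a \<in> A1.cl {a. \<exists>b. \<Gamma> a b}" "b \<in> A2.cl {b. \<exists>a. \<Gamma> a b}"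
  using \<Gamma>_carrier[OF assms] assms
  by (auto intro!: A1.cl_I[where s = "\<lambda>_. a"] A2.cl_I[where s = "\<lambda>_. b"] A1.tends_const A2.tends_const
      dest: \<Gamma>_carrier)

end

locale laurent_pair = A1: rotation_action A1 \<alpha> \<mu> + A2: cstar_algebra A2
  for A1 :: "'a cstar" and A2 :: "'b cstar" and \<alpha> \<mu> +
  fixes w1 w2
  assumes w1: "unitary_in A1 w1" and w2: "unitary_in A2 w2"
    and act: "\<alpha> (A1.upow w1 k) = (\<mu> powi k) \<odot>\<^bsub>A1\<^esub> A1.upow w1 k"
    and nonzero: "\<one>\<^bsub>A1\<^esub> \<noteq> \<zero>\<^bsub>A1\<^esub>"
begin

definition mono :: "int \<Rightarrow> 'a \<Rightarrow> 'b \<Rightarrow> bool" where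
  "mono k a b \<longleftrightarrow> (\<exists>c. a = c \<odot>\<^bsub>A1\<^esub> A1.upow w1 k \<and> b = c \<odot>\<^bsub>A2\<^esub> A2.upow w2 k)"

sublocale graded_pair A1 A2 \<alpha> \<mu> mono
proof
  note [simp] = A1.upow_closed[OF w1] A2.upow_closed[OF w2]
  fix k l a b a' b' c
  show "mono k \<zero>\<^bsub>A1\<^esub> \<zero>\<^bsub>A2\<^esub>"
    unfolding mono_def by (rule exI[of _ 0]) simp
  assume "mono k a b"
  then obtain d where d: "a = d \<odot>\<^bsub>A1\<^esub> A1.upow w1 k" "b = d \<odot>\<^bsub>A2\<^esub> A2.upow w2 k"
    by (auto simp: mono_def)
  show "a \<in> carrier A1 \<and> b \<in> carrier A2" using d by simp
  show "mono k (c \<odot>\<^bsub>A1\<^esub> a) (c \<odot>\<^bsub>A2\<^esub> b)"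
    unfolding mono_def d by (rule exI[of _ "c * d"]) simp
  show "mono (- k) (star A1 a) (star A2 b)"
    unfolding mono_def d by (rule exI[of _ "cnj d"]) (simp add: A1.star_upow[OF w1] A2.star_upow[OF w2])
  show "nrm A2 b \<le> nrm A1 a"
    using A1.nrm_upow[OF w1 nonzero] A2.nrm_upow_le[OF w2] by (simp add: d mult_left_le)
  show "\<alpha> a = (\<mu> powi k) \<odot>\<^bsub>A1\<^esub> a"
    by (simp add: d A1.act_scale act mult.commute)
  { assume "mono k a' b'"
    then obtain d' where d': "a' = d' \<odot>\<^bsub>A1\<^esub> A1.upow w1 k" "b' = d' \<odot>\<^bsub>A2\<^esub> A2.upow w2 k"
      by (auto simp: mono_def)
    show "mono k (a \<oplus>\<^bsub>A1\<^esub> a') (b \<oplus>\<^bsub>A2\<^esub> b')"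
      unfolding mono_def d d' by (rule exI[of _ "d + d'"]) (simp add: A1.scale_add_left A2.scale_add_left) }
  { assume "mono l a' b'"
    then obtain d' where d': "a' = d' \<odot>\<^bsub>A1\<^esub> A1.upow w1 l" "b' = d' \<odot>\<^bsub>A2\<^esub> A2.upow w2 l"
      by (auto simp: mono_def)
    show "mono (k + l) (a \<otimes>\<^bsub>A1\<^esub> a') (b \<otimes>\<^bsub>A2\<^esub> b')"
      unfolding mono_def d d'
      by (rule exI[of _ "d * d'"]) (simp add: A1.upow_add[OF w1] A2.upow_add[OF w2] mult.commute) }
qed

lemma mono_one: "mono 0 \<one>\<^bsub>A1\<^esub> \<one>\<^bsub>A2\<^esub>"
  unfolding mono_def by (rule exI[of _ 1]) (simp add: w1 w2)

lemma \<Gamma>_generators: "\<Gamma> w1 w2"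
  by (rule \<Gamma>_homog[of 1])
    (auto simp: mono_def w1 w2 A1.unitaryD[OF w1] A2.unitaryD[OF w2] intro!: exI[of _ 1])

lemma hom_exists:
  assumes gen: "carrier (cstar_generated A1 {w1}) = carrier A1"
  shows "\<exists>\<Phi>. cstar_hom A1 A2 \<Phi> \<and> \<Phi> w1 = w2"
proof -
  have "\<exists>\<Phi>. cstar_hom A1 A2 \<Phi> \<and> (\<forall>a b. \<Gamma> a b \<longrightarrow> \<Phi> a = b)"
  proof (rule star_hom_extension[OF A1.cstar_algebra_axioms A2.cstar_algebra_axioms])
    show "carrier A1 \<subseteq> A1.cl {a. \<exists>b. \<Gamma> a b}"
      using A1.generated_least[OF \<Gamma>_subalgebras(1)[OF mono_one], of "{w1}"]
        \<Gamma>_in_cl(1)[OF \<Gamma>_generators] gen by simp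
  qed (use \<Gamma>_homog[OF mono_one] in \<open>auto intro: \<Gamma>_add \<Gamma>_mult \<Gamma>_scale \<Gamma>_star \<Gamma>_le dest: \<Gamma>_carrier\<close>)
  thus ?thesis using \<Gamma>_generators by blast
qed

lemma hom_isometric:
  assumes gen: "carrier (cstar_generated A2 {w2}) = carrier A2"
    and \<Phi>: "cstar_hom A2 A1 \<Phi>" "\<Phi> w2 = w1" and b: "b \<in> carrier A2"
  shows "nrm A1 (\<Phi> b) = nrm A2 b"
proof -
  interpret \<Phi>: cstar_hom A2 A1 \<Phi> by fact
  have eq: "a = \<Phi> b" if "G N a b" for N a b
    using that
  proof (induction rule: G.induct)
    case (homog k N a b)
    thus ?case using \<Phi>.upow[OF w2] \<Phi>(2) A2.upow_closed[OF w2] by (auto simp: mono_def)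
  next
    case (sum N a b a' b')
    thus ?case using G_carrier by simp
  qed
  have "carrier A2 \<subseteq> A2.cl {b. \<exists>a. \<Gamma> a b}"
    using A2.generated_least[OF \<Gamma>_subalgebras(2)[OF mono_one], of "{w2}"]
      \<Gamma>_in_cl(2)[OF \<Gamma>_generators] gen by simp
  moreover have "c \<in> carrier A2 \<and> nrm A2 c \<le> nrm A1 (\<Phi> c)" if c: "c \<in> {b. \<exists>a. \<Gamma> a b}" for c
  proof -
    obtain a where a: "\<Gamma> a c" using c by blast
    hence "a = \<Phi> c" using eq unfolding \<Gamma>_def by blast
    thus ?thesis using \<Gamma>_carrier[OF a] \<Gamma>_le[OF a] by simp
  qed
  ultimately show ?thesis using b by (rule \<Phi>.isometric_if_dense)
qed

end

subsection \<open>The circle\<close>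

abbreviation "circle \<equiv> sphere (0::complex) 1"
abbreviation "circle_algebra \<equiv> cont_algebra circle"

definition rot :: "complex \<Rightarrow> (complex \<Rightarrow> complex) \<Rightarrow> complex \<Rightarrow> complex" where
  "rot \<nu> f = (\<lambda>z\<in>circle. f (\<nu> * z))"

interpretation CT: cstar_algebra circle_algebra
  by (rule cstar_algebra_cont_algebra) simp

lemma rot_closed:
  assumes "cmod \<nu> = 1" "f \<in> carrier circle_algebra" shows "rot \<nu> f \<in> carrier circle_algebra"
proof -
  have "continuous_on circle (f \<circ> (\<lambda>z. \<nu> * z))"
    by (rule continuous_on_compose[OF _ continuous_on_subset[of circle]])
      (use assms in \<open>auto intro!: continuous_intros simp: norm_mult\<close>)
  thus ?thesis by (simp add: rot_def o_def del: restrict_apply)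
qed

lemma circle_mult_cnj: "cmod z = 1 \<Longrightarrow> z * cnj z = 1"
  by (simp flip: complex_norm_square)

lemma circle_id: "unitary_in circle_algebra (\<lambda>z\<in>circle. z)"
  unfolding unitary_in_def
proof (intro conjI)
  show "(\<lambda>z\<in>circle. z) \<in> carrier circle_algebra" by (simp del: restrict_apply)
  show "star circle_algebra (\<lambda>z\<in>circle. z) \<otimes>\<^bsub>circle_algebra\<^esub> (\<lambda>z\<in>circle. z) = \<one>\<^bsub>circle_algebra\<^esub>"
    "(\<lambda>z\<in>circle. z) \<otimes>\<^bsub>circle_algebra\<^esub> star circle_algebra (\<lambda>z\<in>circle. z) = \<one>\<^bsub>circle_algebra\<^esub>"
    using circle_mult_cnj by (auto simp: restrict_def fun_eq_iff mult.commute)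
qed

lemma circle_nonzero: "\<one>\<^bsub>circle_algebra\<^esub> \<noteq> \<zero>\<^bsub>circle_algebra\<^esub>"
proof
  assume "\<one>\<^bsub>circle_algebra\<^esub> = \<zero>\<^bsub>circle_algebra\<^esub>"
  hence "(\<lambda>z\<in>circle. 1) (1::complex) = ((\<lambda>z\<in>circle. 0) 1 :: complex)" by simp
  thus False by simp
qed

lemma circle_upow: "CT.upow (\<lambda>z\<in>circle. z) k = (\<lambda>z\<in>circle. z powi k)"
proof (induction k rule: int_induct[where k = 0])
  case base
  show ?case unfolding CT.upow_0[OF circle_id] by (auto simp: restrict_def fun_eq_iff)
next
  case (step1 i)
  have "z powi i * z = z powi (i + 1)" if "cmod z = 1" for z
    using that by (subst power_int_add) auto
  thus ?case
    unfolding CT.upow_add[OF circle_id] CT.upow_1[OF circle_id] step1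
    by (auto simp: restrict_def fun_eq_iff)
next
  case (step2 i)
  have "z powi i * cnj z = z powi (i - 1)" if "cmod z = 1" for z
  proof -
    have "z \<noteq> 0" using that by auto
    moreover from this have "cnj z = inverse z"
      using circle_mult_cnj[OF that] by (simp add: field_simps)
    ultimately show ?thesis by (simp add: power_int_diff field_simps)
  qed
  moreover have "CT.upow (\<lambda>z\<in>circle. z) (i - 1)
      = (\<lambda>z\<in>circle. z powi i) \<otimes>\<^bsub>circle_algebra\<^esub> star circle_algebra (\<lambda>z\<in>circle. z)"
    using CT.upow_add[OF circle_id, of i "-1"] CT.upow_minus_1[OF circle_id] step2 by simp
  ultimately show ?case by (auto simp: restrict_def fun_eq_iff)
qed

lemma circle_homs_eq:
  assumes "cstar_hom circle_algebra A \<Phi>" "cstar_hom circle_algebra A \<Psi>"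
    and "\<Phi> (\<lambda>z\<in>circle. z) = \<Psi> (\<lambda>z\<in>circle. z)" "f \<in> carrier circle_algebra"
  shows "\<Phi> f = \<Psi> f"
proof (rule star_homs_eq_on_generated[OF assms(1,2)])
  show "{\<lambda>z\<in>circle. z} \<subseteq> carrier circle_algebra" using CT.unitaryD[OF circle_id] by blast
  show "f \<in> carrier (cstar_generated circle_algebra {\<lambda>z\<in>circle. z})"
    using assms(4) cont_algebra_generated[of circle] by simp
qed (use assms(3) in auto)

lemma rotation_action_circle:
  assumes \<mu>: "aperiodic \<mu>" shows "rotation_action circle_algebra (rot \<mu>) \<mu>"
proof
  have n: "cmod \<mu> = 1" using \<mu> by (simp add: aperiodic_def)
  fix f g c assume f: "f \<in> carrier circle_algebra"
  show "rot \<mu> f \<in> carrier circle_algebra" by (rule rot_closed[OF n f])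
  show "rot \<mu> (c \<odot>\<^bsub>circle_algebra\<^esub> f) = c \<odot>\<^bsub>circle_algebra\<^esub> rot \<mu> f"
    using n by (simp add: rot_def norm_mult cong: restrict_cong)
  have "cmod (f (\<mu> * z)) \<le> supnorm circle f" if "cmod z = 1" for z
    using supnorm_ge[of circle f "\<mu> * z"] f that n by (simp add: norm_mult)
  thus "nrm circle_algebra (rot \<mu> f) \<le> nrm circle_algebra f"
    using f by (auto simp: rot_def intro!: supnorm_le supnorm_nonneg)
  assume "g \<in> carrier circle_algebra"
  show "rot \<mu> (f \<oplus>\<^bsub>circle_algebra\<^esub> g) = rot \<mu> f \<oplus>\<^bsub>circle_algebra\<^esub> rot \<mu> g"
    using n by (simp add: rot_def norm_mult cong: restrict_cong)
qed (rule \<mu>)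

theorem circle_calculus_exists:
  assumes "aperiodic \<mu>" "cstar_algebra A" "unitary_in A w"
  shows "\<exists>\<Phi>. cstar_hom circle_algebra A \<Phi> \<and> \<Phi> (\<lambda>z\<in>circle. z) = w"
proof -
  interpret A: cstar_algebra A by fact
  interpret C: rotation_action circle_algebra "rot \<mu>" \<mu> by (rule rotation_action_circle) fact
  interpret laurent_pair circle_algebra A "rot \<mu>" \<mu> "\<lambda>z\<in>circle. z" w
  proof
    show "rot \<mu> (CT.upow (\<lambda>z\<in>circle. z) k)
        = (\<mu> powi k) \<odot>\<^bsub>circle_algebra\<^esub> CT.upow (\<lambda>z\<in>circle. z) k" for k
      using C.\<mu>_props by (simp add: circle_upow rot_def norm_mult power_int_mult_distrib cong: restrict_cong)
  qed (use assms circle_id circle_nonzero in auto)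
  show ?thesis by (rule hom_exists) (rule cont_algebra_generated, simp)
qed

theorem circle_calculus_isometric:
  assumes "aperiodic \<mu>" "cstar_algebra A" "unitary_in A u" "unitary_in A w"
    and comm: "w \<otimes>\<^bsub>A\<^esub> u = \<mu> \<odot>\<^bsub>A\<^esub> (u \<otimes>\<^bsub>A\<^esub> w)"
    and "\<one>\<^bsub>A\<^esub> \<noteq> \<zero>\<^bsub>A\<^esub>"
    and "cstar_hom circle_algebra A \<Phi>" "\<Phi> (\<lambda>z\<in>circle. z) = w" "f \<in> carrier circle_algebra"
  shows "nrm A (\<Phi> f) = supnorm circle f"
proof -
  interpret A: cstar_algebra A by fact
  note u = A.unitaryD[OF assms(3)]
  let ?u = "star A u"
  let ?\<alpha> = "\<lambda>a. ?u \<otimes>\<^bsub>A\<^esub> a \<otimes>\<^bsub>A\<^esub> star A ?u"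
  have n: "\<mu> \<noteq> 0" using assms(1) by (auto simp: aperiodic_def)
  have "unitary_in A ?u" using u by (simp add: unitary_in_def)
  then interpret C: rotation_action A ?\<alpha> \<mu>
    by (rule A.rotation_action_conjugation) fact
  interpret laurent_pair A circle_algebra ?\<alpha> \<mu> w "\<lambda>z\<in>circle. z"
  proof
    show "?\<alpha> (A.upow w k) = (\<mu> powi k) \<odot>\<^bsub>A\<^esub> A.upow w k" for k
    proof -
      have "?\<alpha> (A.upow w k) = ?u \<otimes>\<^bsub>A\<^esub> (A.upow w k \<otimes>\<^bsub>A\<^esub> u)"
        using u A.upow_closed[OF assms(4), of k] by (simp add: A.m_assoc)
      also have "\<dots> = (\<mu> powi k) \<odot>\<^bsub>A\<^esub> A.upow w k"
        unfolding A.upow_commute[OF assms(4) u(1) comm n]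
        using u A.upow_closed[OF assms(4), of k] by (simp flip: A.m_assoc)
      finally show ?thesis .
    qed
  qed (use assms circle_id circle_nonzero in auto)
  have "nrm A (\<Phi> f) = nrm circle_algebra f"
    by (rule hom_isometric[OF _ assms(7-9)]) (rule cont_algebra_generated, simp)
  thus ?thesis by simp
qed

lemma rot_hom:
  assumes \<nu>: "cmod \<nu> = 1" shows "cstar_hom circle_algebra circle_algebra (rot \<nu>)"
proof
  show "star_hom circle_algebra circle_algebra (rot \<nu>)"
    unfolding star_hom_def
  proof (intro conjI ballI allI ring_hom_memI)
    fix f assume "f \<in> carrier circle_algebra"
    thus "rot \<nu> f \<in> carrier circle_algebra" by (rule rot_closed[OF \<nu>])
  qed (use \<nu> in \<open>auto simp: rot_def norm_mult restrict_def fun_eq_iff\<close>)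
qed

lemma rot_rot:
  "\<lbrakk>cmod \<nu> = 1; \<nu> * \<nu>' = 1; f \<in> carrier circle_algebra\<rbrakk> \<Longrightarrow> rot \<nu> (rot \<nu>' f) = f"
proof -
  assume h: "cmod \<nu> = 1" "\<nu> * \<nu>' = 1" "f \<in> carrier circle_algebra"
  have "\<nu>' * \<nu> = 1" using h(2) by (simp add: mult.commute)
  hence e: "f (\<nu>' * (\<nu> * z)) = f z" for z by (simp flip: mult.assoc)
  show ?thesis using h e by (auto simp: rot_def norm_mult restrict_def fun_eq_iff extensional_def)
qed

locale circle_calculus = cstar_hom circle_algebra A \<Phi> for A :: "'a cstar" (structure) and \<Phi> +
  assumes iso: "f \<in> carrier circle_algebra \<Longrightarrow> nrm A (\<Phi> f) = supnorm circle f"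
begin

abbreviation "w \<equiv> \<Phi> (\<lambda>z\<in>circle. z)"

lemma unitary_w: "unitary_in A w"
  by (rule unitary[OF circle_id])

lemma circle_id_closed: "(\<lambda>z\<in>circle. z) \<in> carrier circle_algebra"
  using A.unitaryD[OF circle_id] by blast

lemma cfc_w:
  assumes "continuous_on circle f" shows "cfc A w f = \<Phi> (restrict f circle)"
proof (rule cfc_eq[OF cstar_hom_axioms])
  show "spectrum_in A w = circle"
    using spectrum_isometric[OF cstar_hom_axioms _ _ iso circle_id_closed] by auto
qed (use assms in auto)

lemma cfc_scaled_w:
  assumes \<nu>: "cmod \<nu> = 1" and f: "continuous_on circle f"
  shows "cfc A (\<nu> \<odot> w) f = \<Phi> (rot \<nu> (restrict f circle))"
proof -
  interpret r: cstar_hom circle_algebra circle_algebra "rot \<nu>" by (rule rot_hom[OF \<nu>])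
  note hom' = cstar_hom_compose[OF r.cstar_hom_axioms cstar_hom_axioms]
  interpret r': cstar_hom circle_algebra circle_algebra "rot (cnj \<nu>)"
    by (rule rot_hom) (use \<nu> in simp)
  have iso': "nrm A ((\<Phi> \<circ> rot \<nu>) g) = supnorm circle g" if g: "g \<in> carrier circle_algebra" for g
  proof -
    have "nrm circle_algebra g = nrm circle_algebra (rot (cnj \<nu>) (rot \<nu> g))"
      using rot_rot[of "cnj \<nu>" \<nu> g] \<nu> g circle_mult_cnj[OF \<nu>] by (simp add: mult.commute)
    also have "\<dots> \<le> nrm circle_algebra (rot \<nu> g)" by (rule r'.contractive[OF r.closed[OF g]])
    finally show ?thesis
      using r.contractive[OF g] iso[OF r.closed[OF g]] by (simp del: cont_algebra_simps(1-7))
  qed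
  have id: "(\<Phi> \<circ> rot \<nu>) (\<lambda>z\<in>circle. z) = \<nu> \<odot> w"
  proof -
    have "rot \<nu> (\<lambda>z\<in>circle. z) = \<nu> \<odot>\<^bsub>circle_algebra\<^esub> (\<lambda>z\<in>circle. z)"
      using \<nu> by (auto simp: rot_def norm_mult restrict_def fun_eq_iff)
    thus ?thesis using circle_id_closed by (simp del: cont_algebra_simps)
  qed
  have "spectrum_in A (\<nu> \<odot> w) = circle"
    using spectrum_isometric[OF hom' _ _ iso' circle_id_closed] id by auto
  from cfc_eq[OF hom' _ this id f] show ?thesis by (simp only: o_apply compact_sphere)
qed

lemma cstar_sqrt_\<Phi>:
  assumes \<gamma>: "continuous_on circle \<gamma>"
  shows "cstar_sqrt A (\<Phi> (\<lambda>z\<in>circle. complex_of_real (\<gamma> z)))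
    = \<Phi> (\<lambda>z\<in>circle. complex_of_real (sqrt (\<gamma> z)))"
proof -
  let ?g = "\<lambda>z\<in>circle. complex_of_real (\<gamma> z)"
  define K where "K = ?g ` circle"
  have cg: "continuous_on circle ?g"
    using \<gamma> by (simp del: restrict_apply)
  have gc: "?g \<in> carrier circle_algebra" using cg by simp
  have K: "compact K" unfolding K_def by (rule compact_continuous_image[OF cg]) simp
  have spec: "spectrum_in A (\<Phi> ?g) = K"
    unfolding K_def by (rule spectrum_isometric[OF cstar_hom_axioms _ _ iso gc]) auto
  have gK: "complex_of_real (\<gamma> z) \<in> K" if "cmod z = 1" for z
    unfolding K_def by (rule image_eqI[of _ _ z]) (use that in auto)
  define P where "P h = (\<lambda>z\<in>circle. h (complex_of_real (\<gamma> z)))" for h :: "complex \<Rightarrow> complex"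
  have Pc: "P h \<in> carrier circle_algebra" if "h \<in> carrier (cont_algebra K)" for h
  proof -
    have "continuous_on circle (h \<circ> (\<lambda>z. complex_of_real (\<gamma> z)))"
      by (rule continuous_on_compose[OF _ continuous_on_subset[of K]])
        (use that \<gamma> gK in \<open>auto intro!: continuous_intros\<close>)
    thus ?thesis by (simp add: P_def o_def del: restrict_apply)
  qed
  interpret CK: cstar_algebra "cont_algebra K" by (rule cstar_algebra_cont_algebra[OF K])
  have P_hom: "star_hom (cont_algebra K) circle_algebra P"
    unfolding star_hom_def
  proof (intro conjI ballI allI ring_hom_memI)
    fix h assume "h \<in> carrier (cont_algebra K)"
    thus "P h \<in> carrier circle_algebra" by (rule Pc)
  qed (use gK in \<open>auto simp: P_def restrict_def fun_eq_iff\<close>)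
  interpret P: cstar_hom "cont_algebra K" circle_algebra P by unfold_locales (rule P_hom)
  note cstar_hom_compose[OF P.cstar_hom_axioms cstar_hom_axioms]
  moreover have "(\<Phi> \<circ> P) (\<lambda>z\<in>K. z) = \<Phi> ?g"
  proof -
    have "P (\<lambda>z\<in>K. z) = ?g" using gK by (auto simp: P_def restrict_def fun_eq_iff)
    thus ?thesis by simp
  qed
  moreover have "continuous_on K (\<lambda>z. complex_of_real (sqrt (Re z)))"
    by (intro continuous_intros)
  ultimately have "cfc A (\<Phi> ?g) (\<lambda>z. complex_of_real (sqrt (Re z)))
      = (\<Phi> \<circ> P) (\<lambda>z\<in>K. complex_of_real (sqrt (Re z)))"
    using cfc_eq[OF _ K spec] by blast
  moreover have "P (\<lambda>z\<in>K. complex_of_real (sqrt (Re z))) = (\<lambda>z\<in>circle. complex_of_real (sqrt (\<gamma> z)))"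
    using gK by (auto simp: P_def restrict_def fun_eq_iff)
  ultimately show ?thesis by (simp add: cstar_sqrt_def)
qed

lemma intertwine:
  assumes y: "y \<in> carrier A" and \<nu>: "cmod \<nu> = 1" and yw: "y \<otimes> w = \<nu> \<odot> (w \<otimes> y)"
    and f: "f \<in> carrier circle_algebra"
  shows "y \<otimes> \<Phi> f = \<Phi> (rot \<nu> f) \<otimes> y"
proof -
  note [simp del] = cont_algebra_simps
  interpret r: cstar_hom circle_algebra circle_algebra "rot \<nu>" by (rule rot_hom[OF \<nu>])
  define Q where "Q f \<longleftrightarrow> y \<otimes> \<Phi> f = \<Phi> (rot \<nu> f) \<otimes> y" for f
  let ?P = "{f \<in> carrier circle_algebra. Q f \<and> Q (star circle_algebra f)}"
  have Q_add: "Q (f \<oplus>\<^bsub>circle_algebra\<^esub> g)"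
    if "f \<in> carrier circle_algebra" "g \<in> carrier circle_algebra" "Q f" "Q g" for f g
    using that y by (simp add: Q_def B.l_distr B.r_distr)
  have Q_mult: "Q (f \<otimes>\<^bsub>circle_algebra\<^esub> g)"
    if "f \<in> carrier circle_algebra" "g \<in> carrier circle_algebra" "Q f" "Q g" for f g
  proof -
    have "y \<otimes> (\<Phi> f \<otimes> \<Phi> g) = (y \<otimes> \<Phi> f) \<otimes> \<Phi> g"
      using that y by (simp add: B.m_assoc)
    also have "\<dots> = \<Phi> (rot \<nu> f) \<otimes> (y \<otimes> \<Phi> g)"
      using that y by (simp add: Q_def B.m_assoc)
    also have "\<dots> = \<Phi> (rot \<nu> f) \<otimes> \<Phi> (rot \<nu> g) \<otimes> y"
      using that y by (simp add: Q_def B.m_assoc)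
    finally show ?thesis using that by (simp add: Q_def)
  qed
  have Q_scale: "Q (c \<odot>\<^bsub>circle_algebra\<^esub> f)" if "f \<in> carrier circle_algebra" "Q f" for f c
    using that y by (simp add: Q_def)
  have Q_lim: "Q l" if s: "\<And>n. Q (s n)" "A.tends s l" for s l
  proof -
    have "B.tends (\<lambda>n. y \<otimes> \<Phi> (s n)) (y \<otimes> \<Phi> l)"
      by (intro B.tends_mult B.tends_const y tends s)
    moreover have "B.tends (\<lambda>n. \<Phi> (rot \<nu> (s n)) \<otimes> y) (\<Phi> (rot \<nu> l) \<otimes> y)"
      by (intro B.tends_mult B.tends_const y tends r.tends s)
    ultimately show ?thesis using s(1) B.tends_unique by (simp add: Q_def)
  qed
  have id: "(\<lambda>z\<in>circle. z) \<in> ?P"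
  proof -
    note id = circle_id_closed
    note u = B.unitaryD[OF unitary_w]
    have ri: "rot \<nu> (\<lambda>z\<in>circle. z) = \<nu> \<odot>\<^bsub>circle_algebra\<^esub> (\<lambda>z\<in>circle. z)"
      using \<nu> by (auto simp: rot_def norm_mult restrict_def fun_eq_iff cont_algebra_simps)
    have q1: "Q (\<lambda>z\<in>circle. z)"
      using id yw y by (simp add: Q_def ri)

    have "star A w \<otimes> y = star A w \<otimes> (y \<otimes> w) \<otimes> star A w"
      using u y by (simp add: B.m_assoc)
    also have "\<dots> = \<nu> \<odot> (y \<otimes> star A w)"
      unfolding yw using u y by (simp flip: B.m_assoc)
    finally have "y \<otimes> star A w = cnj \<nu> \<odot> (star A w \<otimes> y)"
      using circle_mult_cnj[OF \<nu>] u y by (simp add: mult.commute)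
    hence q2: "Q (star circle_algebra (\<lambda>z\<in>circle. z))"
      using id y by (simp add: Q_def ri)
    show ?thesis using q1 q2 id by simp
  qed
  have "cstar_subalgebra ?P circle_algebra"
  proof (rule A.cstar_subalgebraI)
    show "\<one>\<^bsub>circle_algebra\<^esub> \<in> ?P" using y by (simp add: Q_def)
    fix s l assume s: "\<And>n. s n \<in> ?P" "A.tends s l"
    show "l \<in> ?P"
      using Q_lim[OF _ s(2)] Q_lim[OF _ A.tends_star[OF s(2)]] s(1) A.tends_carrier[OF s(2)] by simp
  qed (auto intro: Q_add Q_mult Q_scale)
  from A.generated_least[OF this, of "{\<lambda>z\<in>circle. z}"] id cont_algebra_generated[of circle] f
  have "f \<in> ?P" by auto
  thus ?thesis by (simp add: Q_def)
qed

end

section \<open>Weighted rotation algebras\<close>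

locale weighted_pair = circle_calculus A \<Phi> for A :: "'a cstar" (structure) and \<Phi> +
  fixes x :: 'a and \<mu> :: complex and p q :: "complex \<Rightarrow> complex"
  assumes x [simp, intro]: "x \<in> carrier A"
    and p: "p \<in> carrier circle_algebra" and q: "q \<in> carrier circle_algebra"
    and xx: "star A x \<otimes> x = \<Phi> p" "x \<otimes> star A x = \<Phi> q"
    and aperiodic: "aperiodic \<mu>"
    and xw: "x \<otimes> w = cnj \<mu> \<odot> (w \<otimes> x)"
begin

declare cont_algebra_simps [simp del] pow_nat [simp del] restrict_apply [simp del]

lemma \<mu>_norm: "cmod \<mu> = 1" "cmod (cnj \<mu>) = 1" "\<mu> * cnj \<mu> = 1" "cnj \<mu> * \<mu> = 1" "\<mu> \<noteq> 0"
  using aperiodic circle_mult_cnj[of \<mu>] by (auto simp: aperiodic_def mult.commute)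

lemma w_closed [simp, intro]: "w \<in> carrier A" "star A w \<in> carrier A"
  using B.unitaryD[OF unitary_w] by auto

lemma xs_w: "star A x \<otimes> w = \<mu> \<odot> (w \<otimes> star A x)"
proof -
  note u = B.unitaryD[OF unitary_w]
  have "star A (x \<otimes> w) = \<mu> \<odot> (star A x \<otimes> star A w)"
    unfolding xw using u by simp
  hence "star A w \<otimes> star A x = \<mu> \<odot> (star A x \<otimes> star A w)" using u by simp
  hence "w \<otimes> (star A w \<otimes> star A x) \<otimes> w
      = w \<otimes> (\<mu> \<odot> (star A x \<otimes> star A w)) \<otimes> w" by simp
  moreover have "w \<otimes> (star A w \<otimes> star A x) \<otimes> w = star A x \<otimes> w"
    using u by (simp flip: B.m_assoc)
  moreover have "w \<otimes> (\<mu> \<odot> (star A x \<otimes> star A w)) \<otimes> w = \<mu> \<odot> (w \<otimes> star A x)"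
    using u by (simp add: B.m_assoc)
  ultimately show ?thesis by simp
qed

lemma rot_closed' [simp, intro]:
  assumes "f \<in> carrier circle_algebra"
  shows "rot \<mu> f \<in> carrier circle_algebra" "rot (cnj \<mu>) f \<in> carrier circle_algebra"
  using rot_closed assms \<mu>_norm by blast+

lemma \<Phi>_x: "f \<in> carrier circle_algebra \<Longrightarrow> \<Phi> f \<otimes> x = x \<otimes> \<Phi> (rot \<mu> f)"
  using intertwine[OF x \<mu>_norm(2) xw, of "rot \<mu> f"] rot_rot[of "cnj \<mu>" \<mu> f] \<mu>_norm by simp

lemma \<Phi>_xs: "f \<in> carrier circle_algebra \<Longrightarrow> \<Phi> f \<otimes> star A x = star A x \<otimes> \<Phi> (rot (cnj \<mu>) f)"
  using intertwine[OF _ \<mu>_norm(1) xs_w, of "rot (cnj \<mu>) f"] rot_rot[of \<mu> "cnj \<mu>" f] \<mu>_norm by simp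

definition X :: "int \<Rightarrow> 'a" where
  "X k = (if 0 \<le> k then x [^] nat k else star A x [^] nat (- k))"

lemma X_closed [simp, intro]: "X k \<in> carrier A"
  by (simp add: X_def)

lemma X_0: "X 0 = \<one>"
  by (simp add: X_def)

lemma X_succ: "0 \<le> k \<Longrightarrow> X (k + 1) = X k \<otimes> x"
  by (simp add: X_def nat_add_distrib)

lemma X_pred: "k \<le> 0 \<Longrightarrow> X (k - 1) = X k \<otimes> star A x"
proof -
  assume k: "k \<le> 0"
  have n: "nat (1 - k) = Suc (nat (- k))" using k by simp
  show ?thesis using k by (cases "k = 0") (auto simp: X_def n)
qed

lemma star_pow: "a \<in> carrier A \<Longrightarrow> star A (a [^] n) = star A a [^] (n::nat)"
proof (induction n)
  case (Suc n)
  have "star A (a [^] Suc n) = star A a \<otimes> star A a [^] n" using Suc by simp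
  also have "\<dots> = star A a [^] Suc n" using Suc by (intro B.nat_pow_Suc2[symmetric]) auto
  finally show ?case .
qed simp

lemma star_X: "star A (X k) = X (- k)"
  by (auto simp: X_def star_pow)

definition D :: "int \<Rightarrow> 'a \<Rightarrow> bool" where
  "D k b \<longleftrightarrow> (\<exists>f\<in>carrier circle_algebra. b = X k \<otimes> \<Phi> f)"

lemma D_I: "f \<in> carrier circle_algebra \<Longrightarrow> D k (X k \<otimes> \<Phi> f)"
  unfolding D_def by blast

lemma D_carrier: "D k b \<Longrightarrow> b \<in> carrier A"
  unfolding D_def by auto

lemma D_\<Phi>: "\<lbrakk>D k b; f \<in> carrier circle_algebra\<rbrakk> \<Longrightarrow> D k (b \<otimes> \<Phi> f)"
proof -
  assume b: "D k b" and f: "f \<in> carrier circle_algebra"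
  obtain g where g: "g \<in> carrier circle_algebra" "b = X k \<otimes> \<Phi> g" using b by (auto simp: D_def)
  have "b \<otimes> \<Phi> f = X k \<otimes> \<Phi> (g \<otimes>\<^bsub>circle_algebra\<^esub> f)" using g f by (simp add: B.m_assoc)
  thus ?thesis using D_I[of "g \<otimes>\<^bsub>circle_algebra\<^esub> f" k] g f by simp
qed

lemma D_x: "D k b \<Longrightarrow> D (k + 1) (b \<otimes> x)"
proof -
  assume "D k b"
  then obtain f where f: "f \<in> carrier circle_algebra" "b = X k \<otimes> \<Phi> f" by (auto simp: D_def)
  have eq: "b \<otimes> x = X k \<otimes> x \<otimes> \<Phi> (rot \<mu> f)"
    using f \<Phi>_x[OF f(1)] by (simp add: B.m_assoc)
  show ?thesis
  proof (cases "0 \<le> k")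
    case True
    thus ?thesis using D_I[of "rot \<mu> f" "k + 1"] f eq by (simp add: X_succ)
  next
    case False
    hence "X k = X (k + 1) \<otimes> star A x" using X_pred[of "k + 1"] by simp
    hence "b \<otimes> x = X (k + 1) \<otimes> \<Phi> p \<otimes> \<Phi> (rot \<mu> f)"
      using eq f xx by (simp add: B.m_assoc)
    thus ?thesis using D_\<Phi>[OF D_I[OF p, of "k + 1"]] f by simp
  qed
qed

lemma D_xs: "D k b \<Longrightarrow> D (k - 1) (b \<otimes> star A x)"
proof -
  assume "D k b"
  then obtain f where f: "f \<in> carrier circle_algebra" "b = X k \<otimes> \<Phi> f" by (auto simp: D_def)
  have eq: "b \<otimes> star A x = X k \<otimes> star A x \<otimes> \<Phi> (rot (cnj \<mu>) f)"
    using f \<Phi>_xs[OF f(1)] by (simp add: B.m_assoc)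
  show ?thesis
  proof (cases "k \<le> 0")
    case True
    thus ?thesis using D_I[of "rot (cnj \<mu>) f" "k - 1"] f eq by (simp add: X_pred)
  next
    case False
    hence "X k = X (k - 1) \<otimes> x" using X_succ[of "k - 1"] by simp
    hence "b \<otimes> star A x = X (k - 1) \<otimes> \<Phi> q \<otimes> \<Phi> (rot (cnj \<mu>) f)"
      using eq f xx by (simp add: B.m_assoc)
    thus ?thesis using D_\<Phi>[OF D_I[OF q, of "k - 1"]] f by simp
  qed
qed

lemma D_X: "D k b \<Longrightarrow> D (k + l) (b \<otimes> X l)"
proof -
  assume b: "D k b"
  note c = D_carrier[OF b]
  have pos: "D (k + int n) (b \<otimes> X (int n))" for n
  proof (induction n)
    case (Suc n)
    thus ?case using D_x[OF Suc] X_succ[of "int n"] c by (simp add: B.m_assoc add.commute add.left_commute)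
  qed (use b c in \<open>simp add: X_0\<close>)
  have neg: "D (k - int n) (b \<otimes> X (- int n))" for n
  proof (induction n)
    case (Suc n)
    have e: "k - int (Suc n) = k - int n - 1" "- int (Suc n) = - int n - 1" by auto
    show ?case unfolding e using D_xs[OF Suc] X_pred[of "- int n"] c by (simp add: B.m_assoc)
  qed (use b c in \<open>simp add: X_0\<close>)
  show ?thesis using pos[of "nat l"] neg[of "nat (- l)"] by (cases "0 \<le> l") auto
qed

lemma D_mult: "\<lbrakk>D k b; D l b'\<rbrakk> \<Longrightarrow> D (k + l) (b \<otimes> b')"
proof -
  assume b: "D k b" and "D l b'"
  then obtain f where f: "f \<in> carrier circle_algebra" "b' = X l \<otimes> \<Phi> f" by (auto simp: D_def)
  have "b \<otimes> b' = b \<otimes> X l \<otimes> \<Phi> f" using D_carrier[OF b] f by (simp add: B.m_assoc)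
  thus ?thesis using D_\<Phi>[OF D_X[OF b] f(1)] by simp
qed

lemma D_0: "f \<in> carrier circle_algebra \<Longrightarrow> D 0 (\<Phi> f)"
  using D_I[of f 0] by (simp add: X_0)

lemma D_star: "D k b \<Longrightarrow> D (- k) (star A b)"
proof -
  assume "D k b"
  then obtain f where f: "f \<in> carrier circle_algebra" "b = X k \<otimes> \<Phi> f" by (auto simp: D_def)
  have "D (0 + - k) (\<Phi> (star circle_algebra f) \<otimes> X (- k))"
    using f by (intro D_X D_0) auto
  thus ?thesis using f by (simp add: star_X)
qed

lemma D_add: "\<lbrakk>D k b; D k b'\<rbrakk> \<Longrightarrow> D k (b \<oplus> b')"
proof -
  assume "D k b" "D k b'"
  then obtain f g where "f \<in> carrier circle_algebra" "b = X k \<otimes> \<Phi> f"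
    "g \<in> carrier circle_algebra" "b' = X k \<otimes> \<Phi> g" by (auto simp: D_def)
  thus ?thesis using D_I[of "f \<oplus>\<^bsub>circle_algebra\<^esub> g" k] by (simp add: B.r_distr)
qed

lemma D_scale: "D k b \<Longrightarrow> D k (c \<odot> b)"
proof -
  assume "D k b"
  then obtain f where "f \<in> carrier circle_algebra" "b = X k \<otimes> \<Phi> f" by (auto simp: D_def)
  thus ?thesis using D_I[of "c \<odot>\<^bsub>circle_algebra\<^esub> f" k] by simp
qed

lemma D_zero: "D k \<zero>"
  using D_I[of "\<zero>\<^bsub>circle_algebra\<^esub>" k] by simp

lemma w_pow:
  fixes n :: nat
  assumes a: "a \<in> carrier A" "w \<otimes> a = \<nu> \<odot> (a \<otimes> w)"
  shows "w \<otimes> a [^] n = (\<nu> ^ n) \<odot> (a [^] n \<otimes> w)"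
proof (induction n)
  case (Suc n)
  have "w \<otimes> a [^] Suc n = (w \<otimes> a [^] n) \<otimes> a" using a by (simp add: B.m_assoc)
  also have "\<dots> = (\<nu> ^ n) \<odot> (a [^] n \<otimes> (w \<otimes> a))"
    unfolding Suc using a by (simp add: B.m_assoc)
  also have "\<dots> = (\<nu> ^ Suc n) \<odot> (a [^] Suc n \<otimes> w)"
    unfolding a(2) using a(1) by (simp add: B.m_assoc mult.commute)
  finally show ?case .
qed simp

lemma w_X: "w \<otimes> X k = (\<mu> powi k) \<odot> (X k \<otimes> w)"
proof -
  have wx: "w \<otimes> x = \<mu> \<odot> (x \<otimes> w)" using \<mu>_norm by (simp add: xw)
  have wxs: "w \<otimes> star A x = cnj \<mu> \<odot> (star A x \<otimes> w)" using \<mu>_norm by (simp add: xs_w)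
  have inv: "cnj \<mu> = inverse \<mu>" using \<mu>_norm by (simp add: field_simps)
  show ?thesis
  proof (cases "0 \<le> k")
    case True
    thus ?thesis using w_pow[OF x wx, of "nat k"] by (simp add: X_def power_int_def)
  next
    case False
    thus ?thesis using w_pow[OF _ wxs, of "nat (- k)"] by (simp add: X_def power_int_def inv)
  qed
qed

lemma D_eigen:
  assumes "D k b" shows "w \<otimes> b \<otimes> star A w = (\<mu> powi k) \<odot> b"
proof -
  note u = B.unitaryD[OF unitary_w]
  obtain f where f: "f \<in> carrier circle_algebra" "b = X k \<otimes> \<Phi> f" using assms by (auto simp: D_def)
  have comm: "w \<otimes> \<Phi> f = \<Phi> f \<otimes> w"
  proof -
    have "(\<lambda>z\<in>circle. z) \<otimes>\<^bsub>circle_algebra\<^esub> f = f \<otimes>\<^bsub>circle_algebra\<^esub> (\<lambda>z\<in>circle. z)"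
      by (auto simp: cont_algebra_simps restrict_def fun_eq_iff)
    thus ?thesis using f circle_id_closed by (simp flip: mult)
  qed
  have "w \<otimes> b \<otimes> star A w = (w \<otimes> X k) \<otimes> \<Phi> f \<otimes> star A w"
    using f by (simp add: B.m_assoc)
  also have "\<dots> = (\<mu> powi k) \<odot> (X k \<otimes> (w \<otimes> \<Phi> f) \<otimes> star A w)"
    unfolding w_X using f by (simp add: B.m_assoc)
  also have "\<dots> = (\<mu> powi k) \<odot> b"
    unfolding comm using f u by (simp add: B.m_assoc)
  finally show ?thesis .
qed

theorem hom_isometric:
  assumes gen: "carrier (cstar_generated A {x, w}) = carrier A"
    and g: "cstar_hom A R g"
    and g_iso: "\<And>f. f \<in> carrier circle_algebra \<Longrightarrow> nrm R (g (\<Phi> f)) = supnorm circle f"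
    and a: "a \<in> carrier A"
  shows "nrm R (g a) = nrm A a"
proof -
  interpret g: cstar_hom A R g by (rule g)
  let ?W = "g w"
  note W = g.B.unitaryD[OF g.unitary[OF unitary_w]]
  let ?\<alpha> = "\<lambda>r. ?W \<otimes>\<^bsub>R\<^esub> r \<otimes>\<^bsub>R\<^esub> star R ?W"
  let ?S = "\<lambda>k a b. a = g b \<and> D k b"
  interpret C: rotation_action R ?\<alpha> \<mu>
    by (rule g.B.rotation_action_conjugation[OF g.unitary[OF unitary_w] aperiodic])
  interpret graded_pair R A ?\<alpha> \<mu> ?S
  proof
    fix k a b assume S: "?S k a b"
    have c: "b \<in> carrier A" using S D_carrier by blast
    show "a \<in> carrier R \<and> b \<in> carrier A" using S c by auto
    show "?S k (s \<odot>\<^bsub>R\<^esub> a) (s \<odot> b)" for s using S c D_scale by auto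
    show "?S (- k) (star R a) (star A b)" using S c D_star by auto
    have "D (- k + k) (star A b \<otimes> b)" using S by (intro D_mult D_star) auto
    then obtain f where f: "f \<in> carrier circle_algebra" "star A b \<otimes> b = \<Phi> f"
      by (auto simp: D_def X_0)
    have "(nrm A b)\<^sup>2 = nrm A (\<Phi> f)" using B.cstar_identity[OF c] f by simp
    also have "\<dots> = nrm R (g (star A b \<otimes> b))" using g_iso[OF f(1)] iso[OF f(1)] f(2) by simp
    also have "\<dots> = (nrm R a)\<^sup>2" using S c g.B.cstar_identity[of a] by simp
    finally show "nrm A b \<le> nrm R a"
      using S c by (intro power2_le_imp_le[of "nrm A b"]) (auto simp: g.B.nrm_nonneg)
    have "?\<alpha> a = g (w \<otimes> b \<otimes> star A w)" using S c by simp
    also have "w \<otimes> b \<otimes> star A w = (\<mu> powi k) \<odot> b" using S D_eigen by blast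
    also have "g \<dots> = (\<mu> powi k) \<odot>\<^bsub>R\<^esub> a" using S c by simp
    finally show "?\<alpha> a = (\<mu> powi k) \<odot>\<^bsub>R\<^esub> a" .
    fix a' b'
    { assume S': "?S k a' b'"
      have "b' \<in> carrier A" using S' D_carrier by blast
      thus "?S k (a \<oplus>\<^bsub>R\<^esub> a') (b \<oplus> b')" using S S' c D_add by auto }
    { fix l assume S': "?S l a' b'"
      have "b' \<in> carrier A" using S' D_carrier by blast
      thus "?S (k + l) (a \<otimes>\<^bsub>R\<^esub> a') (b \<otimes> b')" using S S' c D_mult by auto }
  next
    show "?S k \<zero>\<^bsub>R\<^esub> \<zero>" for k using D_zero by simp
  qed
  have eq: "a = g b" if "G N a b" for N a b
    using that by (induction rule: G.induct) (use G_carrier in auto)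

  let ?D = "{b. \<exists>a. \<Gamma> a b}"
  have one: "D 0 \<one>" using D_0[of "\<one>\<^bsub>circle_algebra\<^esub>"] by simp
  have "\<Gamma> (g x) x" by (rule \<Gamma>_homog[where k = 1]) (use D_x[OF one] in simp)
  moreover have "\<Gamma> (g w) w" by (rule \<Gamma>_homog[where k = 0]) (use D_0[OF circle_id_closed] in simp)
  ultimately have incl: "{x, w} \<subseteq> B.cl ?D" using \<Gamma>_in_cl(2) by blast
  have one': "g \<one> = \<one>\<^bsub>R\<^esub>" by (rule g.one)
  have "cstar_subalgebra (B.cl ?D) A" by (rule \<Gamma>_subalgebras(2)) (use one one' in auto)
  from B.generated_least[OF this incl] have dense: "carrier A \<subseteq> B.cl ?D" by (simp only: gen)
  have "b \<in> carrier A \<and> nrm A b \<le> nrm R (g b)" if b: "b \<in> ?D" for b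
  proof -
    obtain a where a: "\<Gamma> a b" using b by blast
    hence "a = g b" using eq unfolding \<Gamma>_def by blast
    thus ?thesis using \<Gamma>_carrier[OF a] \<Gamma>_le[OF a] by simp
  qed
  from g.isometric_if_dense[OF dense this a] show ?thesis .
qed

end

section \<open>A concrete representation on square-summable sequences\<close>

typedef ell2 = "{f :: int \<Rightarrow> complex. (\<lambda>i. (cmod (f i))\<^sup>2) summable_on UNIV}"
  morphisms coord Abs_ell2
  by (rule exI[of _ "\<lambda>_. 0"]) simp

setup_lifting type_definition_ell2

lemma square_summable: "(\<lambda>i. (cmod (coord x i))\<^sup>2) summable_on UNIV"
  using coord[of x] by simp

lemma summable_on_real_comparison:
  fixes f g :: "'i \<Rightarrow> real"
  assumes "g summable_on A" "\<And>i. i \<in> A \<Longrightarrow> \<bar>f i\<bar> \<le> g i"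
  shows "f summable_on A"
proof -
  have "(\<lambda>i. norm (f i)) summable_on A"
    by (rule Infinite_Sum.summable_on_comparison_test[OF assms(1)]) (use assms(2) in auto)
  thus ?thesis by (rule abs_summable_summable)
qed

lemma square_summable_add:
  assumes "(\<lambda>i. (cmod (f i))\<^sup>2) summable_on A" "(\<lambda>i. (cmod (g i))\<^sup>2) summable_on A"
  shows "(\<lambda>i. (cmod (f i + g i))\<^sup>2) summable_on A"
proof (rule summable_on_real_comparison)
  show "(\<lambda>i. 2 * (cmod (f i))\<^sup>2 + 2 * (cmod (g i))\<^sup>2) summable_on A"
    by (intro summable_on_add summable_on_cmult_right assms)
  fix i
  have "(cmod (f i + g i))\<^sup>2 \<le> (cmod (f i) + cmod (g i))\<^sup>2"
    by (intro power_mono norm_triangle_ineq) simp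
  also have "\<dots> \<le> 2 * (cmod (f i))\<^sup>2 + 2 * (cmod (g i))\<^sup>2"
    using sum_squares_bound[of "cmod (f i)" "cmod (g i)"] by (simp add: power2_sum)
  finally show "\<bar>(cmod (f i + g i))\<^sup>2\<bar> \<le> 2 * (cmod (f i))\<^sup>2 + 2 * (cmod (g i))\<^sup>2" by simp
qed

lemma inner_summable:
  assumes "(\<lambda>i. (cmod (f i))\<^sup>2) summable_on A" "(\<lambda>i. (cmod (g i))\<^sup>2) summable_on A"
  shows "(\<lambda>i. inner (f i) (g i)) summable_on A"
proof (rule summable_on_real_comparison)
  show "(\<lambda>i. (cmod (f i))\<^sup>2 + (cmod (g i))\<^sup>2) summable_on A"
    by (intro summable_on_add assms)
  fix i
  have "\<bar>inner (f i) (g i)\<bar> \<le> cmod (f i) * cmod (g i)" by (rule Cauchy_Schwarz_ineq2)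
  also have "\<dots> \<le> (cmod (f i))\<^sup>2 + (cmod (g i))\<^sup>2"
    using sum_squares_bound[of "cmod (f i)" "cmod (g i)"]
      mult_nonneg_nonneg[OF norm_ge_zero[of "f i"] norm_ge_zero[of "g i"]] by linarith
  finally show "\<bar>inner (f i) (g i)\<bar> \<le> (cmod (f i))\<^sup>2 + (cmod (g i))\<^sup>2" .
qed

instantiation ell2 :: real_vector
begin

lift_definition zero_ell2 :: ell2 is "\<lambda>_. 0" by simp
lift_definition plus_ell2 :: "ell2 \<Rightarrow> ell2 \<Rightarrow> ell2" is "\<lambda>f g i. f i + g i"
  by (rule square_summable_add)
lift_definition uminus_ell2 :: "ell2 \<Rightarrow> ell2" is "\<lambda>f i. - f i" by simp
lift_definition minus_ell2 :: "ell2 \<Rightarrow> ell2 \<Rightarrow> ell2" is "\<lambda>f g i. f i - g i"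
  using square_summable_add[where g = "\<lambda>i. - g i" for g] by simp
lift_definition scaleR_ell2 :: "real \<Rightarrow> ell2 \<Rightarrow> ell2" is "\<lambda>r f i. r *\<^sub>R f i"
  by (simp add: power_mult_distrib summable_on_cmult_right)

instance
  by standard (transfer; simp add: fun_eq_iff algebra_simps)+

end

instantiation ell2 :: real_inner
begin

lift_definition inner_ell2 :: "ell2 \<Rightarrow> ell2 \<Rightarrow> real"
  is "\<lambda>f g. infsum (\<lambda>i. inner (f i) (g i)) UNIV" .

definition norm_ell2 :: "ell2 \<Rightarrow> real" where "norm_ell2 x = sqrt (inner x x)"
definition sgn_ell2 :: "ell2 \<Rightarrow> ell2" where "sgn_ell2 x = x /\<^sub>R norm x"
definition dist_ell2 :: "ell2 \<Rightarrow> ell2 \<Rightarrow> real" where "dist_ell2 x y = norm (x - y)"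
definition uniformity_ell2 :: "(ell2 \<times> ell2) filter"
  where "uniformity_ell2 = (INF e\<in>{0<..}. principal {(x, y). dist x y < e})"
definition open_ell2 :: "ell2 set \<Rightarrow> bool"
  where "open_ell2 U = (\<forall>x\<in>U. \<forall>\<^sub>F (x', y) in uniformity. x' = x \<longrightarrow> y \<in> U)"

instance
proof
  fix x y z :: ell2 and r :: real
  show "dist x y = norm (x - y)" by (rule dist_ell2_def)
  show "sgn x = x /\<^sub>R norm x" by (rule sgn_ell2_def)
  show "uniformity = (INF e\<in>{0<..}. principal {(x::ell2, y). dist x y < e})"
    by (rule uniformity_ell2_def)
  show "open U = (\<forall>x\<in>U. \<forall>\<^sub>F (x', y) in uniformity. x' = x \<longrightarrow> y \<in> U)" for U :: "ell2 set"
    by (rule open_ell2_def)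
  show "inner x y = inner y x" by transfer (simp add: inner_commute)
  show "inner (x + y) z = inner x z + inner y z"
    by transfer (simp add: inner_add_left infsum_add inner_summable)
  show "inner (r *\<^sub>R x) y = r * inner x y"
    by transfer (simp add: infsum_cmult_right')
  show "0 \<le> inner x x" by transfer (simp add: infsum_nonneg)
  show "inner x x = 0 \<longleftrightarrow> x = 0"
  proof transfer
    fix f :: "int \<Rightarrow> complex"
    assume f: "(\<lambda>i. (cmod (f i))\<^sup>2) summable_on UNIV"
    have zero: "f i = 0" if "infsum (\<lambda>i. inner (f i) (f i)) UNIV = 0" for i
      using nonneg_infsum_le_0D[of "\<lambda>i. inner (f i) (f i)" UNIV i] that f
      by (simp add: power2_norm_eq_inner)
    show "(infsum (\<lambda>i. inner (f i) (f i)) UNIV = 0) = (f = (\<lambda>_. 0))"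
    proof
      assume "infsum (\<lambda>i. inner (f i) (f i)) UNIV = 0"
      from zero[OF this] show "f = (\<lambda>_. 0)" by (rule ext)
    qed simp
  qed
  show "norm x = sqrt (inner x x)" by (rule norm_ell2_def)
qed

end

lemma norm_ell2_square: "(norm x)\<^sup>2 = infsum (\<lambda>i. (cmod (coord x i))\<^sup>2) UNIV"
  unfolding power2_norm_eq_inner by transfer (simp add: power2_norm_eq_inner)

lemma coord_simps [simp]:
  "coord (x + y) i = coord x i + coord y i" "coord (x - y) i = coord x i - coord y i"
  "coord 0 i = 0" "coord (r *\<^sub>R x) i = r *\<^sub>R coord x i" "coord (- x) i = - coord x i"
  by (transfer, simp)+

lemma finite_sum_le_norm:
  "finite F \<Longrightarrow> (\<Sum>i\<in>F. (cmod (coord x i))\<^sup>2) \<le> (norm x)\<^sup>2"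
  unfolding norm_ell2_square using square_summable[of x]
  by (intro finite_sum_le_infsum) auto

lemma cmod_coord_le: "cmod (coord x i) \<le> norm x"
  using finite_sum_le_norm[of "{i}" x] by (intro power2_le_imp_le[of "cmod (coord x i)"]) auto

lemma ell2_bounded_memb:
  assumes "\<And>F. finite F \<Longrightarrow> (\<Sum>i\<in>F. (cmod (f i))\<^sup>2) \<le> B"
  shows "(\<lambda>i. (cmod (f i))\<^sup>2) summable_on UNIV" "infsum (\<lambda>i. (cmod (f i))\<^sup>2) UNIV \<le> B"
proof -
  show s: "(\<lambda>i. (cmod (f i))\<^sup>2) summable_on UNIV"
    by (rule nonneg_bdd_above_summable_on) (use assms in \<open>auto intro!: bdd_aboveI2[where M = B]\<close>)
  show "infsum (\<lambda>i. (cmod (f i))\<^sup>2) UNIV \<le> B"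
    using s assms by (intro infsum_le_finite_sums) auto
qed

instance ell2 :: banach
proof
  fix X :: "nat \<Rightarrow> ell2" assume X: "Cauchy X"
  have "convergent (\<lambda>n. coord (X n) i)" for i
  proof -
    have "Cauchy (\<lambda>n. coord (X n) i)"
      unfolding Cauchy_iff
    proof (intro allI impI)
      fix e :: real assume "e > 0"
      then obtain M where M: "\<And>m n. \<lbrakk>m \<ge> M; n \<ge> M\<rbrakk> \<Longrightarrow> norm (X m - X n) < e"
        using X unfolding Cauchy_iff by blast
      have "norm (coord (X m) i - coord (X n) i) < e" if "m \<ge> M" "n \<ge> M" for m n
        using cmod_coord_le[of "X m - X n" i] M[OF that] by simp
      thus "\<exists>M. \<forall>m\<ge>M. \<forall>n\<ge>M. norm (coord (X m) i - coord (X n) i) < e" by blast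
    qed
    thus ?thesis by (simp add: Cauchy_convergent_iff)
  qed
  then obtain l where l: "\<And>i. (\<lambda>n. coord (X n) i) \<longlonglongrightarrow> l i"
    unfolding convergent_def by metis
  have key: "\<exists>M. \<forall>n\<ge>M. \<forall>F. finite F \<longrightarrow> (\<Sum>i\<in>F. (cmod (coord (X n) i - l i))\<^sup>2) \<le> e\<^sup>2"
    if e: "e > 0" for e
  proof -
    obtain M where M: "\<And>m n. \<lbrakk>m \<ge> M; n \<ge> M\<rbrakk> \<Longrightarrow> norm (X m - X n) < e"
      using X e unfolding Cauchy_iff by blast
    have "(\<Sum>i\<in>F. (cmod (coord (X n) i - l i))\<^sup>2) \<le> e\<^sup>2" if n: "n \<ge> M" and F: "finite F" for n F
    proof (rule LIMSEQ_le_const2)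
      show "(\<lambda>m. \<Sum>i\<in>F. (cmod (coord (X n) i - coord (X m) i))\<^sup>2)
          \<longlonglongrightarrow> (\<Sum>i\<in>F. (cmod (coord (X n) i - l i))\<^sup>2)"
        by (intro tendsto_intros l)
      have "(\<Sum>i\<in>F. (cmod (coord (X n) i - coord (X m) i))\<^sup>2) \<le> e\<^sup>2" if "m \<ge> M" for m
      proof -
        have "(\<Sum>i\<in>F. (cmod (coord (X n) i - coord (X m) i))\<^sup>2) \<le> (norm (X n - X m))\<^sup>2"
          using finite_sum_le_norm[OF F, of "X n - X m"] by simp
        also have "\<dots> \<le> e\<^sup>2" using M[OF n that] by (intro power_mono) auto
        finally show ?thesis .
      qed
      thus "\<exists>N. \<forall>m\<ge>N. (\<Sum>i\<in>F. (cmod (coord (X n) i - coord (X m) i))\<^sup>2) \<le> e\<^sup>2" by blast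
    qed
    thus ?thesis by blast
  qed
  obtain M where "\<And>F. finite F \<Longrightarrow> (\<Sum>i\<in>F. (cmod (coord (X M) i - l i))\<^sup>2) \<le> 1\<^sup>2"
    using key[of 1] by auto
  note d = ell2_bounded_memb(1)[OF this]
  have "(\<lambda>i. (cmod (coord (X M) i + - (coord (X M) i - l i)))\<^sup>2) summable_on UNIV"
    by (rule square_summable_add[OF square_summable]) (use d in \<open>simp add: norm_minus_commute\<close>)
  hence lm: "l \<in> {f. (\<lambda>i. (cmod (f i))\<^sup>2) summable_on UNIV}" by simp
  define L where "L = Abs_ell2 l"
  have cL: "coord L i = l i" for i using Abs_ell2_inverse[OF lm] by (simp add: L_def)
  have "X \<longlonglongrightarrow> L"
  proof (rule LIMSEQ_I)
    fix e :: real assume e: "e > 0"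
    obtain M where M: "\<And>n F. \<lbrakk>n \<ge> M; finite F\<rbrakk>
        \<Longrightarrow> (\<Sum>i\<in>F. (cmod (coord (X n) i - l i))\<^sup>2) \<le> (e/2)\<^sup>2"
      using key[of "e/2"] e by auto
    have "norm (X n - L) < e" if "n \<ge> M" for n
    proof -
      have "(norm (X n - L))\<^sup>2 \<le> (e/2)\<^sup>2"
        unfolding norm_ell2_square using ell2_bounded_memb(2)[OF M[OF that]] by (simp add: cL)
      hence "norm (X n - L) \<le> e/2" by (rule power2_le_imp_le) (use e in simp)
      thus ?thesis using e by simp
    qed
    thus "\<exists>no. \<forall>n\<ge>no. norm (X n - L) < e" by blast
  qed
  thus "convergent X" by (auto simp: convergent_def)
qed

lift_definition shift :: "int \<Rightarrow> ell2 \<Rightarrow> ell2" is "\<lambda>k f i. f (i - k)"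
proof -
  fix k :: int and f :: "int \<Rightarrow> complex"
  assume "(\<lambda>i. (cmod (f i))\<^sup>2) summable_on UNIV"
  moreover have "bij (\<lambda>i. i - k)" by (rule bij_betw_byWitness[where f' = "\<lambda>i. i + k"]) auto
  ultimately show "(\<lambda>i. (cmod (f (i - k)))\<^sup>2) summable_on UNIV"
    using summable_on_reindex_bij_betw[of "\<lambda>i. i - k" UNIV UNIV "\<lambda>i. (cmod (f i))\<^sup>2"] by simp
qed

text \<open>The use of \<^const>\<open>sgn\<close> makes \<open>diag m\<close> bounded for all \<open>m\<close>; it is applied to unimodular \<open>m\<close> only.\<close>

lift_definition diag :: "(int \<Rightarrow> complex) \<Rightarrow> ell2 \<Rightarrow> ell2" is "\<lambda>m f i. sgn (m i) * f i"
proof -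
  fix m f :: "int \<Rightarrow> complex"
  assume f: "(\<lambda>i. (cmod (f i))\<^sup>2) summable_on UNIV"
  show "(\<lambda>i. (cmod (sgn (m i) * f i))\<^sup>2) summable_on UNIV"
    by (rule summable_on_real_comparison[OF f]) (auto simp: norm_mult norm_sgn)
qed

lift_definition basis :: "int \<Rightarrow> ell2" is "\<lambda>j i. if i = j then 1 else 0"
proof -
  fix j :: int
  have "(\<lambda>i. (cmod (if i = j then 1 else 0))\<^sup>2) summable_on {j} \<longleftrightarrow>
      (\<lambda>i. (cmod (if i = j then 1 else 0))\<^sup>2) summable_on UNIV"
    by (rule summable_on_cong_neutral) auto
  thus "(\<lambda>i. (cmod (if i = j then 1 else 0))\<^sup>2) summable_on UNIV" by simp
qed

lemma coord_shift [simp]: "coord (shift k x) i = coord x (i - k)"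
  and coord_diag [simp]: "coord (diag m x) i = sgn (m i) * coord x i"
  and coord_basis [simp]: "coord (basis j) i = (if i = j then 1 else 0)"
  by (transfer, simp)+

lemma ell2_eqI: "(\<And>i. coord x i = coord y i) \<Longrightarrow> x = y"
  by (metis coord_inject ext)

lemma inner_ell2: "inner x y = infsum (\<lambda>i. inner (coord x i) (coord y i)) UNIV"
  by transfer simp

lemma inner_diag: "inner (diag m x) y = inner x (diag (\<lambda>i. cnj (m i)) y)"
proof -
  have "inner (sgn c * a) b = inner a (sgn (cnj c) * b)" for a b c :: complex
  proof -
    have "sgn (cnj c) = cnj (sgn c)" by (simp add: sgn_div_norm)
    moreover have "inner (d * a) b = inner a (cnj d * b)" for d
      by (simp add: inner_complex_def algebra_simps)
    ultimately show ?thesis by simp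
  qed
  thus ?thesis by (simp add: inner_ell2)
qed

lemma inner_shift: "inner (shift k x) y = inner x (shift (- k) y)"
proof -
  have "bij (\<lambda>i. i - k)" by (rule bij_betw_byWitness[where f' = "\<lambda>i. i + k"]) auto
  from infsum_reindex_bij_betw[OF this, of "\<lambda>i. inner (coord x i) (coord y (i + k))"]
  show ?thesis by (simp add: inner_ell2)
qed

lemma inner_basis:
  "inner x (basis i) = Re (coord x i)" "inner x (diag (\<lambda>_. \<i>) (basis i)) = Im (coord x i)"
proof -
  have "inner x (basis i) = infsum (\<lambda>j. inner (coord x j) (if j = i then 1 else 0)) {i}"
    unfolding inner_ell2 by (rule infsum_cong_neutral) auto
  thus "inner x (basis i) = Re (coord x i)" by (simp add: inner_complex_def)
  have "inner x (diag (\<lambda>_. \<i>) (basis i)) = infsum (\<lambda>j. inner (coord x j) (if j = i then \<i> else 0)) {i}"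
    unfolding inner_ell2 by (rule infsum_cong_neutral) (auto simp: sgn_div_norm)
  thus "inner x (diag (\<lambda>_. \<i>) (basis i)) = Im (coord x i)" by (simp add: inner_complex_def)
qed

lemma norm_shift: "norm (shift k x) = norm x"
  unfolding norm_eq_sqrt_inner[of "shift k x"] inner_shift norm_eq_sqrt_inner[of x]
  by (rule arg_cong[of _ _ "\<lambda>y. sqrt (inner x y)"]) (rule ell2_eqI, simp)

lemma norm_diag_le: "norm (diag m x) \<le> norm x"
proof (rule power2_le_imp_le)
  show "(norm (diag m x))\<^sup>2 \<le> (norm x)\<^sup>2"
    unfolding norm_ell2_square using square_summable[of x] square_summable[of "diag m x"]
    by (intro infsum_mono) (auto simp: norm_mult norm_sgn)
qed simp

lift_definition Shift :: "int \<Rightarrow> ell2 \<Rightarrow>\<^sub>L ell2" is shift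
  by (rule bounded_linear_intro[where K = 1])
    (auto intro!: ell2_eqI simp: norm_shift)

lift_definition Diag :: "(int \<Rightarrow> complex) \<Rightarrow> ell2 \<Rightarrow>\<^sub>L ell2" is diag
  by (rule bounded_linear_intro[where K = 1])
    (auto intro!: ell2_eqI simp: norm_diag_le algebra_simps)

lemma Shift_apply [simp]: "blinfun_apply (Shift k) x = shift k x"
  and Diag_apply [simp]: "blinfun_apply (Diag m) x = diag m x"
  by (simp_all add: Shift.rep_eq Diag.rep_eq)

subsection \<open>Bounded operators with adjoint\<close>

type_synonym operator = "ell2 \<Rightarrow>\<^sub>L ell2"

definition is_adj :: "operator \<Rightarrow> operator \<Rightarrow> bool" where
  "is_adj T S \<longleftrightarrow> (\<forall>x y. inner (blinfun_apply T x) y = inner x (blinfun_apply S y))"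

text \<open>Multiplication by the imaginary unit, on the underlying real Hilbert space.\<close>

definition J :: operator where "J = Diag (\<lambda>_. \<i>)"

definition adj :: "operator \<Rightarrow> operator" where "adj T = (THE S. is_adj T S)"

lemma is_adj_unique: "\<lbrakk>is_adj T S; is_adj T S'\<rbrakk> \<Longrightarrow> S = S'"
proof (rule blinfun_eqI)
  fix y assume "is_adj T S" "is_adj T S'"
  hence "\<forall>x. inner x (blinfun_apply S y) = inner x (blinfun_apply S' y)"
    by (simp add: is_adj_def)
  thus "blinfun_apply S y = blinfun_apply S' y" by (simp only: vector_eq_ldot)
qed

lemma adj_eq: "is_adj T S \<Longrightarrow> adj T = S"
  unfolding adj_def by (rule the_equality) (auto intro: is_adj_unique)

lemma is_adj_sym: "is_adj T S \<Longrightarrow> is_adj S T"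
  by (simp add: is_adj_def) (metis inner_commute)

lemma is_adj_add: "\<lbrakk>is_adj T S; is_adj T' S'\<rbrakk> \<Longrightarrow> is_adj (T + T') (S + S')"
  by (simp add: is_adj_def blinfun.add_left inner_add_left inner_add_right)

lemma is_adj_scaleR: "is_adj T S \<Longrightarrow> is_adj (r *\<^sub>R T) (r *\<^sub>R S)"
  by (simp add: is_adj_def blinfun.scaleR_left)

lemma is_adj_compose: "\<lbrakk>is_adj T S; is_adj T' S'\<rbrakk> \<Longrightarrow> is_adj (T o\<^sub>L T') (S' o\<^sub>L S)"
  by (simp add: is_adj_def)

lemma is_adj_id: "is_adj id_blinfun id_blinfun"
  by (simp add: is_adj_def)

lemma is_adj_zero: "is_adj 0 0"
  by (simp add: is_adj_def)

lemma is_adj_Shift: "is_adj (Shift k) (Shift (- k))"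
  by (simp add: is_adj_def inner_shift)

lemma is_adj_Diag: "is_adj (Diag m) (Diag (\<lambda>i. cnj (m i)))"
  by (simp add: is_adj_def inner_diag)

lemma Diag_J: "Diag (\<lambda>_. - \<i>) = - J"
  by (rule blinfun_eqI) (auto intro!: ell2_eqI simp: J_def blinfun.minus_left sgn_div_norm)

lemma is_adj_J: "is_adj J (- J)"
  using is_adj_Diag[of "\<lambda>_. \<i>"] by (simp add: J_def[symmetric] Diag_J)

lemma J_J: "J o\<^sub>L J = - id_blinfun"
  by (rule blinfun_eqI) (auto intro!: ell2_eqI simp: J_def blinfun.minus_left sgn_div_norm)

lemma norm_adj_le: "is_adj T S \<Longrightarrow> norm S \<le> norm T"
proof (rule norm_blinfun_bound)
  fix y assume a: "is_adj T S"
  let ?z = "blinfun_apply S y"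
  have "norm ?z * norm ?z = inner (blinfun_apply T ?z) y"
    using a by (simp add: is_adj_def flip: power2_norm_eq_inner power2_eq_square)
  also have "\<dots> \<le> norm (blinfun_apply T ?z) * norm y" by (rule norm_cauchy_schwarz)
  also have "\<dots> \<le> (norm T * norm ?z) * norm y"
    by (intro mult_right_mono norm_blinfun) simp
  finally have "norm ?z * norm ?z \<le> norm ?z * (norm T * norm y)" by (simp add: algebra_simps)
  thus "norm ?z \<le> norm T * norm y"
    by (cases "norm ?z = 0") (auto simp: mult_le_cancel_left)
qed simp

lemma norm_adj: "is_adj T S \<Longrightarrow> norm S = norm T"
  using norm_adj_le is_adj_sym by (intro antisym) blast+

lemma norm_adj_compose:
  assumes "is_adj T S" shows "norm (S o\<^sub>L T) = (norm T)\<^sup>2"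
proof (rule antisym)
  show "norm (S o\<^sub>L T) \<le> (norm T)\<^sup>2"
    using norm_blinfun_compose[of S T] norm_adj[OF assms] by (simp add: power2_eq_square)
  have "norm T \<le> sqrt (norm (S o\<^sub>L T))"
  proof (rule norm_blinfun_bound)
    fix x
    have "(norm (blinfun_apply T x))\<^sup>2 = inner x (blinfun_apply (S o\<^sub>L T) x)"
      using assms by (simp add: is_adj_def power2_norm_eq_inner)
    also have "\<dots> \<le> norm x * (norm (S o\<^sub>L T) * norm x)"
      by (intro order_trans[OF norm_cauchy_schwarz] mult_left_mono norm_blinfun) simp
    also have "\<dots> = (sqrt (norm (S o\<^sub>L T)) * norm x)\<^sup>2"
      by (simp add: power_mult_distrib power2_eq_square)
    finally show "norm (blinfun_apply T x) \<le> sqrt (norm (S o\<^sub>L T)) * norm x"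
      by (rule power2_le_imp_le) simp
  qed simp
  thus "(norm T)\<^sup>2 \<le> norm (S o\<^sub>L T)"
    by (metis norm_ge_zero power_mono real_sqrt_pow2)
qed

definition cscale :: "complex \<Rightarrow> operator \<Rightarrow> operator" where
  "cscale c T = Re c *\<^sub>R T + Im c *\<^sub>R (J o\<^sub>L T)"

definition ops :: "operator set" where
  "ops = {T. J o\<^sub>L T = T o\<^sub>L J \<and> (\<exists>S. is_adj T S)}"

definition operator_algebra :: "operator cstar" where
  "operator_algebra = \<lparr>carrier = ops, mult = (o\<^sub>L), one = id_blinfun, zero = 0, add = (+),
    smult = cscale, star = adj, nrm = norm\<rparr>"

lemma operator_algebra_simps [simp]:
  "carrier operator_algebra = ops" "T \<otimes>\<^bsub>operator_algebra\<^esub> S = T o\<^sub>L S"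
  "\<one>\<^bsub>operator_algebra\<^esub> = id_blinfun" "\<zero>\<^bsub>operator_algebra\<^esub> = 0" "T \<oplus>\<^bsub>operator_algebra\<^esub> S = T + S"
  "c \<odot>\<^bsub>operator_algebra\<^esub> T = cscale c T" "star operator_algebra T = adj T" "nrm operator_algebra T = norm T"
  by (simp_all add: operator_algebra_def)

lemmas compose_distribs =
  bounded_bilinear.add_left[OF bounded_bilinear_blinfun_compose]
  bounded_bilinear.add_right[OF bounded_bilinear_blinfun_compose]
  bounded_bilinear.scaleR_left[OF bounded_bilinear_blinfun_compose]
  bounded_bilinear.scaleR_right[OF bounded_bilinear_blinfun_compose]
  bounded_bilinear.minus_left[OF bounded_bilinear_blinfun_compose]
  bounded_bilinear.minus_right[OF bounded_bilinear_blinfun_compose]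

lemma compose_id [simp]: "id_blinfun o\<^sub>L T = T" "T o\<^sub>L id_blinfun = T"
  by (rule blinfun_eqI, simp)+

lemma compose_zero [simp]: "T o\<^sub>L 0 = 0"
  by (rule blinfun_eqI) simp

lemma compose_assoc: "(T o\<^sub>L S) o\<^sub>L R = T o\<^sub>L (S o\<^sub>L R)"
  by (rule blinfun_eqI) simp

lemma J_J_compose: "J o\<^sub>L (J o\<^sub>L T) = - T"
  by (simp add: J_J compose_distribs flip: compose_assoc)

lemma is_adj_ops: "T \<in> ops \<Longrightarrow> is_adj T (adj T)"
  using adj_eq by (auto simp: ops_def)

lemma ops_J: "T \<in> ops \<Longrightarrow> T o\<^sub>L J = J o\<^sub>L T"
  by (simp add: ops_def)

lemma ops_I: "\<lbrakk>J o\<^sub>L T = T o\<^sub>L J; is_adj T S\<rbrakk> \<Longrightarrow> T \<in> ops"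
  by (auto simp: ops_def)

lemma adj_ops: "T \<in> ops \<Longrightarrow> adj T \<in> ops"
proof (rule ops_I[OF _ is_adj_sym[OF is_adj_ops]])
  assume T: "T \<in> ops"
  have "is_adj (J o\<^sub>L T) (adj T o\<^sub>L (- J))" "is_adj (T o\<^sub>L J) ((- J) o\<^sub>L adj T)"
    by (intro is_adj_compose is_adj_ops is_adj_J T)+
  hence "adj T o\<^sub>L (- J) = (- J) o\<^sub>L adj T" using ops_J[OF T] is_adj_unique by simp
  thus "J o\<^sub>L adj T = adj T o\<^sub>L J" by (simp add: compose_distribs)
qed

lemma ops_cscale_aux:
  assumes T: "T \<in> ops" shows "cscale c T \<in> ops" "adj (cscale c T) = cscale (cnj c) (adj T)"
proof -
  have "is_adj (cscale c T) (Re c *\<^sub>R adj T + Im c *\<^sub>R (adj T o\<^sub>L (- J)))"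
    unfolding cscale_def
    by (intro is_adj_add is_adj_scaleR is_adj_compose is_adj_J is_adj_ops T)
  also have "Re c *\<^sub>R adj T + Im c *\<^sub>R (adj T o\<^sub>L (- J)) = cscale (cnj c) (adj T)"
    using ops_J[OF adj_ops[OF T]] by (simp add: cscale_def compose_distribs)
  finally have a: "is_adj (cscale c T) (cscale (cnj c) (adj T))" .
  show "adj (cscale c T) = cscale (cnj c) (adj T)" by (rule adj_eq[OF a])
  show "cscale c T \<in> ops"
    by (rule ops_I[OF _ a]) (simp add: cscale_def compose_distribs ops_J[OF T] compose_assoc)
qed

lemma norm_eq_scaled:
  assumes "0 \<le> k" "\<And>x. norm (blinfun_apply S x) = k * norm (blinfun_apply T x)"
  shows "norm S = k * norm T"
proof (rule antisym)
  show "norm S \<le> k * norm T"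
    using assms norm_blinfun[of T]
    by (intro norm_blinfun_bound) (auto simp: mult.assoc intro: mult_left_mono)
  show "k * norm T \<le> norm S"
  proof (cases "k = 0")
    case False
    hence k: "k > 0" using assms(1) by simp
    have "norm T \<le> norm S / k"
    proof (rule norm_blinfun_bound)
      fix x
      show "norm (blinfun_apply T x) \<le> norm S / k * norm x"
        using norm_blinfun[of S x] assms(2)[of x] k by (simp add: field_simps)
    qed (use k in simp)
    thus ?thesis using k by (simp add: field_simps)
  qed simp
qed

lemma norm_cscale: "norm (cscale c T) = cmod c * norm T"
proof (rule norm_eq_scaled)
  fix x
  let ?y = "blinfun_apply T x"
  have Jy: "inner (blinfun_apply J ?y) z = - inner ?y (blinfun_apply J z)" for z
    using is_adj_J by (simp add: is_adj_def blinfun.minus_left)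
  have "inner (blinfun_apply J ?y) ?y = - inner (blinfun_apply J ?y) ?y"
    using Jy[of ?y] by (simp add: inner_commute)
  hence orth: "inner (blinfun_apply J ?y) ?y = 0" by simp
  have "blinfun_apply J (blinfun_apply J ?y) = - ?y"
    using J_J_compose[of T] by (metis blinfun_apply_blinfun_compose blinfun.minus_left)
  hence iso: "inner (blinfun_apply J ?y) (blinfun_apply J ?y) = inner ?y ?y"
    using Jy[of "blinfun_apply J ?y"] by simp
  have "(norm (blinfun_apply (cscale c T) x))\<^sup>2 = (Re c)\<^sup>2 * inner ?y ?y + (Im c)\<^sup>2 * inner ?y ?y"
    unfolding power2_norm_eq_inner using orth iso
    by (simp add: cscale_def blinfun.add_left blinfun.scaleR_left
        inner_add_left inner_add_right inner_commute[of ?y "blinfun_apply J ?y"] power2_eq_square)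
  also have "\<dots> = (cmod c * norm ?y)\<^sup>2"
    by (simp add: power_mult_distrib cmod_power2 power2_norm_eq_inner algebra_simps)
  finally show "norm (blinfun_apply (cscale c T) x) = cmod c * norm ?y"
    by (simp add: power2_eq_iff_nonneg)
qed simp

lemma ops_limit:
  assumes s: "\<And>n. s n \<in> ops" and l: "s \<longlonglongrightarrow> T" shows "T \<in> ops"
proof -
  have d: "norm (adj (s m) - adj (s n)) = norm (s m - s n)" for m n
  proof -
    have "is_adj (s m + (- 1) *\<^sub>R s n) (adj (s m) + (- 1) *\<^sub>R adj (s n))"
      by (intro is_adj_add is_adj_scaleR is_adj_ops s)
    from norm_adj[OF this] show ?thesis by simp
  qed
  have "Cauchy s" using l by (simp add: LIMSEQ_imp_Cauchy)
  hence "Cauchy (\<lambda>n. adj (s n))" by (simp add: Cauchy_iff d)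
  then obtain S where S: "(\<lambda>n. adj (s n)) \<longlonglongrightarrow> S"
    by (auto simp: Cauchy_convergent_iff convergent_def)
  have "inner (blinfun_apply T x) y = inner x (blinfun_apply S y)" for x y
  proof (rule LIMSEQ_unique)
    show "(\<lambda>n. inner (blinfun_apply (s n) x) y) \<longlonglongrightarrow> inner (blinfun_apply T x) y"
      by (intro tendsto_intros l)
    have "(\<lambda>n. inner x (blinfun_apply (adj (s n)) y)) \<longlonglongrightarrow> inner x (blinfun_apply S y)"
      by (intro tendsto_intros S)
    thus "(\<lambda>n. inner (blinfun_apply (s n) x) y) \<longlonglongrightarrow> inner x (blinfun_apply S y)"
      using is_adj_ops[OF s] by (simp add: is_adj_def)
  qed
  moreover have "J o\<^sub>L T = T o\<^sub>L J"
  proof (rule LIMSEQ_unique)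
    show "(\<lambda>n. J o\<^sub>L s n) \<longlonglongrightarrow> (J o\<^sub>L T)"
      by (intro bounded_bilinear.tendsto[OF bounded_bilinear_blinfun_compose] tendsto_const l)
    have "(\<lambda>n. s n o\<^sub>L J) \<longlonglongrightarrow> (T o\<^sub>L J)"
      by (intro bounded_bilinear.tendsto[OF bounded_bilinear_blinfun_compose] tendsto_const l)
    thus "(\<lambda>n. J o\<^sub>L s n) \<longlonglongrightarrow> (T o\<^sub>L J)" using ops_J[OF s] by simp
  qed
  ultimately show ?thesis by (auto simp: ops_def is_adj_def)
qed

lemma cstar_algebra_operator_algebra: "cstar_algebra operator_algebra"
proof (rule cstar_algebraI, simp_all only: operator_algebra_simps)
  fix S T R :: operator and c d :: complex
  show "(0::operator) \<in> ops" "id_blinfun \<in> ops"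
    by (rule ops_I[OF _ is_adj_zero], simp) (rule ops_I[OF _ is_adj_id], simp)
  show "cscale (c + d) T = cscale c T + cscale d T" by (simp add: cscale_def algebra_simps)
  show "cscale 1 T = T" "cscale 0 T = 0" by (simp_all add: cscale_def)
  show "cscale (c * d) T = cscale c (cscale d T)"
    by (simp add: cscale_def compose_distribs J_J_compose algebra_simps)
  show "cscale c (S + T) = cscale c S + cscale c T"
    by (simp add: cscale_def compose_distribs algebra_simps)
  show "cscale c S o\<^sub>L T = cscale c (S o\<^sub>L T)"
    by (simp add: cscale_def compose_distribs compose_assoc)
  show "norm (cscale c T) = cmod c * norm T" by (rule norm_cscale)
  show "norm (S o\<^sub>L T) \<le> norm S * norm T" by (rule norm_blinfun_compose)
  show "(S + T) o\<^sub>L R = (S o\<^sub>L R) + (T o\<^sub>L R)" "R o\<^sub>L (S + T) = (R o\<^sub>L S) + (R o\<^sub>L T)"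
    by (simp_all add: compose_distribs)
  assume T: "T \<in> ops"
  note aT = is_adj_ops[OF T]
  show "cscale c T \<in> ops" "adj (cscale c T) = cscale (cnj c) (adj T)"
    using ops_cscale_aux[OF T] by auto
  show "adj T \<in> ops" by (rule adj_ops[OF T])
  show "adj (adj T) = T" by (rule adj_eq[OF is_adj_sym[OF aT]])
  show "norm (adj T o\<^sub>L T) = (norm T)\<^sup>2" by (rule norm_adj_compose[OF aT])
  show "T o\<^sub>L cscale c S = cscale c (T o\<^sub>L S)"
    by (simp add: cscale_def compose_distribs ops_J[OF T] flip: compose_assoc)
  assume S: "S \<in> ops"
  note aS = is_adj_ops[OF S]
  show "T + S \<in> ops"
    by (rule ops_I[OF _ is_adj_add[OF aT aS]]) (simp add: compose_distribs ops_J S T)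
  show "T o\<^sub>L S \<in> ops"
    by (rule ops_I[OF _ is_adj_compose[OF aT aS]])
      (metis ops_J[OF S] ops_J[OF T] compose_assoc)
  show "adj (T + S) = adj T + adj S" by (rule adj_eq[OF is_adj_add[OF aT aS]])
  show "adj (T o\<^sub>L S) = adj S o\<^sub>L adj T" by (rule adj_eq[OF is_adj_compose[OF aT aS]])
next
  fix s :: "nat \<Rightarrow> operator"
  assume s: "\<And>n. s n \<in> ops"
    and C: "\<And>e. e > 0 \<Longrightarrow> \<exists>N. \<forall>m\<ge>N. \<forall>n\<ge>N. norm (s m + cscale (- 1) (s n)) < e"
  have "Cauchy s" using C by (simp add: Cauchy_iff cscale_def)
  then obtain T where T: "s \<longlonglongrightarrow> T" by (auto simp: Cauchy_convergent_iff convergent_def)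
  have "(\<lambda>n. norm (s n + cscale (- 1) T)) \<longlonglongrightarrow> 0"
    using T by (simp add: cscale_def tendsto_norm_zero_iff LIM_zero_iff)
  thus "\<exists>l\<in>ops. (\<lambda>n. norm (s n + cscale (- 1) l)) \<longlonglongrightarrow> 0" using ops_limit[OF s T] by blast
qed (auto simp: compose_assoc norm_triangle_ineq)

lemma Shift_ops: "Shift k \<in> ops"
  by (rule ops_I[OF _ is_adj_Shift]) (auto intro!: blinfun_eqI ell2_eqI simp: J_def)

lemma Diag_ops: "Diag m \<in> ops"
  by (rule ops_I[OF _ is_adj_Diag]) (auto intro!: blinfun_eqI ell2_eqI simp: J_def mult_ac)

lemma operator_rotation_relations:
  "rotation_relations \<theta> operator_algebra (Shift 1) (Diag (\<lambda>i. exp (2 * pi * \<i> * \<theta>) powi i))"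
proof -
  define \<mu> where "\<mu> = exp (2 * pi * \<i> * \<theta>)"
  have n: "cmod \<mu> = 1" by (simp add: \<mu>_def norm_exp_eq_Re)
  hence sg: "sgn (\<mu> powi i) = \<mu> powi i" for i by (simp add: sgn_div_norm norm_power_int)
  have unimod: "sgn (cnj a) * (sgn a * z) = z" "sgn a * (sgn (cnj a) * z) = z" if "cmod a = 1" for a z
    using that circle_mult_cnj[OF that] mult.commute[of a "cnj a"]
    by (simp_all add: sgn_div_norm flip: mult.assoc)
  have succ: "\<mu> powi i = \<mu> * \<mu> powi (i - 1)" for i
  proof -
    have "\<mu> \<noteq> 0" using n by auto
    thus ?thesis using power_int_add[of \<mu> 1 "i - 1"] by simp
  qed
  have J: "blinfun_apply (cscale c T) x = Re c *\<^sub>R blinfun_apply T x + Im c *\<^sub>R diag (\<lambda>_. \<i>) (blinfun_apply T x)"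
    for c T x by (simp add: cscale_def J_def blinfun.add_left blinfun.scaleR_left)
  have sc: "Re c *\<^sub>R z + Im c *\<^sub>R (sgn \<i> * z) = c * z" for c z
    by (simp add: complex_eq_iff sgn_div_norm)
  have "unitary_in operator_algebra (Shift 1)"
    unfolding unitary_in_def operator_algebra_simps adj_eq[OF is_adj_Shift]
    by (intro conjI Shift_ops blinfun_eqI ell2_eqI) auto
  moreover have "unitary_in operator_algebra (Diag (\<lambda>i. \<mu> powi i))"
    unfolding unitary_in_def operator_algebra_simps adj_eq[OF is_adj_Diag]
    by (intro conjI Diag_ops blinfun_eqI ell2_eqI)
      (use unimod n in \<open>simp_all add: norm_power_int del: complex_cnj_power_int\<close>)
  moreover have "Diag (\<lambda>i. \<mu> powi i) o\<^sub>L Shift 1 = cscale \<mu> (Shift 1 o\<^sub>L Diag (\<lambda>i. \<mu> powi i))"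
  proof (intro blinfun_eqI ell2_eqI)
    fix x i
    show "coord (blinfun_apply (Diag (\<lambda>i. \<mu> powi i) o\<^sub>L Shift 1) x) i
        = coord (blinfun_apply (cscale \<mu> (Shift 1 o\<^sub>L Diag (\<lambda>i. \<mu> powi i))) x) i"
    proof -
      have "sgn (\<mu> powi i) = \<mu> * sgn (\<mu> powi (i - 1))" unfolding sg by (rule succ)
      thus ?thesis unfolding J by (simp add: sc)
    qed
  qed
  ultimately show ?thesis by (simp add: rotation_relations_def \<mu>_def)
qed

lemma operator_nonzero: "\<one>\<^bsub>operator_algebra\<^esub> \<noteq> \<zero>\<^bsub>operator_algebra\<^esub>"
proof
  assume "\<one>\<^bsub>operator_algebra\<^esub> = \<zero>\<^bsub>operator_algebra\<^esub>"
  hence "blinfun_apply id_blinfun (basis 0) = blinfun_apply 0 (basis 0)" by simp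
  hence "basis 0 = 0" by simp
  hence "coord (basis 0) 0 = coord 0 0" by simp
  thus False by simp
qed

subsection \<open>Transport to the real numbers\<close>

lemma inj_matrix: "inj_on (\<lambda>T (i, j). coord (blinfun_apply T (basis j)) i) ops"
proof (rule inj_onI)
  fix T T' assume T: "T \<in> ops" "T' \<in> ops"
    and eq: "(\<lambda>(i, j). coord (blinfun_apply T (basis j)) i) = (\<lambda>(i, j). coord (blinfun_apply T' (basis j)) i)"
  interpret cstar_algebra operator_algebra by (rule cstar_algebra_operator_algebra)
  define D where "D = T + cscale (- 1) T'"
  have D: "D \<in> ops" using T scale_closed[of T' "- 1"] M.add.m_closed[of T "cscale (- 1) T'"] by (simp add: D_def)
  have "coord (blinfun_apply D (basis j)) i = 0" for i j
    using fun_cong[OF eq, of "(i, j)"] by (simp add: D_def cscale_def blinfun.diff_left)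
  hence De: "blinfun_apply D (basis j) = 0" for j by (intro ell2_eqI) simp
  have DJ: "blinfun_apply D (diag (\<lambda>_. \<i>) (basis j)) = 0" for j
  proof -
    have "blinfun_apply (D o\<^sub>L J) (basis j) = blinfun_apply (J o\<^sub>L D) (basis j)"
      using ops_J[OF D] by simp
    thus ?thesis by (simp add: De) (simp add: J_def)
  qed
  have adj: "inner (blinfun_apply (adj D) y) z = inner y (blinfun_apply D z)" for y z
    using is_adj_sym[OF is_adj_ops[OF D]] by (simp add: is_adj_def)
  have "blinfun_apply (adj D) y = 0" for y
  proof (rule ell2_eqI)
    fix i
    show "coord (blinfun_apply (adj D) y) i = coord 0 i"
      using adj[of y "basis i"] adj[of y "diag (\<lambda>_. \<i>) (basis i)"]
      by (simp add: inner_basis De DJ complex_eq_iff)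
  qed
  hence "adj D = 0" by (intro blinfun_eqI) simp
  hence "D = 0" using norm_adj[OF is_adj_ops[OF D]] by simp
  thus "T = T'" by (simp add: D_def cscale_def)
qed

lemma matrices_inject_reals: "\<exists>f :: (int \<times> int \<Rightarrow> complex) \<Rightarrow> real. inj f"
proof -
  let ?code = "\<lambda>m :: int \<times> int \<Rightarrow> complex.
    {(k, b, r :: rat). of_rat r < (if b then Re (m k) else Im (m k))}"
  have "inj ?code"
  proof (rule injI, rule ext)
    fix m m' k assume eq: "?code m = ?code m'"
    have eq': "of_rat r < (if b then Re (m k) else Im (m k))
        \<longleftrightarrow> of_rat r < (if b then Re (m' k) else Im (m' k))" for b and r :: rat
    proof -
      have "(k, b, r) \<in> ?code m \<longleftrightarrow> (k, b, r) \<in> ?code m'" using eq by (simp only:)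
      thus ?thesis by simp
    qed
    have same: "s = t" if "\<And>r :: rat. of_rat r < s \<longleftrightarrow> of_rat r < t" for s t :: real
    proof (rule ccontr)
      assume "s \<noteq> t"
      then consider "s < t" | "t < s" by linarith
      thus False
        using that of_rat_dense[of s t] of_rat_dense[of t s] by cases (metis order_less_asym)+
    qed
    show "m k = m' k"
      using same[OF eq'[of _ True]] same[OF eq'[of _ False]] by (simp add: complex_eq_iff)
  qed
  moreover have "inj (\<lambda>X :: ((int \<times> int) \<times> bool \<times> rat) set. to_nat ` X)"
    by (rule injI) (simp add: inj_image_eq_iff)
  moreover obtain h :: "nat set \<Rightarrow> real" where "inj h"
    using nat_sets_eqpoll_reals by (auto simp: eqpoll_def bij_betw_def)
  ultimately have "inj (h \<circ> (\<lambda>X. to_nat ` X) \<circ> ?code)" by (intro inj_compose)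
  thus ?thesis by blast
qed

definition transport :: "('a \<Rightarrow> 'b) \<Rightarrow> 'a cstar \<Rightarrow> 'b cstar" where
  "transport f A = (let g = inv_into (carrier A) f in
    \<lparr>carrier = f ` carrier A, mult = (\<lambda>a b. f (g a \<otimes>\<^bsub>A\<^esub> g b)), one = f \<one>\<^bsub>A\<^esub>, zero = f \<zero>\<^bsub>A\<^esub>,
     add = (\<lambda>a b. f (g a \<oplus>\<^bsub>A\<^esub> g b)), smult = (\<lambda>c a. f (c \<odot>\<^bsub>A\<^esub> g a)),
     star = (\<lambda>a. f (star A (g a))), nrm = (\<lambda>a. nrm A (g a))\<rparr>)"

lemma transport:
  assumes A: "cstar_algebra A" and f: "inj_on f (carrier A)"
  shows "cstar_algebra (transport f A)" "star_hom A (transport f A) f"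
proof -
  interpret cstar_algebra A by fact
  define g where "g = inv_into (carrier A) f"
  have g: "g (f a) = a" if "a \<in> carrier A" for a using f that by (simp add: g_def)
  have simps: "carrier (transport f A) = f ` carrier A"
    "a \<otimes>\<^bsub>transport f A\<^esub> b = f (g a \<otimes>\<^bsub>A\<^esub> g b)" "\<one>\<^bsub>transport f A\<^esub> = f \<one>\<^bsub>A\<^esub>" "\<zero>\<^bsub>transport f A\<^esub> = f \<zero>\<^bsub>A\<^esub>"
    "a \<oplus>\<^bsub>transport f A\<^esub> b = f (g a \<oplus>\<^bsub>A\<^esub> g b)" "c \<odot>\<^bsub>transport f A\<^esub> a = f (c \<odot>\<^bsub>A\<^esub> g a)"
    "star (transport f A) a = f (star A (g a))" "nrm (transport f A) a = nrm A (g a)" for a b c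
    by (simp_all add: transport_def Let_def g_def)
  show "star_hom A (transport f A) f"
    by (auto simp: star_hom_def ring_hom_def simps g)
  have feq: "f a = f b \<longleftrightarrow> a = b" if "a \<in> carrier A" "b \<in> carrier A" for a b
    using f that by (simp add: inj_on_eq_iff)
  show "cstar_algebra (transport f A)"
  proof (rule cstar_algebraI, goal_cases)
    case (32 s)
    have s: "g (s n) \<in> carrier A" "s n = f (g (s n))" for n
      using 32(1)[of n] by (auto simp: simps g)
    have "\<exists>N. \<forall>m\<ge>N. \<forall>n\<ge>N. nrm A (g (s m) \<ominus>\<^bsub>A\<^esub> g (s n)) < e" if "e > 0" for e
      using 32(2)[OF that] s(1) by (simp add: simps g minus_eq_scale)
    then obtain l where l: "tends (\<lambda>n. g (s n)) l" using complete_seq[of "\<lambda>n. g (s n)"] s by blast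
    show ?case
    proof
      show "f l \<in> carrier (transport f A)" using tends_carrier[OF l] by (simp add: simps)
      show "(\<lambda>n. nrm (transport f A) (s n \<oplus>\<^bsub>transport f A\<^esub> (- 1) \<odot>\<^bsub>transport f A\<^esub> f l)) \<longlonglongrightarrow> 0"
        using l s(1) tends_carrier(2)[OF l] by (simp add: simps g tends_def flip: minus_eq_scale)
    qed
  qed (auto simp: simps g feq m_assoc l_distr r_distr M.a_ac scale_add_left scale_add_right
      nrm_nonneg nrm_eq_zero nrm_triangle nrm_mult cstar_identity)
qed

theorem real_rotation_algebra_exists:
  "\<exists>(R :: real cstar) u v. cstar_algebra R \<and> rotation_relations \<theta> R u v \<and> \<one>\<^bsub>R\<^esub> \<noteq> \<zero>\<^bsub>R\<^esub>"
proof -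
  obtain h :: "(int \<times> int \<Rightarrow> complex) \<Rightarrow> real" where h: "inj h" using matrices_inject_reals by blast
  define f where "f = (\<lambda>T. h (\<lambda>(i, j). coord (blinfun_apply T (basis j)) i))"
  have f: "inj_on f (carrier operator_algebra)"
    using comp_inj_on[OF inj_matrix inj_on_subset[OF h]] by (simp add: f_def comp_def)
  let ?R = "transport f operator_algebra"
  interpret cstar_hom operator_algebra ?R f
    by (intro cstar_hom.intro cstar_hom_axioms.intro cstar_algebra_operator_algebra
        transport[OF cstar_algebra_operator_algebra f])
  let ?u = "Shift 1" and ?v = "Diag (\<lambda>i. exp (2 * pi * \<i> * \<theta>) powi i)"
  note rel = operator_rotation_relations[of \<theta>, unfolded rotation_relations_def]
  have c: "?u \<in> carrier operator_algebra" "?v \<in> carrier operator_algebra"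
    by (simp_all add: Shift_ops Diag_ops)
  have "rotation_relations \<theta> ?R (f ?u) (f ?v)"
    unfolding rotation_relations_def
    using rel unitary c mult[OF c(2) c(1)] mult[OF c] scale[OF A.m_closed[OF c]] by metis
  moreover have "\<one>\<^bsub>?R\<^esub> \<noteq> \<zero>\<^bsub>?R\<^esub>"
    using operator_nonzero inj_onD[OF f, of "\<one>\<^bsub>operator_algebra\<^esub>" "\<zero>\<^bsub>operator_algebra\<^esub>"] one zero
      A.one_closed A.M.zero_closed by metis
  ultimately show ?thesis using B.cstar_algebra_axioms by blast
qed

section \<open>The isomorphism\<close>

lemma aperiodic_irrational:
  assumes "\<theta> \<notin> \<rat>" shows "aperiodic (exp (2 * pi * \<i> * complex_of_real \<theta>))"
  unfolding aperiodic_def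
proof (intro conjI allI impI notI)
  show "cmod (exp (2 * pi * \<i> * complex_of_real \<theta>)) = 1" by (simp add: norm_exp_eq_Re)
  fix k :: int assume k: "k \<noteq> 0" and "exp (2 * pi * \<i> * complex_of_real \<theta>) powi k = 1"
  hence "exp (of_int k * (2 * pi * \<i> * complex_of_real \<theta>)) = 1" by (simp add: exp_power_int mult.commute)
  then obtain n :: int where "Im (of_int k * (2 * pi * \<i> * complex_of_real \<theta>)) = of_int (2 * n) * pi"
    by (auto simp: exp_eq_1)
  hence "of_int k * \<theta> * (2 * pi) = of_int n * (2 * pi)" by (simp add: algebra_simps)
  hence "of_int k * \<theta> = of_int n" by simp
  hence "\<theta> = of_int n / of_int k" using k by (simp add: field_simps)
  hence "\<theta> \<in> \<rat>" by simp
  thus False using assms by simp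
qed

lemma cnj_exp_rotation: "exp (- (2 * pi * \<i> * complex_of_real \<theta>)) = cnj (exp (2 * pi * \<i> * complex_of_real \<theta>))"
  by (simp add: exp_cnj)

lemma (in circle_calculus) weighted_relations_iff:
  assumes \<gamma>: "continuous_on circle \<gamma>"
  shows "weighted_relations \<theta> \<gamma> A x w \<longleftrightarrow> x \<in> carrier A \<and>
    star A x \<otimes> x = \<Phi> (\<lambda>z\<in>circle. complex_of_real (\<gamma> z)) \<and>
    x \<otimes> star A x = \<Phi> (rot (cnj (exp (2 * pi * \<i> * \<theta>))) (\<lambda>z\<in>circle. complex_of_real (\<gamma> z))) \<and>
    x \<otimes> w = cnj (exp (2 * pi * \<i> * \<theta>)) \<odot> (w \<otimes> x)"
proof -
  have c: "continuous_on circle (\<lambda>z. complex_of_real (\<gamma> z))" using \<gamma> by (rule continuous_on_of_real)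
  have n: "cmod (cnj (exp (2 * pi * \<i> * complex_of_real \<theta>))) = 1" by (simp add: norm_exp_eq_Re)
  show ?thesis
    unfolding weighted_relations_def cnj_exp_rotation cfc_w[OF c] cfc_scaled_w[OF n c]
    using unitary_w by blast
qed

lemma weighted_hom_isometric:
  assumes A: "circle_calculus A \<Phi>" and \<gamma>: "continuous_on circle \<gamma>" and \<theta>: "\<theta> \<notin> \<rat>"
    and rel: "weighted_relations \<theta> \<gamma> A x (\<Phi> (\<lambda>z\<in>circle. z))"
    and gen: "carrier (cstar_generated A {x, \<Phi> (\<lambda>z\<in>circle. z)}) = carrier A"
    and R: "circle_calculus R \<Psi>" and g: "cstar_hom A R g"
    and gw: "g (\<Phi> (\<lambda>z\<in>circle. z)) = \<Psi> (\<lambda>z\<in>circle. z)" and a: "a \<in> carrier A"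
  shows "nrm R (g a) = nrm A a"
proof -
  interpret A: circle_calculus A \<Phi> by fact
  interpret R: circle_calculus R \<Psi> by fact
  interpret g: cstar_hom A R g by fact
  let ?\<gamma> = "\<lambda>z\<in>circle. complex_of_real (\<gamma> z)" and ?\<mu> = "exp (2 * pi * \<i> * \<theta>)"
  have gc: "?\<gamma> \<in> carrier circle_algebra"
    using \<gamma> by (simp del: restrict_apply)
  have n: "cmod (cnj ?\<mu>) = 1" by (simp add: norm_exp_eq_Re)
  note r = rel[unfolded A.weighted_relations_iff[OF \<gamma>]]
  interpret weighted_pair A \<Phi> x ?\<mu> ?\<gamma> "rot (cnj ?\<mu>) ?\<gamma>"
    by unfold_locales (use r gc rot_closed[OF n gc] aperiodic_irrational[OF \<theta>] in blast)+
  have "(g \<circ> \<Phi>) f = \<Psi> f" if "f \<in> carrier circle_algebra" for f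
    using circle_homs_eq[OF cstar_hom_compose[OF A.cstar_hom_axioms g] R.cstar_hom_axioms _ that] gw
    by simp
  hence "nrm R (g (\<Phi> f)) = supnorm circle f" if "f \<in> carrier circle_algebra" for f
    using R.iso that by simp
  from hom_isometric[OF gen g this a] show ?thesis .
qed

lemma rotation_calculus:
  assumes R: "cstar_algebra R" "rotation_relations \<theta> R u v" "\<one>\<^bsub>R\<^esub> \<noteq> \<zero>\<^bsub>R\<^esub>" and \<theta>: "\<theta> \<notin> \<rat>"
  obtains \<Psi> where "circle_calculus R \<Psi>" "\<Psi> (\<lambda>z\<in>circle. z) = v"
proof -
  have u: "unitary_in R u" "unitary_in R v" "v \<otimes>\<^bsub>R\<^esub> u = exp (2 * pi * \<i> * \<theta>) \<odot>\<^bsub>R\<^esub> (u \<otimes>\<^bsub>R\<^esub> v)"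
    using R(2) by (auto simp: rotation_relations_def)
  note ap = aperiodic_irrational[OF \<theta>]
  obtain \<Psi> where \<Psi>: "cstar_hom circle_algebra R \<Psi>" "\<Psi> (\<lambda>z\<in>circle. z) = v"
    using circle_calculus_exists[OF ap R(1) u(2)] by blast
  have "circle_calculus R \<Psi>"
    by (intro circle_calculus.intro circle_calculus_axioms.intro \<Psi>(1)
        circle_calculus_isometric[OF ap R(1) u R(3) \<Psi>])
  thus ?thesis using that \<Psi>(2) by blast
qed

lemma (in circle_calculus) rotation_weighted:
  assumes \<gamma>: "continuous_on circle \<gamma>" "\<And>z. z \<in> circle \<Longrightarrow> 0 \<le> \<gamma> z"
    and rel: "rotation_relations \<theta> A u w"
    and y: "y = u \<otimes> \<Phi> (\<lambda>z\<in>circle. complex_of_real (sqrt (\<gamma> z)))"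
  shows "weighted_relations \<theta> \<gamma> A y w"
proof -
  let ?\<mu> = "exp (2 * pi * \<i> * \<theta>)"
  let ?s = "\<lambda>z\<in>circle. complex_of_real (sqrt (\<gamma> z))" and ?g = "\<lambda>z\<in>circle. complex_of_real (\<gamma> z)"
  have uu: "unitary_in A u" and wu: "w \<otimes> u = ?\<mu> \<odot> (u \<otimes> w)"
    using rel by (auto simp: rotation_relations_def)
  note u = B.unitaryD[OF uu] B.unitaryD[OF unitary_w]
  have n: "cmod ?\<mu> = 1" "cmod (cnj ?\<mu>) = 1" by (simp_all add: norm_exp_eq_Re)
  have uw: "u \<otimes> w = cnj ?\<mu> \<odot> (w \<otimes> u)"
    using circle_mult_cnj[OF n(1)] u by (simp add: wu mult.commute)
  have sc: "?s \<in> carrier circle_algebra"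
    using continuous_on_real_sqrt[OF \<gamma>(1)] by (simp del: restrict_apply)
  have gc: "?g \<in> carrier circle_algebra"
    using \<gamma>(1) by (simp del: restrict_apply)
  have ss: "star circle_algebra ?s = ?s" by (auto simp: restrict_def fun_eq_iff)
  have sg: "?s \<otimes>\<^bsub>circle_algebra\<^esub> ?s = ?g"
    using \<gamma>(2) by (auto simp: restrict_def fun_eq_iff simp flip: of_real_mult)
  note [simp del] = cont_algebra_simps restrict_apply
  have star_s: "star A (\<Phi> ?s) = \<Phi> ?s" using sc ss by (simp flip: star)
  have sq: "\<Phi> ?s \<otimes> \<Phi> ?s = \<Phi> ?g" using sc sg by (simp flip: mult)
  have yy: "star A y = \<Phi> ?s \<otimes> star A u" using u sc star_s by (simp add: y)
  show ?thesis
    unfolding weighted_relations_iff[OF \<gamma>(1)]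
  proof (intro conjI)
    show "y \<in> carrier A" using u sc by (simp add: y)
    have "star A y \<otimes> y = \<Phi> ?s \<otimes> ((star A u \<otimes> u) \<otimes> \<Phi> ?s)"
      unfolding yy unfolding y using u(1,2) sc by (simp add: B.m_assoc)
    thus "star A y \<otimes> y = \<Phi> ?g" using u sc sq by simp
    have "y \<otimes> star A y = (u \<otimes> (\<Phi> ?s \<otimes> \<Phi> ?s)) \<otimes> star A u"
      unfolding yy unfolding y using u(1,2) sc by (simp add: B.m_assoc)
    also have "\<dots> = \<Phi> (rot (cnj ?\<mu>) ?g) \<otimes> (u \<otimes> star A u)"
      unfolding sq intertwine[OF u(1) n(2) uw gc] using u(1,2) rot_closed[OF n(2) gc] by (simp add: B.m_assoc)
    finally show "y \<otimes> star A y = \<Phi> (rot (cnj ?\<mu>) ?g)"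
      using u rot_closed[OF n(2) gc] by simp
    have comm: "\<Phi> ?s \<otimes> w = w \<otimes> \<Phi> ?s"
    proof -
      have "?s \<otimes>\<^bsub>circle_algebra\<^esub> (\<lambda>z\<in>circle. z) = (\<lambda>z\<in>circle. z) \<otimes>\<^bsub>circle_algebra\<^esub> ?s"
        by (auto simp: cont_algebra_simps restrict_def fun_eq_iff)
      thus ?thesis using sc circle_id_closed by (simp flip: mult)
    qed
    have "y \<otimes> w = (u \<otimes> w) \<otimes> \<Phi> ?s"
      unfolding y using u sc comm by (simp add: B.m_assoc)
    also have "\<dots> = cnj ?\<mu> \<odot> (w \<otimes> y)"
      unfolding uw y using u sc by (simp add: B.m_assoc)
    finally show "y \<otimes> w = cnj ?\<mu> \<odot> (w \<otimes> y)" .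
  qed
qed

lemma (in cstar_hom) isometric_image:
  assumes iso: "\<And>a. a \<in> carrier A \<Longrightarrow> nrm B (h a) = nrm A a" and S: "S \<subseteq> carrier A"
  shows "h ` carrier (cstar_generated A S) = carrier (cstar_generated B (h ` S))"
proof
  have hS: "h ` S \<subseteq> carrier B" using S by auto
  show "h ` carrier (cstar_generated A S) \<subseteq> carrier (cstar_generated B (h ` S))"
    using image_generated[OF S _ hS] by blast
  define H where "H = carrier (cstar_generated A S)"
  note H = A.cstar_subalgebraD[OF A.generated_subalgebra[OF S], folded H_def]
  have Hc: "a \<in> carrier A" if "a \<in> H" for a using H(1) that by blast
  have "cstar_subalgebra (h ` H) B"
  proof (rule B.cstar_subalgebraI)
    show "h ` H \<subseteq> carrier B" using Hc by auto
    show "\<one>\<^bsub>B\<^esub> \<in> h ` H" using H(2) one by force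
    fix p q c assume "p \<in> h ` H"
    then obtain a where a: "a \<in> H" "p = h a" by blast
    show "c \<odot>\<^bsub>B\<^esub> p \<in> h ` H" using a H(5)[of a c] scale[OF Hc] by (metis imageI)
    show "star B p \<in> h ` H" using a H(6)[of a] star[OF Hc] by (metis imageI)
    assume "q \<in> h ` H"
    then obtain b where b: "b \<in> H" "q = h b" by blast
    show "p \<otimes>\<^bsub>B\<^esub> q \<in> h ` H" using a b H(3)[of a b] mult[OF Hc Hc] by (metis imageI)
    show "p \<oplus>\<^bsub>B\<^esub> q \<in> h ` H" using a b H(4)[of a b] add[OF Hc Hc] by (metis imageI)
  next
    fix s l assume s: "\<And>n. s n \<in> h ` H" "B.tends s l"
    have "\<forall>n. \<exists>t. t \<in> H \<and> s n = h t" using s(1) by blast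
    from choice[OF this] obtain t where t: "\<And>n. t n \<in> H" "\<And>n. s n = h (t n)" by blast
    have d: "nrm A (t m \<ominus>\<^bsub>A\<^esub> t n) = nrm B (s m \<ominus>\<^bsub>B\<^esub> s n)" for m n
      using iso[of "t m \<ominus>\<^bsub>A\<^esub> t n"] Hc t by simp
    have "\<exists>N. \<forall>m\<ge>N. \<forall>n\<ge>N. nrm A (t m \<ominus>\<^bsub>A\<^esub> t n) < e" if "e > 0" for e
      using B.tends_Cauchy[OF s(2) that] by (simp only: d)
    then obtain k where k: "A.tends t k" using A.complete_seq[of t] Hc t(1) by blast
    have "s = (\<lambda>n. h (t n))" by (rule ext) (rule t(2))
    hence "B.tends s (h k)" using tends[OF k] by simp
    hence "l = h k" using s(2) B.tends_unique by blast
    thus "l \<in> h ` H" using H(7)[OF t(1) k] by blast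
  qed
  from B.generated_least[OF this, of "h ` S"] show "carrier (cstar_generated B (h ` S)) \<subseteq> h ` carrier (cstar_generated A S)"
    using A.generators_in[of S] unfolding H_def by blast
qed

lemma (in cstar_hom) isometric_inj:
  assumes iso: "\<And>a. a \<in> carrier A \<Longrightarrow> nrm B (h a) = nrm A a"
  shows "inj_on h (carrier A)"
proof (rule inj_onI)
  fix a b assume "a \<in> carrier A" "b \<in> carrier A" "h a = h b"
  thus "a = b" using iso[of "a \<ominus>\<^bsub>A\<^esub> b"] A.nrm_diff_eq_zero[of a b] by (simp add: B.diff_self)
qed

theorem theorem2p5:
  fixes \<theta> :: real and \<gamma> :: "complex \<Rightarrow> real"
    and A :: "'a cstar" and x w :: 'a
    and B :: "'b cstar" and u v y :: 'b
  assumes "\<theta> \<notin> \<rat>"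
    and "continuous_on (sphere 0 1) \<gamma>"
    and "\<And>z. z \<in> sphere 0 1 \<Longrightarrow> 0 \<le> \<gamma> z"
    and "is_rotation_algebra \<theta> B u v"
    and "is_weighted_rotation_algebra \<theta> \<gamma> A x w"
    and "y = u \<otimes>\<^bsub>B\<^esub> cstar_sqrt B (cfc B v (\<lambda>z. complex_of_real (\<gamma> z)))"
  shows "\<exists>\<phi>. star_hom A (cstar_generated B {y, v}) \<phi> \<and> \<phi> x = y \<and> \<phi> w = v \<and>
    (\<forall>\<psi>. star_hom A (cstar_generated B {y, v}) \<psi> \<and> \<psi> x = y \<and> \<psi> w = v \<longrightarrow>
      (\<forall>a\<in>carrier A. \<psi> a = \<phi> a)) \<and>
    star_iso A (cstar_generated B {y, v}) \<phi>"
proof -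
  note \<theta> = assms(1) and \<gamma> = assms(2,3)
  have B: "cstar_algebra B" "rotation_relations \<theta> B u v" "carrier (cstar_generated B {u, v}) = carrier B"
    and B_univ: "\<And>(R :: real cstar) u' v'. \<lbrakk>cstar_algebra R; rotation_relations \<theta> R u' v'\<rbrakk> \<Longrightarrow>
      \<exists>h. star_hom B (cstar_generated R {u', v'}) h \<and> h u = u' \<and> h v = v'"
    using assms(4) unfolding is_rotation_algebra_def by blast+
  have A: "cstar_algebra A" "weighted_relations \<theta> \<gamma> A x w" "carrier (cstar_generated A {x, w}) = carrier A"
    and A_univ: "\<And>(R :: real cstar) x' w'. \<lbrakk>cstar_algebra R; weighted_relations \<theta> \<gamma> R x' w'\<rbrakk> \<Longrightarrow>
      \<exists>h. star_hom A (cstar_generated R {x', w'}) h \<and>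
        h ` carrier A = carrier (cstar_generated R {x', w'}) \<and> h x = x' \<and> h w = w'"
    using assms(5) unfolding is_weighted_rotation_algebra_def by blast+
  interpret A: cstar_algebra A by fact
  interpret B: cstar_algebra B by fact
  obtain R :: "real cstar" and u' v' where
    R: "cstar_algebra R" "rotation_relations \<theta> R u' v'" "\<one>\<^bsub>R\<^esub> \<noteq> \<zero>\<^bsub>R\<^esub>"
    using real_rotation_algebra_exists by blast
  interpret R: cstar_algebra R by fact
  have uv': "{u', v'} \<subseteq> carrier R" using R(2) by (auto simp: rotation_relations_def unitary_in_def)
  have uv: "{u, v} \<subseteq> carrier B" using B(2) by (auto simp: rotation_relations_def unitary_in_def)
  obtain h where h: "star_hom B R h" "h u = u'" "h v = v'"
    using B_univ[OF R(1,2)] R.star_hom_generated[OF uv'] by blast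
  interpret h: cstar_hom B R h by unfold_locales (rule h(1))
  have Bne: "\<one>\<^bsub>B\<^esub> \<noteq> \<zero>\<^bsub>B\<^esub>" using R(3) h.one h.zero by metis
  obtain \<Psi> where \<Psi>: "circle_calculus R \<Psi>" "\<Psi> (\<lambda>z\<in>circle. z) = v'"
    by (rule rotation_calculus[OF R \<theta>])
  obtain \<Omega> where \<Omega>: "circle_calculus B \<Omega>" "\<Omega> (\<lambda>z\<in>circle. z) = v"
    by (rule rotation_calculus[OF B(1,2) Bne \<theta>])
  interpret \<Psi>: circle_calculus R \<Psi> by fact
  interpret \<Omega>: circle_calculus B \<Omega> by fact

  \<comment> \<open>The rotation algebra is the weighted one for the constant weight 1.\<close>
  have "weighted_relations \<theta> (\<lambda>_. 1) B u v"
  proof -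
    have one: "(\<lambda>z\<in>circle. complex_of_real (sqrt 1)) = \<one>\<^bsub>circle_algebra\<^esub>" by simp
    have "u = u \<otimes>\<^bsub>B\<^esub> \<Omega> (\<lambda>z\<in>circle. complex_of_real (sqrt 1))"
      unfolding one \<Omega>.one using uv by simp
    from \<Omega>.rotation_weighted[OF _ _ _ this] B(2) \<Omega>(2) show ?thesis by simp
  qed
  hence h_iso: "nrm R (h b) = nrm B b" if "b \<in> carrier B" for b
    using weighted_hom_isometric[OF \<Omega>(1) _ \<theta> _ _ \<Psi>(1) h.cstar_hom_axioms _ that, of "\<lambda>_. 1" u]
      B(3) h(3) by (simp add: \<Omega>(2) \<Psi>(2))

  let ?s = "\<lambda>z\<in>circle. complex_of_real (sqrt (\<gamma> z))"
  have sc: "?s \<in> carrier circle_algebra"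
    using continuous_on_real_sqrt[OF \<gamma>(1)] by (simp del: restrict_apply)
  have y: "y = u \<otimes>\<^bsub>B\<^esub> \<Omega> ?s"
  proof -
    have "cfc B v (\<lambda>z. complex_of_real (\<gamma> z)) = \<Omega> (\<lambda>z\<in>circle. complex_of_real (\<gamma> z))"
      using \<Omega>.cfc_w[OF continuous_on_of_real[OF \<gamma>(1)]] by (simp only: \<Omega>(2))
    thus ?thesis using assms(6) \<Omega>.cstar_sqrt_\<Phi>[OF \<gamma>(1)] by simp
  qed
  have yc: "y \<in> carrier B" using uv sc by (simp add: y del: cont_algebra_simps)
  have yv: "{y, v} \<subseteq> carrier B" using yc uv by blast
  have relB: "weighted_relations \<theta> \<gamma> B y v"
    using \<Omega>.rotation_weighted[OF \<gamma> _ y] B(2) \<Omega>(2) by simp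
  define y' where "y' = u' \<otimes>\<^bsub>R\<^esub> \<Psi> ?s"
  have relR: "weighted_relations \<theta> \<gamma> R y' v'"
    using \<Psi>.rotation_weighted[OF \<gamma> _ y'_def] R(2) \<Psi>(2) by simp
  have "(h \<circ> \<Omega>) ?s = \<Psi> ?s"
    using circle_homs_eq[OF cstar_hom_compose[OF \<Omega>.cstar_hom_axioms h.cstar_hom_axioms]
      \<Psi>.cstar_hom_axioms _ sc] h(3) \<Omega>(2) \<Psi>(2) by simp
  hence hy: "h y = y'" using uv sc h(2) by (simp add: y y'_def del: cont_algebra_simps)
  have yv': "{y', v'} \<subseteq> carrier R" using hy h(3) yv by auto

  obtain g where g: "star_hom A R g" "g ` carrier A = carrier (cstar_generated R {y', v'})"
    "g x = y'" "g w = v'"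
    using A_univ[OF R(1) relR] R.star_hom_generated[OF yv'] by blast
  interpret g: cstar_hom A R g by unfold_locales (rule g(1))
  have xw: "{x, w} \<subseteq> carrier A" and wu: "unitary_in A w"
    using A(2) by (auto simp: weighted_relations_def unitary_in_def)
  obtain \<Phi> where \<Phi>: "cstar_hom circle_algebra A \<Phi>" "\<Phi> (\<lambda>z\<in>circle. z) = w"
    using circle_calculus_exists[OF aperiodic_irrational[OF \<theta>] A(1) wu] by blast
  interpret \<Phi>: cstar_hom circle_algebra A \<Phi> by fact
  have g\<Phi>: "(g \<circ> \<Phi>) f = \<Psi> f" if "f \<in> carrier circle_algebra" for f
    using circle_homs_eq[OF cstar_hom_compose[OF \<Phi>(1) g.cstar_hom_axioms] \<Psi>.cstar_hom_axioms _ that]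
      g(4) \<Phi>(2) \<Psi>(2) by simp
  have \<Phi>_calc: "circle_calculus A \<Phi>"
  proof (intro circle_calculus.intro circle_calculus_axioms.intro \<Phi>(1))
    fix f assume f: "f \<in> carrier circle_algebra"
    have "supnorm circle f \<le> nrm A (\<Phi> f)"
      using g.contractive[OF \<Phi>.closed[OF f]] g\<Phi>[OF f] \<Psi>.iso[OF f] by simp
    thus "nrm A (\<Phi> f) = supnorm circle f" using \<Phi>.contractive[OF f] by simp
  qed
  have g_iso: "nrm R (g a) = nrm A a" if "a \<in> carrier A" for a
    using weighted_hom_isometric[OF \<Phi>_calc \<gamma>(1) \<theta> _ _ \<Psi>(1) g.cstar_hom_axioms _ that, of x]
      A(2,3) g(4) by (simp add: \<Phi>(2) \<Psi>(2))

  define C where "C = cstar_generated B {y, v}"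
  have C_sub: "carrier C \<subseteq> carrier B"
    unfolding C_def by (rule B.cstar_subalgebraD(1)[OF B.generated_subalgebra[OF yv]])
  have h_inj: "inj_on h (carrier C)" by (rule inj_on_subset[OF h.isometric_inj[OF h_iso] C_sub])
  have g_inj: "inj_on g (carrier A)" by (rule g.isometric_inj[OF g_iso])
  have hC: "h ` carrier C = g ` carrier A"
    using h.isometric_image[OF h_iso yv] g(2) hy h(3) by (simp add: C_def)
  define \<phi> where "\<phi> a = inv_into (carrier C) h (g a)" for a
  have \<phi>: "\<phi> a \<in> carrier C" "h (\<phi> a) = g a" if "a \<in> carrier A" for a
  proof -
    have "g a \<in> h ` carrier C" using hC that by blast
    thus "\<phi> a \<in> carrier C" "h (\<phi> a) = g a"
      by (auto simp: \<phi>_def inv_into_into f_inv_into_f)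
  qed
  have \<phi>_eq: "\<phi> a = b" if "a \<in> carrier A" "b \<in> carrier B" "h b = g a" for a b
    using inj_onD[OF h.isometric_inj[OF h_iso], of "\<phi> a" b] \<phi>[OF that(1)] that C_sub by auto
  have \<phi>B: "\<phi> a \<in> carrier B" if "a \<in> carrier A" for a using \<phi>(1)[OF that] C_sub by blast
  have \<phi>_hom: "star_hom A B \<phi>"
    unfolding star_hom_def
    by (intro conjI ballI allI ring_hom_memI \<phi>B) (auto intro!: \<phi>_eq simp: \<phi>B \<phi>(2))
  have hom: "star_hom A C \<phi>"
    unfolding C_def B.star_hom_generated[OF yv] using \<phi>_hom \<phi>(1) by (auto simp: C_def)
  have vals: "\<phi> x = y" "\<phi> w = v"
    using xw yc uv hy h(3) g(3,4) by (auto intro!: \<phi>_eq)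
  have bij: "bij_betw \<phi> (carrier A) (carrier C)"
    unfolding bij_betw_def
  proof
    show "inj_on \<phi> (carrier A)"
      by (rule inj_onI) (metis \<phi>(2) g_inj inj_onD)
    have "b \<in> \<phi> ` carrier A" if b: "b \<in> carrier C" for b
    proof -
      have "h b \<in> g ` carrier A" using hC b by blast
      then obtain a where a: "a \<in> carrier A" "h b = g a" by blast
      have "\<phi> a = b" by (rule \<phi>_eq[OF a(1) _ a(2)]) (use b C_sub in auto)
      thus ?thesis using a(1) by blast
    qed
    thus "\<phi> ` carrier A = carrier C" using \<phi>(1) by blast
  qed
  interpret \<phi>: cstar_hom A B \<phi> by unfold_locales (rule \<phi>_hom)
  have unique: "\<psi> a = \<phi> a"
    if \<psi>: "star_hom A C \<psi>" "\<psi> x = y" "\<psi> w = v" and a: "a \<in> carrier A" for \<psi> a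
  proof -
    have "star_hom A B \<psi>" using \<psi>(1) unfolding C_def B.star_hom_generated[OF yv] by blast
    hence "cstar_hom A B \<psi>" by unfold_locales
    thus ?thesis
    proof (rule star_homs_eq_on_generated[OF _ \<phi>.cstar_hom_axioms xw])
      show "\<psi> c = \<phi> c" if "c \<in> {x, w}" for c using that \<psi>(2,3) vals by auto
      show "a \<in> carrier (cstar_generated A {x, w})" using a A(3) by simp
    qed
  qed
  show ?thesis
    unfolding C_def[symmetric] star_iso_def
  proof (intro exI[of _ \<phi>] conjI allI impI ballI hom vals bij)
    fix \<psi> a assume "star_hom A C \<psi> \<and> \<psi> x = y \<and> \<psi> w = v" and "a \<in> carrier A"
    thus "\<psi> a = \<phi> a" by (intro unique) auto
  qed
qed

end
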